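(* Let $G$ be an admissible graph of rank $n$ with $k$ legs and $N$ internal edges. Consider the two constructions of the compactified cell $\tilde\sigma_G$ described in the context: (1) as the closure of the image of the map $r$, and (2) by the sequence of blowups of $\overline{\sigma_G}\subset\mathbb P(\mathbb R^N)$ along the (strict transforms of the) subspaces $L_\gamma$, where $\gamma$ runs over the proper core subgraphs of $G$. Both constructions are equivalent, i.e. for every admissible graph $G$ both compactified cells are isomorphic (as smooth varieties).
   Context: Graphs. A graph $G$ has a finite vertex set, a finite set $E(G)$ of internal edges (multi-edges and self-loops allowed), and $k$ external half-edges (legs), each attached to a vertex. A subgraph $\gamma\subset G$ is determined by a subset $E(\gamma)\subset E(G)$; its vertices are the endpoints of its edges, and it has no legs. The rank $|G|$ is the first Betti number. $G$ is core (or 1PI) if deleting any internal edge lowers its rank; core subgraphs are taken nonempty and may be disconnected. $G$ is admissible (of rank $n$ with $k$ legs) if it is connected, $|G|=n$, it is core, and every vertex has valence at least $3$ (legs are counted). Simplices. For a graph $\gamma$ with edge set $E(\gamma)$ let $\overline{\sigma_\gamma}=\{(x_e)_{e\in E(\gamma)} : x_e\ge 0,\ \sum_e x_e=1\}$ (metrics of volume one, lengths possibly zero). $\sigma_G\subset\overline{\sigma_G}$ is the open simplex (all $x_e>0$) together with those of its faces $\{x_e=0,\ e\in E(F)\}$ (remaining coordinates positive) for which $F$ is a forest in $G$ (a subgraph of rank $0$). Construction 1. For each core subgraph $\gamma\subset G$ (including $G$ itself) let $r_\gamma:\sigma_G\to\overline{\sigma_\gamma}$ restrict a metric to $\gamma$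 and rescale it to volume one. The product of these maps is an embedding $r:\sigma_G\to\prod_{\gamma\subset G\text{ core}}\overline{\sigma_\gamma}$, and the compactified cell is $\overline{r(\sigma_G)}$, the closure of the image of $r$. Construction 2. Describe the closed simplex projectively as $\overline{\sigma_G}=\{[x_1:\dots:x_N] : x_i\ge 0\}\subset\mathbb P_G:=\mathbb P(\mathbb R^N)$ (coordinates indexed by $E(G)$; similarly $\mathbb P_\gamma=\mathbb P(\mathbb R^{E(\gamma)})$). It is identified with the standard simplex via $[x_1:\dots:x_N]\mapsto (x_1+\dots+x_N)^{-1}(x_1,\dots,x_N)$. For a proper core subgraph $\gamma\subset G$ let $L_\gamma=\{x_e=0 \text{ for all } e\in E(\gamma)\}\subset\overline{\sigma_G}$. The compactified cell is the subset of $\prod_{\gamma}\mathbb P_\gamma$ obtained from $\overline{\sigma_G}$ by a sequence of blowups along the (strict transforms of the) subspaces $L_\gamma$, for all proper core subgraphs $\gamma$ of $G$, proceeding along subspaces of increasing dimension (so the order is determined by inclusion of subgraphs, while for disjoint subgraphs the order does not matter). *)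

theory Defs
  imports "HOL-Analysis.Analysis"
begin

section \<open>Graphs with legs\<close>

text \<open>
  \<open>ends e\<close> is the set of endpoints of an internal edge: a singleton for a self-loop, a
  two-element set otherwise.  Legs are attached to vertices by \<open>root\<close>.
\<close>

record ('v, 'e, 'l) graph =
  verts :: "'v set"
  edges :: "'e set"
  ends :: "'e \<Rightarrow> 'v set"
  legs :: "'l set"
  root :: "'l \<Rightarrow> 'v"

definition wf_graph :: "('v, 'e, 'l) graph \<Rightarrow> bool" where
  "wf_graph G \<longleftrightarrow> finite (verts G) \<and> finite (edges G) \<and> finite (legs G) \<and>
     (\<forall>e\<in>edges G. ends G e \<subseteq> verts G \<and> card (ends G e) \<in> {1, 2}) \<and>
     (\<forall>l\<in>legs G. root G l \<in> verts G)"

definition everts :: "('v, 'e, 'l) graph \<Rightarrow> 'e set \<Rightarrow> 'v set" where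
  "everts G S = (\<Union>e\<in>S. ends G e)"

definition joined :: "('v, 'e, 'l) graph \<Rightarrow> 'v set \<Rightarrow> 'e set \<Rightarrow> ('v \<times> 'v) set" where
  "joined G W S = {(u, v). u \<in> W \<and> v \<in> W \<and> (u, v) \<in> {(a, b). \<exists>e\<in>S. ends G e = {a, b}}\<^sup>*}"

definition components :: "('v, 'e, 'l) graph \<Rightarrow> 'v set \<Rightarrow> 'e set \<Rightarrow> 'v set set" where
  "components G W S = W // joined G W S"

text \<open>The first Betti number of the graph with vertex set \<open>W\<close> and edge set \<open>S\<close>.\<close>

definition betti :: "('v, 'e, 'l) graph \<Rightarrow> 'v set \<Rightarrow> 'e set \<Rightarrow> int" where
  "betti G W S = int (card S) - int (card W) + int (card (components G W S))"

definition core_on :: "('v, 'e, 'l) graph \<Rightarrow> 'v set \<Rightarrow> 'e set \<Rightarrow> bool" where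
  "core_on G W S \<longleftrightarrow> (\<forall>e\<in>S. betti G W (S - {e}) < betti G W S)"

definition connected_graph :: "('v, 'e, 'l) graph \<Rightarrow> bool" where
  "connected_graph G \<longleftrightarrow> verts G \<noteq> {} \<and>
     (\<forall>u\<in>verts G. \<forall>v\<in>verts G. (u, v) \<in> joined G (verts G) (edges G))"

definition valence :: "('v, 'e, 'l) graph \<Rightarrow> 'v \<Rightarrow> nat" where
  "valence G v =
     (\<Sum>e\<in>edges G. if ends G e = {v} then 2 else if v \<in> ends G e then 1 else 0)
     + card {l \<in> legs G. root G l = v}"

definition admissible :: "('v, 'e, 'l) graph \<Rightarrow> nat \<Rightarrow> nat \<Rightarrow> bool" where
  "admissible G n k \<longleftrightarrow> wf_graph G \<and> card (legs G) = k \<and> connected_graph G \<and>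
     betti G (verts G) (edges G) = int n \<and> core_on G (verts G) (edges G) \<and>
     (\<forall>v\<in>verts G. 3 \<le> valence G v)"

text \<open>Subgraphs are given by their edge sets.\<close>

definition cores :: "('v, 'e, 'l) graph \<Rightarrow> 'e set set" where
  "cores G = {\<gamma>. \<gamma> \<subseteq> edges G \<and> \<gamma> \<noteq> {} \<and> core_on G (everts G \<gamma>) \<gamma>}"

definition proper_cores :: "('v, 'e, 'l) graph \<Rightarrow> 'e set set" where
  "proper_cores G = {\<gamma> \<in> cores G. \<gamma> \<noteq> edges G}"

definition forest :: "('v, 'e, 'l) graph \<Rightarrow> 'e set \<Rightarrow> bool" where
  "forest G F \<longleftrightarrow> F \<subseteq> edges G \<and> betti G (everts G F) F = 0"


section \<open>Spaces with regular functions\<close>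

text \<open>
  The cells are not varieties but closed semialgebraic subsets (with boundary and corners) of
  smooth real varieties.  We therefore use the classical notion of a space with functions: a
  topological space (the Euclidean topology in all cases below) with, for every open set, the
  real-valued functions regular there.  Regular functions are those which locally are rational
  expressions, with nowhere vanishing denominators, in given generators.  Values outside the open
  set are irrelevant.
\<close>

record 'a rspace =
  rtop :: "'a topology"
  reg :: "'a set \<Rightarrow> ('a \<Rightarrow> real) set"

abbreviation pts :: "'a rspace \<Rightarrow> 'a set" where
  "pts X \<equiv> topspace (rtop X)"

inductive_set rational_in :: "'a set \<Rightarrow> ('a \<Rightarrow> real) set \<Rightarrow> ('a \<Rightarrow> real) set"
  for V :: "'a set" and F :: "('a \<Rightarrow> real) set" where
  rat_const: "(\<lambda>_. c) \<in> rational_in V F"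
| rat_gen: "f \<in> F \<Longrightarrow> f \<in> rational_in V F"
| rat_add: "f \<in> rational_in V F \<Longrightarrow> g \<in> rational_in V F \<Longrightarrow> (\<lambda>x. f x + g x) \<in> rational_in V F"
| rat_mult: "f \<in> rational_in V F \<Longrightarrow> g \<in> rational_in V F \<Longrightarrow> (\<lambda>x. f x * g x) \<in> rational_in V F"
| rat_inverse: "f \<in> rational_in V F \<Longrightarrow> \<forall>x\<in>V. f x \<noteq> 0 \<Longrightarrow> (\<lambda>x. inverse (f x)) \<in> rational_in V F"

text \<open>\<open>K\<close> is a set of pairs \<open>(W, g)\<close>, with \<open>g\<close> a generator defined on \<open>W\<close>.\<close>

definition gen_space :: "'a topology \<Rightarrow> ('a set \<times> ('a \<Rightarrow> real)) set \<Rightarrow> 'a rspace" where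
  "gen_space T K = \<lparr> rtop = T, reg = (\<lambda>U. {f. openin T U \<and>
     (\<forall>p\<in>U. \<exists>V. openin T V \<and> p \<in> V \<and> V \<subseteq> U \<and>
        (\<exists>h \<in> rational_in V {g. \<exists>W. (W, g) \<in> K \<and> V \<subseteq> W}. \<forall>x\<in>V. f x = h x))}) \<rparr>"

definition sub_space :: "'a rspace \<Rightarrow> 'a set \<Rightarrow> 'a rspace" where
  "sub_space X A = gen_space (subtopology (rtop X) A)
     {(U \<inter> A, f) | U f. openin (rtop X) U \<and> f \<in> reg X U}"

definition prod_space :: "'a rspace \<Rightarrow> 'b rspace \<Rightarrow> ('a \<times> 'b) rspace" where
  "prod_space X Y = gen_space (prod_topology (rtop X) (rtop Y))
     ({(U \<times> pts Y, f \<circ> fst) | U f. openin (rtop X) U \<and> f \<in> reg X U} \<union>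
      {(pts X \<times> U, f \<circ> snd) | U f. openin (rtop Y) U \<and> f \<in> reg Y U})"

definition Prod_space :: "'i set \<Rightarrow> ('i \<Rightarrow> 'a rspace) \<Rightarrow> ('i \<Rightarrow> 'a) rspace" where
  "Prod_space I X = gen_space (product_topology (\<lambda>i. rtop (X i)) I)
     {({p \<in> (\<Pi>\<^sub>E j\<in>I. pts (X j)). p i \<in> U}, \<lambda>p. f (p i)) | i U f.
        i \<in> I \<and> openin (rtop (X i)) U \<and> f \<in> reg (X i) U}"

definition line_space :: "real rspace" where
  "line_space = gen_space euclidean {(UNIV, \<lambda>t. t)}"

definition affine_space :: "'i set \<Rightarrow> ('i \<Rightarrow> real) rspace" where
  "affine_space S = Prod_space S (\<lambda>_. line_space)"

definition morphism :: "'a rspace \<Rightarrow> 'b rspace \<Rightarrow> ('a \<Rightarrow> 'b) \<Rightarrow> bool" where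
  "morphism X Y \<phi> \<longleftrightarrow> continuous_map (rtop X) (rtop Y) \<phi> \<and>
     (\<forall>V g. openin (rtop Y) V \<and> g \<in> reg Y V \<longrightarrow> g \<circ> \<phi> \<in> reg X {x \<in> pts X. \<phi> x \<in> V})"

definition isomorphism :: "'a rspace \<Rightarrow> 'b rspace \<Rightarrow> ('a \<Rightarrow> 'b) \<Rightarrow> bool" where
  "isomorphism X Y \<phi> \<longleftrightarrow> morphism X Y \<phi> \<and>
     (\<exists>\<psi>. morphism Y X \<psi> \<and> (\<forall>x\<in>pts X. \<psi> (\<phi> x) = x) \<and> (\<forall>y\<in>pts Y. \<phi> (\<psi> y) = y))"

text \<open>Smoothness allows boundary and corners: the local models are open subsets of orthants.\<close>

definition orthant :: "nat \<Rightarrow> (nat \<Rightarrow> real) rspace" where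
  "orthant d = sub_space (affine_space {..<d}) {x. \<forall>i<d. 0 \<le> x i}"

definition smooth_variety :: "'a rspace \<Rightarrow> bool" where
  "smooth_variety X \<longleftrightarrow> (\<exists>d. \<forall>p\<in>pts X. \<exists>U W \<phi>. openin (rtop X) U \<and> p \<in> U \<and>
     openin (rtop (orthant d)) W \<and> isomorphism (sub_space X U) (sub_space (orthant d) W) \<phi>)"

definition isomorphic_smooth_varieties :: "'a rspace \<Rightarrow> 'b rspace \<Rightarrow> bool" where
  "isomorphic_smooth_varieties X Y \<longleftrightarrow>
     smooth_variety X \<and> smooth_variety Y \<and> (\<exists>\<phi>. isomorphism X Y \<phi>)"


section \<open>Real projective space\<close>

definition nonzero_vectors :: "'i set \<Rightarrow> ('i \<Rightarrow> real) set" where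
  "nonzero_vectors S = {x \<in> S \<rightarrow>\<^sub>E UNIV. \<exists>i\<in>S. x i \<noteq> 0}"

text \<open>The point \<open>[x]\<close> with homogeneous coordinates \<open>x\<close>, as the set of nonzero multiples of \<open>x\<close>.\<close>

definition hpoint :: "'i set \<Rightarrow> ('i \<Rightarrow> real) \<Rightarrow> ('i \<Rightarrow> real) set" where
  "hpoint S x = {\<lambda>i\<in>S. c * x i | c. c \<noteq> 0}"

definition proj_topology :: "'i set \<Rightarrow> ('i \<Rightarrow> real) set topology" where
  "proj_topology S = topology (\<lambda>U. U \<subseteq> hpoint S ` nonzero_vectors S \<and>
     openin (subtopology (product_topology (\<lambda>_. euclidean) S) (nonzero_vectors S))
       {x \<in> nonzero_vectors S. hpoint S x \<in> U})"

definition hratio :: "'i \<Rightarrow> 'i \<Rightarrow> ('i \<Rightarrow> real) set \<Rightarrow> real" where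
  "hratio i j p = (let x = (SOME x. x \<in> p) in x i / x j)"

definition proj_space :: "'i set \<Rightarrow> ('i \<Rightarrow> real) set rspace" where
  "proj_space S = gen_space (proj_topology S)
     {(hpoint S ` {x \<in> nonzero_vectors S. x j \<noteq> 0}, hratio i j) | i j. i \<in> S \<and> j \<in> S}"

lemma openin_proj_topology:
  "openin (proj_topology S) U \<longleftrightarrow> U \<subseteq> hpoint S ` nonzero_vectors S \<and>
     openin (subtopology (product_topology (\<lambda>_. euclidean) S) (nonzero_vectors S))
       {x \<in> nonzero_vectors S. hpoint S x \<in> U}"
proof -
  let ?N = "nonzero_vectors S" and ?q = "hpoint S"
  let ?T = "subtopology (product_topology (\<lambda>_. euclidean) S) ?N :: ('a \<Rightarrow> real) topology"
  have "istopology (\<lambda>U. U \<subseteq> ?q ` ?N \<and> openin ?T {x \<in> ?N. ?q x \<in> U})"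
    unfolding istopology_def
  proof (intro conjI allI impI)
    fix A B
    assume "A \<subseteq> ?q ` ?N \<and> openin ?T {x \<in> ?N. ?q x \<in> A}"
      and "B \<subseteq> ?q ` ?N \<and> openin ?T {x \<in> ?N. ?q x \<in> B}"
    moreover have "{x \<in> ?N. ?q x \<in> A \<inter> B} = {x \<in> ?N. ?q x \<in> A} \<inter> {x \<in> ?N. ?q x \<in> B}"
      by blast
    ultimately show "A \<inter> B \<subseteq> ?q ` ?N" "openin ?T {x \<in> ?N. ?q x \<in> A \<inter> B}"
      by (auto intro: openin_Int)
  next
    fix \<K>
    assume *: "\<forall>A\<in>\<K>. A \<subseteq> ?q ` ?N \<and> openin ?T {x \<in> ?N. ?q x \<in> A}"
    have "{x \<in> ?N. ?q x \<in> \<Union>\<K>} = (\<Union>A\<in>\<K>. {x \<in> ?N. ?q x \<in> A})"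
      by blast
    with * show "openin ?T {x \<in> ?N. ?q x \<in> \<Union>\<K>}"
      by (metis (no_types, lifting) openin_Union imageE)
    from * show "\<Union>\<K> \<subseteq> ?q ` ?N" by blast
  qed
  then show ?thesis
    by (simp add: proj_topology_def)
qed

lemma topspace_proj_topology: "topspace (proj_topology S) = hpoint S ` nonzero_vectors S"
proof -
  have N: "nonzero_vectors S \<subseteq> topspace (product_topology (\<lambda>_. euclidean) S)"
    by (auto simp: nonzero_vectors_def)
  have "{x \<in> nonzero_vectors S. hpoint S x \<in> hpoint S ` nonzero_vectors S} = nonzero_vectors S"
    by blast
  then have "openin (proj_topology S) (hpoint S ` nonzero_vectors S)"
    using N by (simp add: openin_proj_topology openin_subtopology_refl)
  then show ?thesis
    by (metis openin_proj_topology openin_subset openin_topspace subset_antisym)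
qed


section \<open>Blow-ups\<close>

text \<open>
  On the open set \<open>U\<close>, the regular functions \<open>f 0, \<dots>, f (m - 1)\<close> cut out \<open>Z\<close> and
  generate its ideal sheaf.
\<close>

definition generates_ideal ::
  "'a rspace \<Rightarrow> 'a set \<Rightarrow> 'a set \<Rightarrow> nat \<Rightarrow> (nat \<Rightarrow> 'a \<Rightarrow> real) \<Rightarrow> bool" where
  "generates_ideal X Z U m f \<longleftrightarrow> (\<forall>i<m. f i \<in> reg X U) \<and>
     {x \<in> U. \<forall>i<m. f i x = 0} = U \<inter> Z \<and>
     (\<forall>V g. openin (rtop X) V \<and> V \<subseteq> U \<and> g \<in> reg X V \<and> (\<forall>x \<in> V \<inter> Z. g x = 0) \<longrightarrow>
        (\<forall>p\<in>V. \<exists>W a. openin (rtop X) W \<and> p \<in> W \<and> W \<subseteq> V \<and>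
           (\<forall>i<m. a i \<in> reg X W) \<and> (\<forall>x\<in>W. g x = (\<Sum>i<m. a i x * f i x))))"

text \<open>
  The local blow-up: the closure in \<open>U \<times> P\<^sup>m\<^sup>-\<^sup>1\<close> of the graph of
  \<open>x \<mapsto> [f 0 x : \<dots> : f (m - 1) x]\<close>.
\<close>

definition graph_blowup ::
  "'a rspace \<Rightarrow> 'a set \<Rightarrow> nat \<Rightarrow> (nat \<Rightarrow> 'a \<Rightarrow> real) \<Rightarrow> ('a \<times> (nat \<Rightarrow> real) set) rspace" where
  "graph_blowup X U m f =
     (let P = prod_space (sub_space X U) (proj_space {..<m})
      in sub_space P (rtop P closure_of
           {(x, hpoint {..<m} (\<lambda>i\<in>{..<m}. f i x)) | x. x \<in> U \<and> (\<exists>i<m. f i x \<noteq> 0)}))"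

text \<open>
  \<open>\<pi> : Y \<rightarrow> X\<close> is the blow-up of \<open>X\<close> along \<open>Z\<close>: locally over \<open>X\<close> it is
  isomorphic to the closure of the graph given by generators of the ideal of \<open>Z\<close>.
  For \<open>X\<close> a subset with corners of a smooth variety this is the part of the blow-up of the
  ambient variety lying in the strict transform of \<open>X\<close>.
\<close>

definition is_blowup :: "'a rspace \<Rightarrow> 'a set \<Rightarrow> 'b rspace \<Rightarrow> ('b \<Rightarrow> 'a) \<Rightarrow> bool" where
  "is_blowup X Z Y \<pi> \<longleftrightarrow> closedin (rtop X) Z \<and> morphism Y X \<pi> \<and>
     (\<forall>p\<in>pts X. \<exists>U m f \<phi>. openin (rtop X) U \<and> p \<in> U \<and> generates_ideal X Z U m f \<and>
        isomorphism (sub_space Y {y \<in> pts Y. \<pi> y \<in> U}) (graph_blowup X U m f) \<phi> \<and>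
        (\<forall>y\<in>pts Y. \<pi> y \<in> U \<longrightarrow> fst (\<phi> y) = \<pi> y))"

definition strict_transform :: "'a set \<Rightarrow> 'b rspace \<Rightarrow> ('b \<Rightarrow> 'a) \<Rightarrow> 'a set \<Rightarrow> 'b set" where
  "strict_transform C Y \<pi> Z = rtop Y closure_of {y \<in> pts Y. \<pi> y \<in> Z - C}"


section \<open>The compactified cell as the closure of an image\<close>

definition std_simplex :: "'e set \<Rightarrow> ('e \<Rightarrow> real) set" where
  "std_simplex S = {x \<in> S \<rightarrow>\<^sub>E UNIV. (\<forall>e\<in>S. 0 \<le> x e) \<and> (\<Sum>e\<in>S. x e) = 1}"

definition open_cell :: "('v, 'e, 'l) graph \<Rightarrow> ('e \<Rightarrow> real) set" where
  "open_cell G = {x \<in> std_simplex (edges G). forest G {e \<in> edges G. x e = 0}}"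

definition rescale :: "'e set \<Rightarrow> ('e \<Rightarrow> real) \<Rightarrow> 'e \<Rightarrow> real" where
  "rescale \<gamma> x = (\<lambda>e\<in>\<gamma>. x e / (\<Sum>e'\<in>\<gamma>. x e'))"

definition rmap :: "('v, 'e, 'l) graph \<Rightarrow> ('e \<Rightarrow> real) \<Rightarrow> 'e set \<Rightarrow> 'e \<Rightarrow> real" where
  "rmap G x = (\<lambda>\<gamma>\<in>cores G. rescale \<gamma> x)"

definition simplex_product :: "('v, 'e, 'l) graph \<Rightarrow> ('e set \<Rightarrow> 'e \<Rightarrow> real) rspace" where
  "simplex_product G = Prod_space (cores G) (\<lambda>\<gamma>. sub_space (affine_space \<gamma>) (std_simplex \<gamma>))"

definition closure_cell :: "('v, 'e, 'l) graph \<Rightarrow> ('e set \<Rightarrow> 'e \<Rightarrow> real) rspace" where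
  "closure_cell G = sub_space (simplex_product G)
     (rtop (simplex_product G) closure_of (rmap G ` open_cell G))"


section \<open>The compactified cell as an iterated blow-up\<close>

definition proj_simplex :: "'e set \<Rightarrow> ('e \<Rightarrow> real) set set" where
  "proj_simplex S = hpoint S ` {x \<in> nonzero_vectors S. \<forall>e\<in>S. 0 \<le> x e}"

definition L_face :: "('v, 'e, 'l) graph \<Rightarrow> 'e set \<Rightarrow> ('e \<Rightarrow> real) set set" where
  "L_face G \<gamma> = hpoint (edges G) `
     {x \<in> nonzero_vectors (edges G). (\<forall>e\<in>edges G. 0 \<le> x e) \<and> (\<forall>e\<in>\<gamma>. x e = 0)}"

definition L_dim :: "('v, 'e, 'l) graph \<Rightarrow> 'e set \<Rightarrow> int" where
  "L_dim G \<gamma> = int (card (edges G)) - int (card \<gamma>) - 1"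

definition blowup_order :: "('v, 'e, 'l) graph \<Rightarrow> 'e set list \<Rightarrow> bool" where
  "blowup_order G \<gamma>s \<longleftrightarrow> distinct \<gamma>s \<and> set \<gamma>s = proper_cores G \<and>
     sorted_wrt (\<lambda>\<gamma> \<delta>. L_dim G \<gamma> \<le> L_dim G \<delta>) \<gamma>s"

text \<open>
  The stages of the sequence of blow-ups are subsets \<open>A i\<close> of the product of the projective spaces
  of \<open>G\<close> and of the first \<open>i\<close> subgraphs; the blow-down maps are the coordinate projections.
\<close>

definition stage_index :: "('v, 'e, 'l) graph \<Rightarrow> 'e set list \<Rightarrow> nat \<Rightarrow> 'e set set" where
  "stage_index G \<gamma>s i = insert (edges G) (set (take i \<gamma>s))"

definition stage ::
  "('v, 'e, 'l) graph \<Rightarrow> 'e set list \<Rightarrow> (nat \<Rightarrow> ('e set \<Rightarrow> ('e \<Rightarrow> real) set) set) \<Rightarrow> nat \<Rightarrow>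
   ('e set \<Rightarrow> ('e \<Rightarrow> real) set) rspace" where
  "stage G \<gamma>s A i = sub_space (Prod_space (stage_index G \<gamma>s i) proj_space) (A i)"

definition blow_down ::
  "('v, 'e, 'l) graph \<Rightarrow> 'e set list \<Rightarrow> nat \<Rightarrow> ('e set \<Rightarrow> 'b) \<Rightarrow> 'e set \<Rightarrow> 'b" where
  "blow_down G \<gamma>s i = (\<lambda>p. restrict p (stage_index G \<gamma>s i))"

text \<open>The strict transform of \<open>L_face G \<delta>\<close> in the \<open>i\<close>-th stage.\<close>

primrec transform ::
  "('v, 'e, 'l) graph \<Rightarrow> 'e set list \<Rightarrow> (nat \<Rightarrow> ('e set \<Rightarrow> ('e \<Rightarrow> real) set) set) \<Rightarrow> nat \<Rightarrow>
   'e set \<Rightarrow> ('e set \<Rightarrow> ('e \<Rightarrow> real) set) set" where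
  "transform G \<gamma>s A 0 = (\<lambda>\<delta>. \<Pi>\<^sub>E _\<in>{edges G}. L_face G \<delta>)"
| "transform G \<gamma>s A (Suc i) = (\<lambda>\<delta>. strict_transform (transform G \<gamma>s A i (\<gamma>s ! i))
     (stage G \<gamma>s A (Suc i)) (blow_down G \<gamma>s i) (transform G \<gamma>s A i \<delta>))"

definition blowup_tower ::
  "('v, 'e, 'l) graph \<Rightarrow> 'e set list \<Rightarrow> (nat \<Rightarrow> ('e set \<Rightarrow> ('e \<Rightarrow> real) set) set) \<Rightarrow> bool" where
  "blowup_tower G \<gamma>s A \<longleftrightarrow> A 0 = (\<Pi>\<^sub>E _\<in>{edges G}. proj_simplex (edges G)) \<and>
     (\<forall>i<length \<gamma>s. A (Suc i) \<subseteq> pts (Prod_space (stage_index G \<gamma>s (Suc i)) proj_space) \<and>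
        is_blowup (stage G \<gamma>s A i) (transform G \<gamma>s A i (\<gamma>s ! i))
          (stage G \<gamma>s A (Suc i)) (blow_down G \<gamma>s i))"

definition is_blowup_cell ::
  "('v, 'e, 'l) graph \<Rightarrow> 'e set list \<Rightarrow> ('e set \<Rightarrow> ('e \<Rightarrow> real) set) rspace \<Rightarrow> bool" where
  "is_blowup_cell G \<gamma>s Y \<longleftrightarrow> (\<exists>A. blowup_tower G \<gamma>s A \<and> Y = stage G \<gamma>s A (length \<gamma>s))"

end

theory Submission
  imports Defs
begin

text \<open>
  Both constructions are compared with an explicit model.  For a family \<open>I\<close> of edge sets that is
  closed under unions and contains the set of all edges, the model consists of the tuples
  \<open>x \<gamma>\<close>, \<open>\<gamma> \<in> I\<close>, of metrics of volume one such that the restriction of \<open>x \<eta>\<close> to any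
  \<open>\<gamma> \<subseteq> \<eta>\<close> is a multiple of \<open>x \<gamma>\<close>.  At a point of the model, passing repeatedly to the largest
  member on which the current metric vanishes gives a chain of members of \<open>I\<close>; along this chain
  all coordinates are monomials in independent parameters, so that the model is locally an orthant
  and its positive points are dense.

  Adding to \<open>I\<close> a set \<open>\<gamma>\<close> that contains no member, keeping the family closed under unions, blows
  up the model: the ideal of the face in question is generated by the coordinates of \<open>\<gamma>\<close>, and the
  point of projective space which these define is the new component \<open>x \<gamma>\<close>.  Core subgraphs are
  closed under unions and blow-ups are unique, hence every tower is isomorphic to the tower of
  models.  The last model is the closure of the image of \<open>r\<close>, because all points of that image lie
  in it and the positive ones are dense.
\<close>

section \<open>Spaces with regular functions\<close>

text \<open>Two obstacles shape the proof. First, \<open>is_blowup\<close> is a local condition that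
  leaves the generators of the ideal free, so a tower fixes each stage only up to isomorphism over
  the previous one. Two systems of generators are matched by matrices of regular functions, and the
  local comparison maps glue because the preimage of the complement of the center is dense and the
  spaces are Hausdorff. Second, the coordinates must generate the ideal of all regular functions
  vanishing on the center, where functions are only locally rational and live on a set with corners.
  A retraction z of the chart onto the center reduces this to dividing the difference of f and its
  pullback along z. The order of the blow-ups enters once: increasing dimension of
  \<open>L_face G \<gamma>\<close> means decreasing number of edges, so a union of a treated
  subgraph with any core has been treated before, and no treated subgraph lies inside the new one.
  This makes the coordinates of the new member independent parameters at points of its center. A
  graph without internal edges has no core subgraph and is settled separately.\<close>

lemma continuous_map_local:
  assumes "\<And>p. p \<in> topspace X \<Longrightarrow> \<exists>V. openin X V \<and> p \<in> V \<and> continuous_map (subtopology X V) Y f"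
  shows "continuous_map X Y f"
proof -
  obtain V where V: "\<And>p. p \<in> topspace X \<Longrightarrow>
      openin X (V p) \<and> p \<in> V p \<and> continuous_map (subtopology X (V p)) Y f"
    using assms by metis
  show ?thesis
    by (rule pasting_lemma[where I = "topspace X" and T = V and f = "\<lambda>_. f"]) (use V in auto)
qed

text \<open>A sheaf of continuous real functions, closed under inverses of nowhere vanishing ones.
  The axioms are kept apart from \<open>gen_space\<close> because \<open>hadamard_space\<close>
  below satisfies them without being presented by generators.\<close>

locale fspace =
  fixes X :: "'a rspace"
  assumes reg_open: "f \<in> reg X U \<Longrightarrow> openin (rtop X) U"
    and reg_continuous: "f \<in> reg X U \<Longrightarrow> continuous_map (subtopology (rtop X) U) euclideanreal f"
    and reg_subset: "f \<in> reg X U \<Longrightarrow> openin (rtop X) V \<Longrightarrow> V \<subseteq> U \<Longrightarrow> f \<in> reg X V"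
    and reg_local: "openin (rtop X) U \<Longrightarrow>
      (\<And>p. p \<in> U \<Longrightarrow> \<exists>V h. p \<in> V \<and> V \<subseteq> U \<and> h \<in> reg X V \<and> (\<forall>x\<in>V. f x = h x)) \<Longrightarrow> f \<in> reg X U"
    and reg_const: "openin (rtop X) U \<Longrightarrow> (\<lambda>_. c) \<in> reg X U"
    and reg_add: "f \<in> reg X U \<Longrightarrow> g \<in> reg X U \<Longrightarrow> (\<lambda>x. f x + g x) \<in> reg X U"
    and reg_mult: "f \<in> reg X U \<Longrightarrow> g \<in> reg X U \<Longrightarrow> (\<lambda>x. f x * g x) \<in> reg X U"
    and reg_inverse: "f \<in> reg X U \<Longrightarrow> \<forall>x\<in>U. f x \<noteq> 0 \<Longrightarrow> (\<lambda>x. inverse (f x)) \<in> reg X U"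
begin

lemma reg_cong:
  assumes "f \<in> reg X U" "\<And>x. x \<in> U \<Longrightarrow> g x = f x"
  shows "g \<in> reg X U"
  by (rule reg_local) (use assms reg_open in auto)

lemma reg_diff:
  assumes "f \<in> reg X U" "g \<in> reg X U"
  shows "(\<lambda>x. f x - g x) \<in> reg X U"
proof -
  have "(\<lambda>x. f x + (-1) * g x) \<in> reg X U"
    by (intro reg_add reg_mult reg_const assms reg_open[OF assms(1)])
  then show ?thesis by simp
qed

lemma reg_divide:
  assumes "f \<in> reg X U" "g \<in> reg X U" "\<forall>x\<in>U. g x \<noteq> 0"
  shows "(\<lambda>x. f x / g x) \<in> reg X U"
  unfolding divide_inverse by (intro reg_mult reg_inverse assms)

lemma reg_sum:
  assumes "openin (rtop X) U" "\<And>i. i \<in> I \<Longrightarrow> f i \<in> reg X U"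
  shows "(\<lambda>x. \<Sum>i\<in>I. f i x) \<in> reg X U"
  using assms(2)
  by (induction I rule: infinite_finite_induct) (auto intro!: reg_const reg_add assms(1))

lemma reg_prod:
  assumes "openin (rtop X) U" "\<And>i. i \<in> I \<Longrightarrow> f i \<in> reg X U"
  shows "(\<lambda>x. \<Prod>i\<in>I. f i x) \<in> reg X U"
  using assms(2)
  by (induction I rule: infinite_finite_induct) (auto intro!: reg_const reg_mult assms(1))

lemma reg_nonzero_open:
  assumes "f \<in> reg X U"
  shows "openin (rtop X) {x \<in> U. f x \<noteq> 0}"
proof -
  have U: "openin (rtop X) U" "U \<subseteq> pts X" using assms reg_open openin_subset by blast+
  have "openin (subtopology (rtop X) U)
      {x \<in> topspace (subtopology (rtop X) U). f x \<in> - {0}}"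
    using reg_continuous[OF assms] unfolding continuous_map by auto
  moreover have "{x \<in> topspace (subtopology (rtop X) U). f x \<in> - {0}} = {x \<in> U. f x \<noteq> 0}"
    using U by auto
  ultimately show ?thesis using U(1) by (simp add: openin_open_subtopology)
qed

text \<open>Denominators do not vanish on \<open>V\<close>, hence after composition not on
  \<open>O'\<close>; so regularity of the pulled back generators passes to all rational expressions
  in them.\<close>

lemma rational_in_comp:
  assumes "h \<in> rational_in V F" "openin (rtop X) O'"
    and "\<And>f. f \<in> F \<Longrightarrow> (\<lambda>x. f (\<phi> x)) \<in> reg X O'" "\<And>x. x \<in> O' \<Longrightarrow> \<phi> x \<in> V"
  shows "(\<lambda>x. h (\<phi> x)) \<in> reg X O'"
  using assms(1)
proof induction
  case (rat_inverse f)
  then show ?case using assms(4) by (intro reg_inverse) auto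
qed (auto intro: reg_const reg_add reg_mult assms(2,3))

end

lemma rational_in_mono:
  assumes "V' \<subseteq> V" "F \<subseteq> F'"
  shows "rational_in V F \<subseteq> rational_in V' F'"
proof
  fix h assume "h \<in> rational_in V F"
  then show "h \<in> rational_in V' F'"
    by induction (use assms in \<open>auto intro: rational_in.intros\<close>)
qed

lemma rtop_gen_space [simp]: "rtop (gen_space T K) = T"
  by (simp add: gen_space_def)

lemma reg_gen_space:
  "f \<in> reg (gen_space T K) U \<longleftrightarrow> openin T U \<and>
     (\<forall>p\<in>U. \<exists>V. openin T V \<and> p \<in> V \<and> V \<subseteq> U \<and>
        (\<exists>h \<in> rational_in V {g. \<exists>W. (W, g) \<in> K \<and> V \<subseteq> W}. \<forall>x\<in>V. f x = h x))"
  by (simp add: gen_space_def)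

lemma reg_gen_spaceI: "(W, g) \<in> K \<Longrightarrow> openin T W \<Longrightarrow> g \<in> reg (gen_space T K) W"
  unfolding reg_gen_space by (blast intro: rat_gen)

lemma fspace_gen_space:
  assumes K: "\<And>W g. (W, g) \<in> K \<Longrightarrow> continuous_map (subtopology T W) euclideanreal g"
  shows "fspace (gen_space T K)"
proof
  let ?X = "gen_space T K" and ?F = "\<lambda>V. {g. \<exists>W. (W, g) \<in> K \<and> V \<subseteq> W}"
  fix f U assume f: "f \<in> reg ?X U"
  show U: "openin (rtop ?X) U" using f by (simp add: reg_gen_space)
  have cont: "continuous_map (subtopology T V) euclideanreal h" if "h \<in> rational_in V (?F V)" for h V
    using that
  proof induction
    case (rat_gen f)
    then show ?case using K by (blast intro: continuous_map_from_subtopology_mono)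
  next
    case (rat_inverse f)
    then show ?case by (intro continuous_map_real_inverse) auto
  qed (auto intro: continuous_map_add continuous_map_real_mult)
  show "continuous_map (subtopology (rtop ?X) U) euclideanreal f"
  proof (rule continuous_map_local)
    fix p assume "p \<in> topspace (subtopology (rtop ?X) U)"
    then have "p \<in> U" by simp
    then obtain V h where V: "openin T V" "p \<in> V" "V \<subseteq> U" "h \<in> rational_in V (?F V)" "\<forall>x\<in>V. f x = h x"
      using f unfolding reg_gen_space by blast
    have "continuous_map (subtopology T V) euclideanreal f"
      by (rule continuous_map_eq[OF cont[OF V(4)]]) (use V in auto)
    then show "\<exists>V. openin (subtopology (rtop ?X) U) V \<and> p \<in> V \<and>
        continuous_map (subtopology (subtopology (rtop ?X) U) V) euclideanreal f"
      using V U by (intro exI[of _ V]) (auto simp: openin_open_subtopology subtopology_subtopology Int_absorb1)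
  qed
  show "(\<lambda>x. inverse (f x)) \<in> reg ?X U" if nz: "\<forall>x\<in>U. f x \<noteq> 0"
    unfolding reg_gen_space
  proof (intro conjI ballI)
    fix p assume "p \<in> U"
    then obtain V h where V: "openin T V" "p \<in> V" "V \<subseteq> U" "h \<in> rational_in V (?F V)" "\<forall>x\<in>V. f x = h x"
      using f unfolding reg_gen_space by blast
    have "(\<lambda>x. inverse (h x)) \<in> rational_in V (?F V)"
      using V nz by (intro rat_inverse) (auto simp: subset_iff)
    then show "\<exists>V. openin T V \<and> p \<in> V \<and> V \<subseteq> U \<and> (\<exists>h\<in>rational_in V (?F V). \<forall>x\<in>V. inverse (f x) = h x)"
      using V by (intro exI[of _ V]) auto
  qed (use U in simp)
  {
    fix g assume g: "g \<in> reg ?X U"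
    \<comment> \<open>Sum and product are treated together: both need only that the two local
      expressions are valid on the intersection of their neighbourhoods.\<close>
    have *: "\<exists>V. openin T V \<and> p \<in> V \<and> V \<subseteq> U \<and> (\<exists>h\<in>rational_in V (?F V). \<forall>x\<in>V. op' (f x) (g x) = h x)"
      if p: "p \<in> U" and op': "\<And>V h1 h2. h1 \<in> rational_in V (?F V) \<Longrightarrow> h2 \<in> rational_in V (?F V) \<Longrightarrow>
        (\<lambda>x. op' (h1 x) (h2 x)) \<in> rational_in V (?F V)" for p and op' :: "real \<Rightarrow> real \<Rightarrow> real"
    proof -
      obtain V1 h1 where V1: "openin T V1" "p \<in> V1" "V1 \<subseteq> U" "h1 \<in> rational_in V1 (?F V1)" "\<forall>x\<in>V1. f x = h1 x"
        using f p unfolding reg_gen_space by blast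
      obtain V2 h2 where V2: "openin T V2" "p \<in> V2" "V2 \<subseteq> U" "h2 \<in> rational_in V2 (?F V2)" "\<forall>x\<in>V2. g x = h2 x"
        using g p unfolding reg_gen_space by blast
      let ?V = "V1 \<inter> V2"
      have "h1 \<in> rational_in ?V (?F ?V)" "h2 \<in> rational_in ?V (?F ?V)"
        using V1(4) V2(4) rational_in_mono[of ?V V1 "?F V1" "?F ?V"] rational_in_mono[of ?V V2 "?F V2" "?F ?V"]
        by blast+
      then have "(\<lambda>x. op' (h1 x) (h2 x)) \<in> rational_in ?V (?F ?V)" by (rule op')
      then show ?thesis using V1 V2
        by (intro exI[of _ ?V] conjI bexI[of _ "\<lambda>x. op' (h1 x) (h2 x)"]) auto
    qed
    show "(\<lambda>x. f x + g x) \<in> reg ?X U"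
      unfolding reg_gen_space by (intro conjI ballI * rat_add U[simplified])
    show "(\<lambda>x. f x * g x) \<in> reg ?X U"
      unfolding reg_gen_space by (intro conjI ballI * rat_mult U[simplified])
  }
  show "f \<in> reg ?X V" if V: "openin (rtop ?X) V" "V \<subseteq> U" for V
    unfolding reg_gen_space
  proof (intro conjI ballI)
    fix p assume "p \<in> V"
    then obtain V1 h where V1: "openin T V1" "p \<in> V1" "V1 \<subseteq> U" "h \<in> rational_in V1 (?F V1)" "\<forall>x\<in>V1. f x = h x"
      using f V unfolding reg_gen_space by blast
    have "h \<in> rational_in (V1 \<inter> V) (?F (V1 \<inter> V))"
      using V1(4) rational_in_mono[of "V1 \<inter> V" V1 "?F V1" "?F (V1 \<inter> V)"] by blast
    then show "\<exists>V'. openin T V' \<and> p \<in> V' \<and> V' \<subseteq> V \<and> (\<exists>h\<in>rational_in V' (?F V'). \<forall>x\<in>V'. f x = h x)"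
      using V1 V \<open>p \<in> V\<close> by (intro exI[of _ "V1 \<inter> V"]) auto
  qed (use V in simp)
next
  let ?X = "gen_space T K" and ?F = "\<lambda>V. {g. \<exists>W. (W, g) \<in> K \<and> V \<subseteq> W}"
  fix U and f :: "'a \<Rightarrow> real"
  assume U: "openin (rtop ?X) U"
    and *: "\<And>p. p \<in> U \<Longrightarrow> \<exists>V h. p \<in> V \<and> V \<subseteq> U \<and> h \<in> reg ?X V \<and> (\<forall>x\<in>V. f x = h x)"
  show "f \<in> reg ?X U"
    unfolding reg_gen_space
  proof (intro conjI ballI)
    fix p assume "p \<in> U"
    then obtain V h where V: "p \<in> V" "V \<subseteq> U" "h \<in> reg ?X V" "\<forall>x\<in>V. f x = h x" using * by blast
    then obtain V' h' where "openin T V'" "p \<in> V'" "V' \<subseteq> V" "h' \<in> rational_in V' (?F V')" "\<forall>x\<in>V'. h x = h' x"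
      unfolding reg_gen_space by blast
    then show "\<exists>V'. openin T V' \<and> p \<in> V' \<and> V' \<subseteq> U \<and> (\<exists>h\<in>rational_in V' (?F V'). \<forall>x\<in>V'. f x = h x)"
      using V by (intro exI[of _ V'] conjI bexI[of _ h']) auto
  qed (use U in simp)
next
  let ?X = "gen_space T K"
  fix U and c :: real
  assume "openin (rtop ?X) U"
  then show "(\<lambda>_. c) \<in> reg ?X U"
    unfolding reg_gen_space by (auto intro!: exI[of _ U] bexI[of _ "\<lambda>_. c"] rat_const)
qed

subsection \<open>Morphisms\<close>

lemma morphism_continuous: "morphism X Y \<phi> \<Longrightarrow> continuous_map (rtop X) (rtop Y) \<phi>"
  by (simp add: morphism_def)

lemma morphism_in: "morphism X Y \<phi> \<Longrightarrow> x \<in> pts X \<Longrightarrow> \<phi> x \<in> pts Y"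
  by (auto simp: morphism_def continuous_map_def)

lemma morphism_reg: "morphism X Y \<phi> \<Longrightarrow> g \<in> reg Y V \<Longrightarrow> openin (rtop Y) V \<Longrightarrow>
  (\<lambda>x. g (\<phi> x)) \<in> reg X {x \<in> pts X. \<phi> x \<in> V}"
  by (auto simp: morphism_def o_def)

lemma morphism_open: "morphism X Y \<phi> \<Longrightarrow> openin (rtop Y) V \<Longrightarrow> openin (rtop X) {x \<in> pts X. \<phi> x \<in> V}"
  by (auto simp: morphism_def continuous_map_def)

lemma morphism_id:
  assumes "fspace X" shows "morphism X X (\<lambda>x. x)"
  unfolding morphism_def o_def
proof (intro conjI allI impI)
  fix V g assume Vg: "openin (rtop X) V \<and> g \<in> reg X V"
  then have "{x \<in> pts X. x \<in> V} = V" using openin_subset by blast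
  then show "(\<lambda>x. g x) \<in> reg X {x \<in> pts X. x \<in> V}" using Vg by simp
qed simp

lemma morphism_compose:
  assumes "morphism X Y \<phi>" "morphism Y Z \<psi>"
  shows "morphism X Z (\<lambda>x. \<psi> (\<phi> x))"
  unfolding morphism_def
proof (intro conjI allI impI)
  show "continuous_map (rtop X) (rtop Z) (\<lambda>x. \<psi> (\<phi> x))"
    using continuous_map_compose[OF morphism_continuous[OF assms(1)] morphism_continuous[OF assms(2)]]
    by (simp add: o_def)
  fix V g assume Vg: "openin (rtop Z) V \<and> g \<in> reg Z V"
  have "(\<lambda>x. g (\<psi> (\<phi> x))) \<in> reg X {x \<in> pts X. \<phi> x \<in> {y \<in> pts Y. \<psi> y \<in> V}}"
    using morphism_reg[OF assms(1) morphism_reg[OF assms(2)] morphism_open[OF assms(2)]] Vg by blast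
  moreover have "{x \<in> pts X. \<phi> x \<in> {y \<in> pts Y. \<psi> y \<in> V}} = {x \<in> pts X. \<psi> (\<phi> x) \<in> V}"
    using morphism_in[OF assms(1)] by auto
  ultimately show "g \<circ> (\<lambda>x. \<psi> (\<phi> x)) \<in> reg X {x \<in> pts X. \<psi> (\<phi> x) \<in> V}"
    by (simp add: o_def)
qed

lemma morphism_cong:
  assumes "fspace X" "morphism X Y \<phi>" "\<And>x. x \<in> pts X \<Longrightarrow> \<psi> x = \<phi> x"
  shows "morphism X Y \<psi>"
  unfolding morphism_def
proof (intro conjI allI impI)
  show "continuous_map (rtop X) (rtop Y) \<psi>"
    by (rule continuous_map_eq[OF morphism_continuous[OF assms(2)]]) (use assms(3) in auto)
  fix V g assume "openin (rtop Y) V \<and> g \<in> reg Y V"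
  then have "(\<lambda>x. g (\<phi> x)) \<in> reg X {x \<in> pts X. \<phi> x \<in> V}" using morphism_reg[OF assms(2)] by blast
  moreover have "{x \<in> pts X. \<phi> x \<in> V} = {x \<in> pts X. \<psi> x \<in> V}" using assms(3) by auto
  ultimately have "(\<lambda>x. g (\<phi> x)) \<in> reg X {x \<in> pts X. \<psi> x \<in> V}" by simp
  then show "g \<circ> \<psi> \<in> reg X {x \<in> pts X. \<psi> x \<in> V}"
    by (rule fspace.reg_cong[OF assms(1)]) (use assms(3) in auto)
qed

text \<open>Pulling back the generators is enough to recognise a morphism. The universal properties
  of subspaces, products, the line and projective space below are all instances.\<close>

lemma morphism_gen_space:
  assumes X: "fspace X" and cont: "continuous_map (rtop X) T \<phi>"
    and K: "\<And>W g. (W, g) \<in> K \<Longrightarrow> (\<lambda>x. g (\<phi> x)) \<in> reg X {x \<in> pts X. \<phi> x \<in> W}"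
  shows "morphism X (gen_space T K) \<phi>"
  unfolding morphism_def
proof (intro conjI allI impI)
  fix V g assume Vg: "openin (rtop (gen_space T K)) V \<and> g \<in> reg (gen_space T K) V"
  have op: "openin (rtop X) {x \<in> pts X. \<phi> x \<in> V}" if "openin T V" for V
    using cont that by (auto simp: continuous_map_def)
  show "g \<circ> \<phi> \<in> reg X {x \<in> pts X. \<phi> x \<in> V}"
  proof (rule fspace.reg_local[OF X])
    show "openin (rtop X) {x \<in> pts X. \<phi> x \<in> V}" using op Vg by simp
    fix p assume p: "p \<in> {x \<in> pts X. \<phi> x \<in> V}"
    then obtain V' h where V': "openin T V'" "\<phi> p \<in> V'" "V' \<subseteq> V"
        "h \<in> rational_in V' {g. \<exists>W. (W, g) \<in> K \<and> V' \<subseteq> W}" "\<forall>x\<in>V'. g x = h x"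
      using Vg unfolding reg_gen_space by blast
    have "(\<lambda>x. h (\<phi> x)) \<in> reg X {x \<in> pts X. \<phi> x \<in> V'}"
    proof (rule fspace.rational_in_comp[OF X V'(4) op[OF V'(1)]])
      fix f assume "f \<in> {g. \<exists>W. (W, g) \<in> K \<and> V' \<subseteq> W}"
      then obtain W where "(W, f) \<in> K" "V' \<subseteq> W" by blast
      then show "(\<lambda>x. f (\<phi> x)) \<in> reg X {x \<in> pts X. \<phi> x \<in> V'}"
        by (intro fspace.reg_subset[OF X K[of W f] op[OF V'(1)]]) auto
    qed auto
    then show "\<exists>V'' h. p \<in> V'' \<and> V'' \<subseteq> {x \<in> pts X. \<phi> x \<in> V} \<and> h \<in> reg X V'' \<and> (\<forall>x\<in>V''. (g \<circ> \<phi>) x = h x)"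
      using p V' by (intro exI[of _ "{x \<in> pts X. \<phi> x \<in> V'}"] exI[of _ "\<lambda>x. h (\<phi> x)"]) auto
  qed
qed (use cont in simp)

subsection \<open>Subspaces\<close>

lemma rtop_sub_space [simp]: "rtop (sub_space X A) = subtopology (rtop X) A"
  by (simp add: sub_space_def)

lemma fspace_sub_space [simp]:
  assumes "fspace X" shows "fspace (sub_space X A)"
  unfolding sub_space_def
proof (rule fspace_gen_space)
  fix W g assume "(W, g) \<in> {(U \<inter> A, f) | U f. openin (rtop X) U \<and> f \<in> reg X U}"
  then obtain U where U: "W = U \<inter> A" "g \<in> reg X U" by auto
  show "continuous_map (subtopology (subtopology (rtop X) A) W) euclideanreal g"
    unfolding subtopology_subtopology
    by (rule continuous_map_from_subtopology_mono[OF fspace.reg_continuous[OF assms U(2)]])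
      (use U in auto)
qed

lemma morphism_sub_spaceI:
  assumes "fspace X" "morphism X Y \<phi>" "\<And>x. x \<in> pts X \<Longrightarrow> \<phi> x \<in> A"
  shows "morphism X (sub_space Y A) \<phi>"
  unfolding sub_space_def
proof (rule morphism_gen_space[OF assms(1)])
  show "continuous_map (rtop X) (subtopology (rtop Y) A) \<phi>"
    using assms by (auto simp: continuous_map_in_subtopology morphism_continuous)
  fix W g assume "(W, g) \<in> {(U \<inter> A, f) | U f. openin (rtop Y) U \<and> f \<in> reg Y U}"
  then obtain U where U: "W = U \<inter> A" "openin (rtop Y) U" "g \<in> reg Y U" by auto
  have "{x \<in> pts X. \<phi> x \<in> W} = {x \<in> pts X. \<phi> x \<in> U}" using U assms(3) by auto
  then show "(\<lambda>x. g (\<phi> x)) \<in> reg X {x \<in> pts X. \<phi> x \<in> W}"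
    using morphism_reg[OF assms(2) U(3) U(2)] by simp
qed

lemma morphism_sub_space_incl:
  assumes "fspace X" shows "morphism (sub_space X A) X (\<lambda>x. x)"
  unfolding morphism_def
proof (intro conjI allI impI)
  show "continuous_map (rtop (sub_space X A)) (rtop X) (\<lambda>x. x)" by simp
  fix V g assume Vg: "openin (rtop X) V \<and> g \<in> reg X V"
  have "g \<in> reg (sub_space X A) (V \<inter> A)"
    unfolding sub_space_def
    by (rule reg_gen_spaceI) (use Vg in \<open>auto simp: openin_subtopology\<close>)
  moreover have "{x \<in> pts (sub_space X A). x \<in> V} = V \<inter> A" using Vg openin_subset by fastforce
  ultimately show "g \<circ> (\<lambda>x. x) \<in> reg (sub_space X A) {x \<in> pts (sub_space X A). x \<in> V}"
    by (simp add: o_def)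
qed

lemma morphism_sub_space_dom:
  assumes "fspace X" "morphism X Y \<phi>" shows "morphism (sub_space X A) Y \<phi>"
  using morphism_compose[OF morphism_sub_space_incl[OF assms(1)] assms(2)] .

lemma morphism_sub_space_mono:
  assumes "fspace X" "A \<inter> pts X \<subseteq> B" shows "morphism (sub_space X A) (sub_space X B) (\<lambda>x. x)"
  by (rule morphism_sub_spaceI) (use assms morphism_sub_space_incl in auto)

lemma morphism_sub_space_dom_mono:
  assumes "fspace X" "morphism (sub_space X B) Y \<phi>" "A \<inter> pts X \<subseteq> B"
  shows "morphism (sub_space X A) Y \<phi>"
  using morphism_compose[OF morphism_sub_space_mono[OF assms(1,3)] assms(2)] .

lemma morphism_sub_space_cod:
  assumes "fspace Y" "morphism X (sub_space Y B) \<phi>" shows "morphism X Y \<phi>"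
  using morphism_compose[OF assms(2) morphism_sub_space_incl[OF assms(1)]] .

lemma reg_sub_space_restrict:
  assumes "fspace X" and "f \<in> reg X U" shows "f \<in> reg (sub_space X A) (U \<inter> A)"
proof -
  have U: "openin (rtop X) U" using assms fspace.reg_open by blast
  have "{x \<in> pts (sub_space X A). x \<in> U} = U \<inter> A" using openin_subset[OF U] by auto
  then show ?thesis using morphism_reg[OF morphism_sub_space_incl[OF assms(1), of A] assms(2) U] by metis
qed

text \<open>Regularity is local, so an open subspace has exactly the regular functions of
  \<open>X\<close> on its open subsets. Computations in charts can thus be moved freely to and from
  the whole space.\<close>

lemma reg_sub_space_open:
  assumes X: "fspace X" and A: "openin (rtop X) A"
  shows "f \<in> reg (sub_space X A) U \<longleftrightarrow> U \<subseteq> A \<and> f \<in> reg X U"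
proof
  assume f: "f \<in> reg (sub_space X A) U"
  then have U: "openin (rtop X) U" "U \<subseteq> A"
    using fspace.reg_open[OF fspace_sub_space[OF X] f] A by (auto simp: openin_open_subtopology)
  have "f \<in> reg X U"
  proof (rule fspace.reg_local[OF X U(1)])
    fix p assume "p \<in> U"
    then obtain V h where V: "openin (rtop X) V" "p \<in> V" "V \<subseteq> U"
        "h \<in> rational_in V {g. \<exists>W. (W, g) \<in> {(U \<inter> A, f) | U f. openin (rtop X) U \<and> f \<in> reg X U} \<and> V \<subseteq> W}"
        "\<forall>x\<in>V. f x = h x"
      using f A unfolding sub_space_def reg_gen_space by (auto simp: openin_open_subtopology)
    have "(\<lambda>x. h ((\<lambda>x. x) x)) \<in> reg X V"
      by (rule fspace.rational_in_comp[OF X V(4) V(1)]) (auto intro: fspace.reg_subset[OF X _ V(1)])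
    then show "\<exists>V h. p \<in> V \<and> V \<subseteq> U \<and> h \<in> reg X V \<and> (\<forall>x\<in>V. f x = h x)"
      using V by auto
  qed
  with U show "U \<subseteq> A \<and> f \<in> reg X U" by simp
next
  assume "U \<subseteq> A \<and> f \<in> reg X U"
  then show "f \<in> reg (sub_space X A) U" using reg_sub_space_restrict[OF X, of f U A] by (auto simp: Int_absorb2)
qed

text \<open>The representative \<psi> may change with the point; this form serves to glue maps that
  are constructed only near each point.\<close>

lemma morphism_local:
  assumes X: "fspace X"
    and *: "\<And>p. p \<in> pts X \<Longrightarrow> \<exists>V \<psi>. openin (rtop X) V \<and> p \<in> V \<and> morphism (sub_space X V) Y \<psi> \<and> (\<forall>x\<in>V. \<phi> x = \<psi> x)"
  shows "morphism X Y \<phi>"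
proof -
  have **: "\<exists>V. openin (rtop X) V \<and> p \<in> V \<and> morphism (sub_space X V) Y \<phi>" if p: "p \<in> pts X" for p
  proof -
    obtain V \<psi> where "openin (rtop X) V \<and> p \<in> V \<and> morphism (sub_space X V) Y \<psi> \<and> (\<forall>x\<in>V. \<phi> x = \<psi> x)"
      using *[OF p] by blast
    then show ?thesis
      by (intro exI[of _ V]) (auto intro!: morphism_cong[of "sub_space X V" Y \<psi>] simp: X)
  qed
  show ?thesis
    unfolding morphism_def
  proof (intro conjI allI impI)
    show cont: "continuous_map (rtop X) (rtop Y) \<phi>"
    proof (rule continuous_map_local)
      fix p assume "p \<in> topspace (rtop X)"
      then obtain V where "openin (rtop X) V" "p \<in> V" "morphism (sub_space X V) Y \<phi>" using ** by blast
      then show "\<exists>V. openin (rtop X) V \<and> p \<in> V \<and> continuous_map (subtopology (rtop X) V) (rtop Y) \<phi>"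
        using morphism_continuous[of "sub_space X V" Y \<phi>] by auto
    qed
    fix V g assume Vg: "openin (rtop Y) V \<and> g \<in> reg Y V"
    show "g \<circ> \<phi> \<in> reg X {x \<in> pts X. \<phi> x \<in> V}"
    proof (rule fspace.reg_local[OF X])
      show "openin (rtop X) {x \<in> pts X. \<phi> x \<in> V}" using cont Vg by (auto simp: continuous_map_def)
      fix p assume p: "p \<in> {x \<in> pts X. \<phi> x \<in> V}"
      then obtain U where U: "openin (rtop X) U" "p \<in> U" "morphism (sub_space X U) Y \<phi>" using ** by auto
      have "(\<lambda>x. g (\<phi> x)) \<in> reg X {x \<in> pts (sub_space X U). \<phi> x \<in> V}"
        using morphism_reg[OF U(3), of g V] Vg reg_sub_space_open[OF X U(1)] by blast
      then show "\<exists>V' h. p \<in> V' \<and> V' \<subseteq> {x \<in> pts X. \<phi> x \<in> V} \<and> h \<in> reg X V' \<and> (\<forall>x\<in>V'. (g \<circ> \<phi>) x = h x)"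
        using p U by (intro exI[of _ "{x \<in> pts (sub_space X U). \<phi> x \<in> V}"] exI[of _ "\<lambda>x. g (\<phi> x)"]) auto
    qed
  qed
qed

subsection \<open>Products and affine spaces\<close>

lemma rtop_prod_space [simp]: "rtop (prod_space X Y) = prod_topology (rtop X) (rtop Y)"
  by (simp add: prod_space_def)

lemma rtop_Prod_space [simp]: "rtop (Prod_space I X) = product_topology (\<lambda>i. rtop (X i)) I"
  by (simp add: Prod_space_def)

lemma prod_space_gens_open:
  "openin (rtop X) U \<Longrightarrow> openin (prod_topology (rtop X) (rtop Y)) (U \<times> pts Y)"
  "openin (rtop Y) V \<Longrightarrow> openin (prod_topology (rtop X) (rtop Y)) (pts X \<times> V)"
  by (auto simp: openin_prod_Times_iff)

lemma fspace_prod_space [simp]: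
  assumes "fspace X" "fspace Y" shows "fspace (prod_space X Y)"
  unfolding prod_space_def
proof (rule fspace_gen_space)
  fix W g assume "(W, g) \<in> {(U \<times> pts Y, f \<circ> fst) | U f. openin (rtop X) U \<and> f \<in> reg X U} \<union>
      {(pts X \<times> U, f \<circ> snd) | U f. openin (rtop Y) U \<and> f \<in> reg Y U}"
  then consider U f where "W = U \<times> pts Y" "g = f \<circ> fst" "f \<in> reg X U"
    | V f where "W = pts X \<times> V" "g = f \<circ> snd" "f \<in> reg Y V" by auto
  then show "continuous_map (subtopology (prod_topology (rtop X) (rtop Y)) W) euclideanreal g"
  proof cases
    case 1
    have "continuous_map (subtopology (prod_topology (rtop X) (rtop Y)) W) (subtopology (rtop X) U) fst"
      using 1 by (auto simp: continuous_map_in_subtopology intro: continuous_map_from_subtopology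
          continuous_map_fst)
    then show ?thesis
      using 1 fspace.reg_continuous[OF assms(1) 1(3)] by (auto intro: continuous_map_compose)
  next
    case 2
    have "continuous_map (subtopology (prod_topology (rtop X) (rtop Y)) W) (subtopology (rtop Y) V) snd"
      using 2 by (auto simp: continuous_map_in_subtopology intro: continuous_map_from_subtopology
          continuous_map_snd)
    then show ?thesis
      using 2 fspace.reg_continuous[OF assms(2) 2(3)] by (auto intro: continuous_map_compose)
  qed
qed

lemma morphism_fst: "morphism (prod_space X Y) X fst"
  unfolding morphism_def
proof (intro conjI allI impI)
  show "continuous_map (rtop (prod_space X Y)) (rtop X) fst" by (simp add: continuous_map_fst)
  fix V g assume Vg: "openin (rtop X) V \<and> g \<in> reg X V"
  have "{x \<in> pts (prod_space X Y). fst x \<in> V} = V \<times> pts Y" using Vg openin_subset by fastforce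
  then show "g \<circ> fst \<in> reg (prod_space X Y) {x \<in> pts (prod_space X Y). fst x \<in> V}"
    using Vg unfolding prod_space_def
    by (auto intro!: reg_gen_spaceI simp: prod_space_gens_open)
qed

lemma morphism_snd: "morphism (prod_space X Y) Y snd"
  unfolding morphism_def
proof (intro conjI allI impI)
  show "continuous_map (rtop (prod_space X Y)) (rtop Y) snd" by (simp add: continuous_map_snd)
  fix V g assume Vg: "openin (rtop Y) V \<and> g \<in> reg Y V"
  have "{x \<in> pts (prod_space X Y). snd x \<in> V} = pts X \<times> V" using Vg openin_subset by fastforce
  then show "g \<circ> snd \<in> reg (prod_space X Y) {x \<in> pts (prod_space X Y). snd x \<in> V}"
    using Vg unfolding prod_space_def
    by (auto intro!: reg_gen_spaceI simp: prod_space_gens_open)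
qed

lemma morphism_Pair:
  assumes Z: "fspace Z" and f: "morphism Z X f" and g: "morphism Z Y g"
  shows "morphism Z (prod_space X Y) (\<lambda>z. (f z, g z))"
  unfolding prod_space_def
proof (rule morphism_gen_space[OF Z])
  show "continuous_map (rtop Z) (prod_topology (rtop X) (rtop Y)) (\<lambda>z. (f z, g z))"
    using f g by (auto simp: continuous_map_paired morphism_continuous)
  fix W h assume "(W, h) \<in> {(U \<times> pts Y, f \<circ> fst) | U f. openin (rtop X) U \<and> f \<in> reg X U} \<union>
      {(pts X \<times> U, f \<circ> snd) | U f. openin (rtop Y) U \<and> f \<in> reg Y U}"
  then consider U u where "W = U \<times> pts Y" "h = u \<circ> fst" "u \<in> reg X U" "openin (rtop X) U"
    | V v where "W = pts X \<times> V" "h = v \<circ> snd" "v \<in> reg Y V" "openin (rtop Y) V" by auto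
  then show "(\<lambda>x. h (f x, g x)) \<in> reg Z {x \<in> pts Z. (f x, g x) \<in> W}"
  proof cases
    case 1
    have "{x \<in> pts Z. (f x, g x) \<in> W} = {x \<in> pts Z. f x \<in> U}" using 1 morphism_in[OF g] by auto
    then show ?thesis using 1 morphism_reg[OF f 1(3,4)] by simp
  next
    case 2
    have "{x \<in> pts Z. (f x, g x) \<in> W} = {x \<in> pts Z. g x \<in> V}" using 2 morphism_in[OF f] by auto
    then show ?thesis using 2 morphism_reg[OF g 2(3,4)] by simp
  qed
qed

lemma Prod_space_gens_open:
  assumes "i \<in> I" "openin (rtop (X i)) U"
  shows "openin (product_topology (\<lambda>i. rtop (X i)) I) {p \<in> (\<Pi>\<^sub>E j\<in>I. pts (X j)). p i \<in> U}"
  using continuous_map_product_projection[OF assms(1), of "\<lambda>i. rtop (X i)"] assms(2)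
  by (auto simp: continuous_map_def)

lemma fspace_Prod_space:
  assumes "\<And>i. i \<in> I \<Longrightarrow> fspace (X i)" shows "fspace (Prod_space I X)"
  unfolding Prod_space_def
proof (rule fspace_gen_space)
  fix W g assume "(W, g) \<in> {({p \<in> (\<Pi>\<^sub>E j\<in>I. pts (X j)). p i \<in> U}, \<lambda>p. f (p i)) | i U f.
        i \<in> I \<and> openin (rtop (X i)) U \<and> f \<in> reg (X i) U}"
  then obtain i U f where *: "W = {p \<in> (\<Pi>\<^sub>E j\<in>I. pts (X j)). p i \<in> U}" "g = (\<lambda>p. f (p i))"
      "i \<in> I" "f \<in> reg (X i) U" by blast
  have "continuous_map (subtopology (product_topology (\<lambda>i. rtop (X i)) I) W) (subtopology (rtop (X i))
      U) (\<lambda>p. p i)"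
    using * continuous_map_product_projection[OF *(3), of "\<lambda>i. rtop (X i)"]
    by (auto simp: continuous_map_in_subtopology intro: continuous_map_from_subtopology)
  then show "continuous_map (subtopology (product_topology (\<lambda>i. rtop (X i)) I) W) euclideanreal g"
    using continuous_map_compose[OF _ fspace.reg_continuous[OF assms[OF *(3)] *(4)]] *
    by (auto simp: o_def)
qed

lemma morphism_Prod_proj:
  assumes "i \<in> I" shows "morphism (Prod_space I X) (X i) (\<lambda>p. p i)"
  unfolding morphism_def
proof (intro conjI allI impI)
  show "continuous_map (rtop (Prod_space I X)) (rtop (X i)) (\<lambda>p. p i)"
    using continuous_map_product_projection[OF assms, of "\<lambda>i. rtop (X i)"] by simp
  fix V g assume Vg: "openin (rtop (X i)) V \<and> g \<in> reg (X i) V"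
  have "g \<circ> (\<lambda>p. p i) \<in> reg (Prod_space I X) {p \<in> (\<Pi>\<^sub>E j\<in>I. pts (X j)). p i \<in> V}"
    unfolding Prod_space_def o_def
    by (rule reg_gen_spaceI) (use assms Vg in \<open>blast, simp add: Prod_space_gens_open\<close>)
  then show "g \<circ> (\<lambda>p. p i) \<in> reg (Prod_space I X) {x \<in> pts (Prod_space I X). x i \<in> V}" by simp
qed

lemma morphism_ProdI:
  assumes Z: "fspace Z" and ext: "\<And>z. z \<in> pts Z \<Longrightarrow> \<phi> z \<in> extensional I"
    and *: "\<And>i. i \<in> I \<Longrightarrow> morphism Z (X i) (\<lambda>z. \<phi> z i)"
  shows "morphism Z (Prod_space I X) \<phi>"
  unfolding Prod_space_def
proof (rule morphism_gen_space[OF Z])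
  show "continuous_map (rtop Z) (product_topology (\<lambda>i. rtop (X i)) I) \<phi>"
    unfolding continuous_map_componentwise using ext * morphism_continuous by blast
  fix W g assume "(W, g) \<in> {({p \<in> (\<Pi>\<^sub>E j\<in>I. pts (X j)). p i \<in> U}, \<lambda>p. f (p i)) | i U f.
        i \<in> I \<and> openin (rtop (X i)) U \<and> f \<in> reg (X i) U}"
  then obtain i U f where i: "W = {p \<in> (\<Pi>\<^sub>E j\<in>I. pts (X j)). p i \<in> U}" "g = (\<lambda>p. f (p i))"
      "i \<in> I" "f \<in> reg (X i) U" "openin (rtop (X i)) U" by blast
  have "\<phi> x \<in> (\<Pi>\<^sub>E j\<in>I. pts (X j))" if "x \<in> pts Z" for x
    using that ext morphism_in[OF *] by (simp add: PiE_iff)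
  then have "{x \<in> pts Z. \<phi> x \<in> W} = {x \<in> pts Z. \<phi> x i \<in> U}" unfolding i(1) by blast
  then show "(\<lambda>x. g (\<phi> x)) \<in> reg Z {x \<in> pts Z. \<phi> x \<in> W}"
    using i morphism_reg[OF *[OF i(3)] i(4,5)] by simp
qed

lemma fspace_line_space [simp]: "fspace line_space"
  unfolding line_space_def by (rule fspace_gen_space) (auto simp: continuous_map_from_subtopology)

lemma morphism_line_space:
  assumes "fspace X"
  shows "morphism X line_space f \<longleftrightarrow> f \<in> reg X (pts X)"
proof
  assume "morphism X line_space f"
  moreover have "(\<lambda>t. t) \<in> reg line_space UNIV"
    unfolding line_space_def by (rule reg_gen_spaceI) auto
  ultimately show "f \<in> reg X (pts X)"
    using morphism_reg[of X line_space f "\<lambda>t. t" UNIV] by (simp add: line_space_def)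
next
  assume f: "f \<in> reg X (pts X)"
  show "morphism X line_space f"
    unfolding line_space_def
    by (rule morphism_gen_space[OF assms]) (use f fspace.reg_continuous[OF assms f] in auto)
qed

lemma fspace_affine_space [simp]: "fspace (affine_space S)"
  unfolding affine_space_def by (rule fspace_Prod_space) simp

lemma rtop_affine_space [simp]: "rtop (affine_space S) = product_topology (\<lambda>_. euclidean) S"
  by (simp add: affine_space_def line_space_def)

lemma morphism_affine_space:
  assumes X: "fspace X" and ext: "\<And>x. x \<in> pts X \<Longrightarrow> \<phi> x \<in> extensional S"
  shows "morphism X (affine_space S) \<phi> \<longleftrightarrow> (\<forall>i\<in>S. (\<lambda>x. \<phi> x i) \<in> reg X (pts X))"
proof
  assume m: "morphism X (affine_space S) \<phi>"
  show "\<forall>i\<in>S. (\<lambda>x. \<phi> x i) \<in> reg X (pts X)"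
  proof
    fix i assume "i \<in> S"
    then have "morphism X line_space (\<lambda>x. \<phi> x i)"
      using morphism_compose[OF m[unfolded affine_space_def] morphism_Prod_proj[of i S "\<lambda>_. line_space"]]
        by simp
    then show "(\<lambda>x. \<phi> x i) \<in> reg X (pts X)" using morphism_line_space[OF X] by blast
  qed
next
  assume "\<forall>i\<in>S. (\<lambda>x. \<phi> x i) \<in> reg X (pts X)"
  then show "morphism X (affine_space S) \<phi>"
    unfolding affine_space_def using ext by (intro morphism_ProdI X) (auto simp: morphism_line_space[OF X])
qed

subsection \<open>Isomorphisms\<close>

text \<open>The inverse is carried along explicitly, so that isomorphisms can be composed,
  restricted and transported without choosing an inverse each time.\<close>

definition inverse_morphisms :: "'a rspace \<Rightarrow> 'b rspace \<Rightarrow> ('a \<Rightarrow> 'b) \<Rightarrow> ('b \<Rightarrow> 'a) \<Rightarrow> bool" where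
  "inverse_morphisms X Y \<phi> \<psi> \<longleftrightarrow> morphism X Y \<phi> \<and> morphism Y X \<psi> \<and>
     (\<forall>x\<in>pts X. \<psi> (\<phi> x) = x) \<and> (\<forall>y\<in>pts Y. \<phi> (\<psi> y) = y)"

lemma isomorphism_iff: "isomorphism X Y \<phi> \<longleftrightarrow> (\<exists>\<psi>. inverse_morphisms X Y \<phi> \<psi>)"
  by (auto simp: isomorphism_def inverse_morphisms_def)

lemma inverse_morphismsD:
  assumes "inverse_morphisms X Y \<phi> \<psi>"
  shows "morphism X Y \<phi>" "morphism Y X \<psi>"
    "x \<in> pts X \<Longrightarrow> \<psi> (\<phi> x) = x" "y \<in> pts Y \<Longrightarrow> \<phi> (\<psi> y) = y"
    "x \<in> pts X \<Longrightarrow> \<phi> x \<in> pts Y" "y \<in> pts Y \<Longrightarrow> \<psi> y \<in> pts X"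
  using assms by (auto simp: inverse_morphisms_def intro: morphism_in)

lemma inverse_morphisms_sym: "inverse_morphisms X Y \<phi> \<psi> \<Longrightarrow> inverse_morphisms Y X \<psi> \<phi>"
  by (auto simp: inverse_morphisms_def)

lemma inverse_morphisms_trans:
  assumes "inverse_morphisms X Y \<phi> \<psi>" "inverse_morphisms Y Z \<phi>' \<psi>'"
  shows "inverse_morphisms X Z (\<lambda>x. \<phi>' (\<phi> x)) (\<lambda>z. \<psi> (\<psi>' z))"
  using assms unfolding inverse_morphisms_def
  by (auto intro: morphism_compose simp: morphism_in)

lemma inverse_morphisms_sub_space:
  assumes "fspace X" "fspace Y" "inverse_morphisms X Y \<phi> \<psi>"
    and "\<And>x. x \<in> pts X \<Longrightarrow> x \<in> A \<Longrightarrow> \<phi> x \<in> B" "\<And>y. y \<in> pts Y \<Longrightarrow> y \<in> B \<Longrightarrow> \<psi> y \<in> A"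
  shows "inverse_morphisms (sub_space X A) (sub_space Y B) \<phi> \<psi>"
  unfolding inverse_morphisms_def
proof (intro conjI)
  show "morphism (sub_space X A) (sub_space Y B) \<phi>"
    by (rule morphism_sub_spaceI[OF _ morphism_sub_space_dom]) (use assms in \<open>auto simp: inverse_morphisms_def\<close>)
  show "morphism (sub_space Y B) (sub_space X A) \<psi>"
    by (rule morphism_sub_spaceI[OF _ morphism_sub_space_dom]) (use assms in \<open>auto simp: inverse_morphisms_def\<close>)
qed (use assms in \<open>auto simp: inverse_morphisms_def\<close>)

lemma inverse_morphisms_closure_of:
  assumes "inverse_morphisms X Y \<phi> \<psi>" "S \<subseteq> pts X"
  shows "rtop Y closure_of (\<phi> ` S) = \<phi> ` (rtop X closure_of S)"
proof -
  have c: "continuous_map (rtop X) (rtop Y) \<phi>" "continuous_map (rtop Y) (rtop X) \<psi>"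
    using assms by (auto simp: inverse_morphisms_def morphism_continuous)
  have "\<psi> (\<phi> x) = x" if "x \<in> S" for x using inverse_morphismsD(3)[OF assms(1)] assms(2) that by blast
  then have S: "\<psi> ` \<phi> ` S = S" by (simp add: image_image)
  have "\<psi> ` (rtop Y closure_of (\<phi> ` S)) \<subseteq> rtop X closure_of S"
    using continuous_map_image_closure_subset[OF c(2), of "\<phi> ` S"] S by simp
  then have "y \<in> \<phi> ` (rtop X closure_of S)" if "y \<in> rtop Y closure_of (\<phi> ` S)" for y
    using that in_closure_of[of y "rtop Y"] inverse_morphismsD(4)[OF assms(1), of y]
    by (metis image_eqI image_subset_iff)
  then show ?thesis using continuous_map_image_closure_subset[OF c(1), of S] by blast
qed

lemma smooth_variety_transfer:
  assumes X: "fspace X" and Y: "fspace Y" and iso: "inverse_morphisms X Y \<phi> \<psi>" and smooth: "smooth_variety X"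
  shows "smooth_variety Y"
proof -
  obtain d where d: "\<forall>p\<in>pts X. \<exists>U W \<theta>. openin (rtop X) U \<and> p \<in> U \<and>
     openin (rtop (orthant d)) W \<and> isomorphism (sub_space X U) (sub_space (orthant d) W) \<theta>"
    using smooth unfolding smooth_variety_def by blast
  show ?thesis unfolding smooth_variety_def
  proof (intro exI[of _ d] ballI)
    fix p assume p: "p \<in> pts Y"
    then obtain U W \<theta> \<theta>' where U: "openin (rtop X) U" "\<psi> p \<in> U" "openin (rtop (orthant d)) W"
      "inverse_morphisms (sub_space X U) (sub_space (orthant d) W) \<theta> \<theta>'"
      using d inverse_morphismsD(6)[OF iso] unfolding isomorphism_iff by meson
    let ?U = "{y \<in> pts Y. \<psi> y \<in> U}"
    have "inverse_morphisms (sub_space Y ?U) (sub_space X U) \<psi> \<phi>"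
      by (rule inverse_morphisms_sub_space[OF Y X inverse_morphisms_sym[OF iso]])
        (use inverse_morphismsD[OF iso] in auto)
    from inverse_morphisms_trans[OF this U(4)]
    show "\<exists>U W \<theta>. openin (rtop Y) U \<and> p \<in> U \<and> openin (rtop (orthant d)) W \<and>
        isomorphism (sub_space Y U) (sub_space (orthant d) W) \<theta>"
      using p U morphism_open[OF inverse_morphismsD(2)[OF iso] U(1)] unfolding isomorphism_iff by blast
  qed
qed

section \<open>Projective space and simplices\<close>

lemma mem_hpoint: "y \<in> hpoint S x \<longleftrightarrow> (\<exists>c. c \<noteq> 0 \<and> y = (\<lambda>i\<in>S. c * x i))"
  by (auto simp: hpoint_def)

lemma hpoint_scale:
  assumes "c \<noteq> 0" "\<And>i. i \<in> S \<Longrightarrow> y i = c * x i"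
  shows "hpoint S y = hpoint S x"
proof (rule set_eqI)
  fix z
  have "(\<exists>d. d \<noteq> 0 \<and> z = (\<lambda>i\<in>S. d * y i)) \<longleftrightarrow> (\<exists>d. d \<noteq> 0 \<and> z = (\<lambda>i\<in>S. d * x i))"
  proof safe
    fix d :: real assume "d \<noteq> 0"
    then show "\<exists>d'. d' \<noteq> 0 \<and> (\<lambda>i\<in>S. d * y i) = (\<lambda>i\<in>S. d' * x i)"
      using assms by (intro exI[of _ "d * c"]) (auto intro!: restrict_ext)
    show "\<exists>d'. d' \<noteq> 0 \<and> (\<lambda>i\<in>S. d * x i) = (\<lambda>i\<in>S. d' * y i)"
      using assms \<open>d \<noteq> 0\<close> by (intro exI[of _ "d / c"]) (auto intro!: restrict_ext)
  qed
  then show "z \<in> hpoint S y \<longleftrightarrow> z \<in> hpoint S x" by (simp add: mem_hpoint)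
qed

lemma hpoint_restrict [simp]: "hpoint S (\<lambda>i\<in>S. f i) = hpoint S f"
  by (rule hpoint_scale[of 1]) auto

lemma nonzero_vectors_restrict [simp]: "(\<lambda>i\<in>S. f i) \<in> nonzero_vectors S \<longleftrightarrow> (\<exists>i\<in>S. f i \<noteq> 0)"
  by (auto simp: nonzero_vectors_def)

text \<open>\<open>hratio\<close> and \<open>normalize_rep\<close> pick a representative by
  \<open>SOME\<close>; all that is known of it is that it is a nonzero, possibly negative, multiple
  of the given one.\<close>

lemma hpoint_rep:
  assumes "\<exists>i\<in>S. x i \<noteq> 0"
  obtains c where "c \<noteq> 0" "(SOME y. y \<in> hpoint S x) = (\<lambda>i\<in>S. c * x i)"
proof -
  have "(\<lambda>i\<in>S. 1 * x i) \<in> hpoint S x" unfolding mem_hpoint by (rule exI[of _ 1]) auto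
  then have "(SOME y. y \<in> hpoint S x) \<in> hpoint S x" by (rule someI[of "\<lambda>y. y \<in> hpoint S x"])
  then show thesis using that by (auto simp: mem_hpoint)
qed

lemma hratio_hpoint:
  assumes "i \<in> S" "j \<in> S" "\<exists>i\<in>S. x i \<noteq> 0"
  shows "hratio i j (hpoint S x) = x i / x j"
proof -
  obtain c where "c \<noteq> 0" "(SOME y. y \<in> hpoint S x) = (\<lambda>i\<in>S. c * x i)" using hpoint_rep[OF assms(3)] .
  then show ?thesis using assms(1,2) by (simp add: hratio_def)
qed

lemma hpoint_eqD:
  assumes "hpoint S x = hpoint S y" "\<exists>i\<in>S. x i \<noteq> 0" "\<exists>i\<in>S. y i \<noteq> 0"
  obtains c where "c \<noteq> 0" "\<And>i. i \<in> S \<Longrightarrow> y i = c * x i"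
proof -
  have "(\<lambda>i\<in>S. 1 * y i) \<in> hpoint S y" unfolding mem_hpoint by (rule exI[of _ 1]) auto
  then obtain c where "c \<noteq> 0" "(\<lambda>i\<in>S. 1 * y i) = (\<lambda>i\<in>S. c * x i)" unfolding assms(1)[symmetric] mem_hpoint
    by blast
  then have "y i = c * x i" if "i \<in> S" for i using that by (metis mult_1 restrict_apply')
  then show thesis using that \<open>c \<noteq> 0\<close> by blast
qed

lemma hpoint_eqI:
  assumes "\<exists>i\<in>S. x i \<noteq> 0" "\<exists>i\<in>S. y i \<noteq> 0" "\<And>i j. i \<in> S \<Longrightarrow> j \<in> S \<Longrightarrow> x i * y j = x j * y i"
  shows "hpoint S x = hpoint S y"
proof -
  obtain k where k: "k \<in> S" "x k \<noteq> 0" using assms by blast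
  have y: "y i = (y k / x k) * x i" if "i \<in> S" for i using assms(3)[of k i] that k by (simp add: field_simps)
  then have "y k \<noteq> 0" using assms(2) by force
  then have "y k / x k \<noteq> 0" using k by simp
  from hpoint_scale[OF this y] show ?thesis by (rule sym)
qed

section \<open>Quotient topology and charts of projective space\<close>

abbreviation cone_top :: "'i set \<Rightarrow> ('i \<Rightarrow> real) topology" where
  "cone_top S \<equiv> subtopology (product_topology (\<lambda>_. euclidean) S) (nonzero_vectors S)"

lemma topspace_cone_top [simp]: "topspace (cone_top S) = nonzero_vectors S"
  by (auto simp: nonzero_vectors_def)

lemma nonzero_vectors_ex: "x \<in> nonzero_vectors S \<Longrightarrow> \<exists>i\<in>S. x i \<noteq> 0"
  by (simp add: nonzero_vectors_def)

lemma continuous_map_hpoint: "continuous_map (cone_top S) (proj_topology S) (hpoint S)"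
  unfolding continuous_map_def topspace_cone_top topspace_proj_topology by (auto simp: openin_proj_topology)

text \<open>The universal property of the quotient topology, over an open set: the preimage of
  \<open>U\<close> is open and saturated, so the quotient property survives the restriction.\<close>

lemma continuous_map_from_proj_topology:
  assumes U: "openin (proj_topology S) U"
    and f: "continuous_map (subtopology (cone_top S) {x \<in> nonzero_vectors S. hpoint S x \<in> U}) T (\<lambda>x. f
        (hpoint S x))"
  shows "continuous_map (subtopology (proj_topology S) U) T f"
  unfolding continuous_map_def
proof (intro conjI allI impI funcsetI)
  let ?C = "{x \<in> nonzero_vectors S. hpoint S x \<in> U}"
  have UI: "U \<subseteq> hpoint S ` nonzero_vectors S" "openin (cone_top S) ?C"
    using U unfolding openin_proj_topology by auto
  have tops: "topspace (subtopology (cone_top S) ?C) = ?C"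
    unfolding topspace_subtopology[of "cone_top S"] topspace_cone_top by auto
  show "f p \<in> topspace T" if "p \<in> topspace (subtopology (proj_topology S) U)" for p
    using that UI f tops by (auto simp: continuous_map_def)
  fix V assume V: "openin T V"
  have "openin (subtopology (cone_top S) ?C) {x \<in> ?C. f (hpoint S x) \<in> V}"
    using f[unfolded continuous_map_def tops] V by blast
  then have "openin (cone_top S) {x \<in> ?C. f (hpoint S x) \<in> V}"
    using UI(2) openin_trans_full by blast
  moreover have "{x \<in> nonzero_vectors S. hpoint S x \<in> {p \<in> U. f p \<in> V}} = {x \<in> ?C. f (hpoint S x) \<in> V}" by blast
  ultimately have "openin (proj_topology S) {p \<in> U. f p \<in> V}"
    unfolding openin_proj_topology using UI by auto
  moreover have "{x \<in> topspace (subtopology (proj_topology S) U). f x \<in> V} = {p \<in> U. f p \<in> V}"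
    using UI by (auto simp: topspace_proj_topology)
  ultimately show "openin (subtopology (proj_topology S) U) {x \<in> topspace (subtopology (proj_topology S)
      U). f x \<in> V}"
    using U by (auto simp: openin_open_subtopology)
qed

lemma continuous_map_coordinate: "i \<in> S \<Longrightarrow> continuous_map (subtopology (product_topology (\<lambda>_.
    euclideanreal) S) A) euclideanreal (\<lambda>x. x i)"
  by (intro continuous_map_from_subtopology continuous_map_product_projection)

abbreviation proj_chart :: "'i set \<Rightarrow> 'i \<Rightarrow> ('i \<Rightarrow> real) set set" where
  "proj_chart S j \<equiv> hpoint S ` {x \<in> nonzero_vectors S. x j \<noteq> 0}"

lemma hpoint_in_proj_chart:
  assumes "j \<in> S" "x \<in> nonzero_vectors S" shows "hpoint S x \<in> proj_chart S j \<longleftrightarrow> x j \<noteq> 0"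
proof
  assume "hpoint S x \<in> proj_chart S j"
  then obtain y where "y \<in> nonzero_vectors S" "y j \<noteq> 0" "hpoint S y = hpoint S x" by auto
  then show "x j \<noteq> 0" using assms hpoint_eqD[of S y x] nonzero_vectors_ex by (metis mult_eq_0_iff)
qed (use assms in blast)

lemma openin_proj_chart:
  assumes "j \<in> S" shows "openin (proj_topology S) (proj_chart S j)"
  unfolding openin_proj_topology
proof
  have "{x \<in> nonzero_vectors S. hpoint S x \<in> proj_chart S j} = {x \<in> topspace (cone_top S). x j \<in> -{0}}"
    unfolding topspace_cone_top using hpoint_in_proj_chart[OF assms] by blast
  moreover have "openin (cone_top S) {x \<in> topspace (cone_top S). x j \<in> -{0}}"
    using continuous_map_coordinate[OF assms, of "nonzero_vectors S"] unfolding continuous_map by auto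
  ultimately show "openin (cone_top S) {x \<in> nonzero_vectors S. hpoint S x \<in> proj_chart S j}" by simp
qed auto

lemma rtop_proj_space [simp]: "rtop (proj_space S) = proj_topology S"
  by (simp add: proj_space_def)

lemma pts_proj_space: "pts (proj_space S) = hpoint S ` nonzero_vectors S"
  by (simp add: topspace_proj_topology)

lemma fspace_proj_space [simp]: "fspace (proj_space S)"
  unfolding proj_space_def
proof (rule fspace_gen_space)
  fix W g assume "(W, g) \<in> {(proj_chart S j, hratio i j) | i j. i \<in> S \<and> j \<in> S}"
  then obtain i j where ij: "i \<in> S" "j \<in> S" "W = proj_chart S j" "g = hratio i j" by auto
  let ?C = "{x \<in> nonzero_vectors S. hpoint S x \<in> W}"
  have "continuous_map (subtopology (cone_top S) ?C) euclideanreal (\<lambda>x. x i / x j)"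
    by (intro continuous_map_real_divide)
      (use ij hpoint_in_proj_chart[OF ij(2)] in \<open>auto simp: subtopology_subtopology intro!:
          continuous_map_coordinate\<close>)
  then have "continuous_map (subtopology (cone_top S) ?C) euclideanreal (\<lambda>x. g (hpoint S x))"
    by (rule continuous_map_eq) (use ij in \<open>auto simp: hratio_hpoint nonzero_vectors_ex\<close>)
  then show "continuous_map (subtopology (proj_topology S) W) euclideanreal g"
    using ij openin_proj_chart by (intro continuous_map_from_proj_topology) auto
qed

lemma hratio_reg: "i \<in> S \<Longrightarrow> j \<in> S \<Longrightarrow> hratio i j \<in> reg (proj_space S) (proj_chart S j)"
  unfolding proj_space_def by (rule reg_gen_spaceI) (auto intro: openin_proj_chart)

lemma morphism_proj_space:
  assumes X: "fspace X" and g: "\<And>i. i \<in> S \<Longrightarrow> g i \<in> reg X (pts X)"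
    and nz: "\<And>x. x \<in> pts X \<Longrightarrow> \<exists>i\<in>S. g i x \<noteq> 0"
  shows "morphism X (proj_space S) (\<lambda>x. hpoint S (\<lambda>i. g i x))"
  unfolding proj_space_def
proof (rule morphism_gen_space[OF X])
  have "continuous_map (rtop X) (product_topology (\<lambda>_. euclidean) S) (\<lambda>x. \<lambda>i\<in>S. g i x)"
    using fspace.reg_continuous[OF X g] by (auto simp: continuous_map_componentwise)
  then have "continuous_map (rtop X) (cone_top S) (\<lambda>x. \<lambda>i\<in>S. g i x)"
    using nz by (auto simp: continuous_map_in_subtopology)
  from continuous_map_compose[OF this continuous_map_hpoint]
  show "continuous_map (rtop X) (proj_topology S) (\<lambda>x. hpoint S (\<lambda>i. g i x))" by (simp add: o_def)
  fix W h assume "(W, h) \<in> {(proj_chart S j, hratio i j) | i j. i \<in> S \<and> j \<in> S}"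
  then obtain i j where ij: "i \<in> S" "j \<in> S" "W = proj_chart S j" "h = hratio i j" by auto
  have "hpoint S (\<lambda>i. g i x) \<in> W \<longleftrightarrow> g j x \<noteq> 0" if "x \<in> pts X" for x
    using hpoint_in_proj_chart[OF ij(2), of "\<lambda>i\<in>S. g i x"] nz[OF that] ij
    unfolding hpoint_restrict nonzero_vectors_restrict by simp
  then have W: "{x \<in> pts X. hpoint S (\<lambda>i. g i x) \<in> W} = {x \<in> pts X. g j x \<noteq> 0}" by blast
  have op: "openin (rtop X) {x \<in> pts X. g j x \<noteq> 0}" using fspace.reg_nonzero_open[OF X g[OF ij(2)]] .
  have "(\<lambda>x. g i x / g j x) \<in> reg X {x \<in> pts X. g j x \<noteq> 0}"
    by (rule fspace.reg_divide[OF X]) (use ij g op fspace.reg_subset[OF X] in auto)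
  then show "(\<lambda>x. h (hpoint S (\<lambda>i. g i x))) \<in> reg X {x \<in> pts X. hpoint S (\<lambda>i. g i x) \<in> W}"
    unfolding W by (rule fspace.reg_cong[OF X]) (use ij nz in \<open>auto simp: hratio_hpoint\<close>)
qed

text \<open>Homogeneous coordinates of a map to projective space exist locally only: near
  \<open>x\<close> one divides by a coordinate \<open>j\<close> that does not vanish at
  \<open>v x\<close>, which makes the \<open>j\<close>-th one equal to 1.\<close>

lemma morphism_proj_space_local:
  assumes X: "fspace X" and v: "morphism X (proj_space S) v" and x: "x \<in> pts X"
  obtains V g where "openin (rtop X) V" "x \<in> V" "\<forall>i\<in>S. g i \<in> reg X V"
    "\<forall>y\<in>V. \<exists>i\<in>S. g i y \<noteq> 0" "\<forall>y\<in>V. v y = hpoint S (\<lambda>i. g i y)"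
proof -
  obtain u where u: "u \<in> nonzero_vectors S" "v x = hpoint S u"
    using morphism_in[OF v x] unfolding pts_proj_space by blast
  then obtain j where j: "j \<in> S" "u j \<noteq> 0" using nonzero_vectors_ex by blast
  let ?V = "{y \<in> pts X. v y \<in> proj_chart S j}"
  have V: "openin (rtop X) ?V" using morphism_open[OF v, of "proj_chart S j"] openin_proj_chart[OF j(1)] by simp
  have r: "(\<lambda>y. hratio i j (v y)) \<in> reg X ?V" if "i \<in> S" for i
    using morphism_reg[OF v hratio_reg[OF that j(1)]] openin_proj_chart[OF j(1)] by simp
  have e: "hratio j j (v y) = 1 \<and> v y = hpoint S (\<lambda>i. hratio i j (v y))" if "y \<in> ?V" for y
  proof -
    obtain w where w: "w \<in> nonzero_vectors S" "w j \<noteq> 0" "v y = hpoint S w" using \<open>y \<in> ?V\<close> by blast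
    then have "hratio i j (v y) = w i / w j" if "i \<in> S" for i
      using that j by (simp add: hratio_hpoint nonzero_vectors_ex)
    then show ?thesis using w j hpoint_scale[of "1 / w j" S "\<lambda>i. hratio i j (v y)" w] by simp
  qed
  show thesis
  proof (rule that[OF V])
    show "x \<in> ?V" using x u j by auto
    show "\<forall>i\<in>S. (\<lambda>y. hratio i j (v y)) \<in> reg X ?V" using r by blast
    show "\<forall>y\<in>?V. \<exists>i\<in>S. hratio i j (v y) \<noteq> 0" using e j(1) by (metis (lifting) zero_neq_one)
    show "\<forall>y\<in>?V. v y = hpoint S (\<lambda>i. hratio i j (v y))" using e by blast
  qed
qed

text \<open>A line is determined by the orthogonal projection onto it. \<open>F\<close> sends
  \<open>[x]\<close> to the matrix with entries \<open>x i * x j / |x|^2\<close>, a continuous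
  injection into a product of real lines.\<close>

lemma Hausdorff_proj_topology:
  assumes "finite S" shows "Hausdorff_space (proj_topology S)"
proof -
  define F :: "('a \<Rightarrow> real) set \<Rightarrow> 'a \<times> 'a \<Rightarrow> real" where
    "F p = (let u = (SOME u. u \<in> p) in (\<lambda>z\<in>S\<times>S. u (fst z) * u (snd z) / (\<Sum>k\<in>S. (u k)\<^sup>2)))" for p
  have F: "F (hpoint S x) = (\<lambda>z\<in>S\<times>S. x (fst z) * x (snd z) / (\<Sum>k\<in>S. (x k)\<^sup>2))" if nz: "\<exists>i\<in>S. x i \<noteq> 0" for x
  proof -
    obtain c where c: "c \<noteq> 0" "(SOME y. y \<in> hpoint S x) = (\<lambda>i\<in>S. c * x i)" using hpoint_rep[OF nz] .
    have "(\<Sum>k\<in>S. ((\<lambda>i\<in>S. c * x i) k)\<^sup>2) = c\<^sup>2 * (\<Sum>k\<in>S. (x k)\<^sup>2)"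
      by (simp add: sum_distrib_left power_mult_distrib cong: sum.cong)
    then show ?thesis using c unfolding F_def Let_def
      by (auto intro!: restrict_ext simp: power2_eq_square)
  qed
  have pos: "(\<Sum>k\<in>S. (x k)\<^sup>2) > 0" if "\<exists>i\<in>S. x i \<noteq> 0" for x :: "'a \<Rightarrow> real"
    using that assms by (auto intro!: sum_pos2)
  have nz: "(\<Sum>k\<in>S. (x k)\<^sup>2) \<noteq> 0" if "x \<in> nonzero_vectors S" for x :: "'a \<Rightarrow> real"
    using pos[OF nonzero_vectors_ex[OF that]] by simp
  let ?T = "product_topology (\<lambda>_. euclideanreal) (S \<times> S)"
  have "continuous_map (subtopology (cone_top S) {x \<in> nonzero_vectors S. hpoint S x \<in> topspace
      (proj_topology S)})
      ?T (\<lambda>x. \<lambda>z\<in>S\<times>S. x (fst z) * x (snd z) / (\<Sum>k\<in>S. (x k)\<^sup>2))"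
    unfolding continuous_map_componentwise
  proof (intro conjI ballI)
    fix ij assume "ij \<in> S \<times> S"
    then obtain i j where ij: "ij = (i, j)" "i \<in> S" "j \<in> S" by auto
    have "continuous_map (subtopology (product_topology (\<lambda>_. euclidean) S) (nonzero_vectors S \<inter> {x \<in>
        nonzero_vectors S. hpoint S x \<in> topspace (proj_topology S)}))
        euclideanreal (\<lambda>x. x i * x j / (\<Sum>k\<in>S. (x k)\<^sup>2))"
      by (intro continuous_map_real_divide continuous_map_real_mult continuous_map_sum assms
          continuous_map_real_pow
          continuous_map_coordinate ij) (auto simp: nz)
    then show "continuous_map (subtopology (cone_top S) {x \<in> nonzero_vectors S. hpoint S x \<in> topspace
        (proj_topology S)})
      euclideanreal (\<lambda>x. (\<lambda>z\<in>S\<times>S. x (fst z) * x (snd z) / (\<Sum>k\<in>S. (x k)\<^sup>2)) ij)"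
      using ij by (simp add: subtopology_subtopology)
  qed auto
  then have "continuous_map (subtopology (cone_top S) {x \<in> nonzero_vectors S. hpoint S x \<in> topspace
      (proj_topology S)})
      ?T (\<lambda>x. F (hpoint S x))"
    by (rule continuous_map_eq) (auto simp: F nonzero_vectors_ex)
  from continuous_map_from_proj_topology[OF openin_topspace this]
  have cont: "continuous_map (proj_topology S) ?T F" by simp
  have inj: "inj_on F (topspace (proj_topology S))"
  proof (rule inj_onI)
    fix p q assume "p \<in> topspace (proj_topology S)" "q \<in> topspace (proj_topology S)" and e: "F p = F q"
    then obtain x y where xy: "x \<in> nonzero_vectors S" "y \<in> nonzero_vectors S" "p = hpoint S x" "q = hpoint S y"
      by (auto simp: topspace_proj_topology)
    let ?s = "\<Sum>k\<in>S. (x k)\<^sup>2" and ?t = "\<Sum>k\<in>S. (y k)\<^sup>2"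
    have *: "x i * x j / ?s = y i * y j / ?t" if "i \<in> S" "j \<in> S" for i j
      using fun_cong[OF e, of "(i, j)"] that xy by (simp add: F nonzero_vectors_ex)
    have st: "?s > 0" "?t > 0" using pos xy nonzero_vectors_ex by blast+
    obtain k where k: "k \<in> S" "x k \<noteq> 0" using xy nonzero_vectors_ex by blast
    have "y k \<noteq> 0" using *[OF k(1) k(1)] k st by auto
    have yy: "y i * y j = ?t / ?s * (x i * x j)" if "i \<in> S" "j \<in> S" for i j using *[OF that] st
      by (simp add: field_simps)
    have "x i * y j = x j * y i" if "i \<in> S" "j \<in> S" for i j
    proof -
      \<comment> \<open>By \<open>yy\<close>, both sides equal \<open>?t / ?s\<close> times the
        product of \<open>x i\<close>, \<open>x j\<close> and \<open>x k\<close>.\<close>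
      have "(x i * y j) * y k = (x j * y i) * y k"
        using yy[OF that(2) k(1)] yy[OF that(1) k(1)] by (simp add: mult.assoc)
      then show ?thesis using \<open>y k \<noteq> 0\<close> by simp
    qed
    then show "p = q" unfolding xy
      by (rule hpoint_eqI[OF nonzero_vectors_ex[OF xy(1)] nonzero_vectors_ex[OF xy(2)]])
  qed
  show ?thesis
    using Hausdorff_space_injective_preimage[OF _ cont inj] by (simp add: Hausdorff_space_product_topology)
qed

section \<open>The projective simplex and the simplex of metrics of volume one\<close>

definition normalize_rep :: "'i set \<Rightarrow> ('i \<Rightarrow> real) set \<Rightarrow> 'i \<Rightarrow> real" where
  "normalize_rep S p = rescale S (SOME u. u \<in> p)"

text \<open>A negative \<open>c\<close> cancels as well, between the coordinates and their sum;
  therefore rescaling is well defined on points of projective space.\<close>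

lemma rescale_scale:
  assumes "c \<noteq> 0" "\<And>e. e \<in> S \<Longrightarrow> y e = c * x e" shows "rescale S y = rescale S x"
proof -
  have "sum y S = c * sum x S" using assms(2) by (simp add: sum_distrib_left)
  then show ?thesis using assms by (auto simp: rescale_def intro!: restrict_ext)
qed

lemma normalize_rep_hpoint:
  assumes "\<exists>i\<in>S. x i \<noteq> 0" shows "normalize_rep S (hpoint S x) = rescale S x"
proof -
  obtain c where "c \<noteq> 0" "(SOME y. y \<in> hpoint S x) = (\<lambda>i\<in>S. c * x i)" using hpoint_rep[OF assms] .
  then show ?thesis unfolding normalize_rep_def by (simp add: rescale_scale[of c])
qed

lemma rescale_in_std_simplex:
  assumes "\<And>e. e \<in> S \<Longrightarrow> 0 \<le> x e" "sum x S \<noteq> 0" shows "rescale S x \<in> std_simplex S"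
  using assms unfolding std_simplex_def rescale_def
  by (auto simp: sum_divide_distrib[symmetric] intro!: divide_nonneg_nonneg sum_nonneg cong: sum.cong)

lemma rescale_std_simplex: "x \<in> std_simplex S \<Longrightarrow> rescale S x = x"
  by (auto simp: std_simplex_def rescale_def PiE_def intro!: extensionalityI[of _ S])

lemma std_simplex_nonzero: "x \<in> std_simplex S \<Longrightarrow> \<exists>i\<in>S. x i \<noteq> 0"
  by (rule ccontr) (simp add: std_simplex_def)

lemma hpoint_in_proj_simplex: "x \<in> std_simplex S \<Longrightarrow> hpoint S x \<in> proj_simplex S"
  using std_simplex_nonzero[of x S]
    by (auto simp: proj_simplex_def std_simplex_def nonzero_vectors_def intro!: imageI)

lemma proj_simplex_subset: "proj_simplex S \<subseteq> hpoint S ` nonzero_vectors S"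
  by (auto simp: proj_simplex_def)

lemma proj_simplexE:
  assumes "finite S" "p \<in> proj_simplex S"
  obtains u where "u \<in> nonzero_vectors S" "\<forall>e\<in>S. 0 \<le> u e" "p = hpoint S u" "sum u S > 0"
proof -
  obtain u where u: "u \<in> nonzero_vectors S" "\<forall>e\<in>S. 0 \<le> u e" "p = hpoint S u"
    using assms(2) by (auto simp: proj_simplex_def)
  then obtain i where "i \<in> S" "u i \<noteq> 0" using nonzero_vectors_ex by blast
  then have "sum u S > 0" using u assms(1) by (intro sum_pos2[of S i]) (auto simp: less_le)
  then show thesis using that u by blast
qed

abbreviation simplex_space :: "'e set \<Rightarrow> ('e \<Rightarrow> real) rspace" where
  "simplex_space S \<equiv> sub_space (affine_space S) (std_simplex S)"

lemma pts_simplex_space [simp]: "pts (simplex_space S) = std_simplex S"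
  by (auto simp: std_simplex_def)

lemma pts_proj_simplex_space [simp]: "pts (sub_space (proj_space S) (proj_simplex S)) = proj_simplex S"
  using proj_simplex_subset by (auto simp: topspace_proj_topology)

text \<open>This allows replacing the projective simplices of the second construction by standard
  ones. The inverse is regular: on the chart of a coordinate \<open>j\<close> the sum of the ratios
  \<open>hratio k j\<close> is \<open>sum u S / u j\<close> for a nonnegative representative
  \<open>u\<close>, and this is nonzero.\<close>

lemma inverse_morphisms_simplex:
  assumes S: "finite S"
  shows "inverse_morphisms (simplex_space S) (sub_space (proj_space S) (proj_simplex S)) (hpoint S)
      (normalize_rep S)"
  unfolding inverse_morphisms_def
proof (intro conjI ballI)
  let ?A = "simplex_space S" and ?P = "sub_space (proj_space S) (proj_simplex S)"
  have A: "fspace ?A" and P: "fspace ?P" by simp_all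
  have "morphism ?A (affine_space S) (\<lambda>x. x)" by (simp add: morphism_sub_space_incl)
  then have coord: "(\<lambda>x. x i) \<in> reg ?A (pts ?A)" if "i \<in> S" for i
    using morphism_affine_space[OF A, of "\<lambda>x. x" S] that by (auto simp: PiE_def)
  have "morphism ?A (proj_space S) (\<lambda>x. hpoint S (\<lambda>i. x i))"
    by (rule morphism_proj_space[OF A coord]) (auto dest: std_simplex_nonzero)
  then show "morphism ?A ?P (hpoint S)"
    by (intro morphism_sub_spaceI) (auto intro: hpoint_in_proj_simplex)
  show "morphism ?P ?A (normalize_rep S)"
  proof (rule morphism_local[OF P])
    fix p assume "p \<in> pts ?P"
    then have "p \<in> proj_simplex S" by simp
    then obtain u where u: "u \<in> nonzero_vectors S" "\<forall>e\<in>S. 0 \<le> u e" "p = hpoint S u" "sum u S > 0"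
      using proj_simplexE[OF S] by metis
    then obtain j where j: "j \<in> S" "u j \<noteq> 0" using nonzero_vectors_ex by blast
    let ?V = "proj_chart S j \<inter> proj_simplex S"
    have V: "openin (rtop ?P) ?V" using openin_proj_chart[OF j(1)] by (auto simp: openin_subtopology)
    let ?Q = "sub_space ?P ?V"
    have Q: "fspace ?Q" by simp
    have ptsQ: "pts ?Q = ?V" using proj_simplex_subset[of S] by (auto simp: topspace_proj_topology)
    have r: "hratio i j \<in> reg ?Q (pts ?Q)" if "i \<in> S" for i
      using reg_sub_space_restrict[OF fspace_proj_space hratio_reg[OF that j(1)], of "proj_simplex S"]
      unfolding ptsQ by (subst reg_sub_space_open[OF P V]) blast
    have e: "normalize_rep S p = (\<lambda>i\<in>S. hratio i j p / (\<Sum>k\<in>S. hratio k j p))"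
        "(\<Sum>k\<in>S. hratio k j p) \<noteq> 0" "normalize_rep S p \<in> std_simplex S"
      if "p \<in> pts ?Q" for p
    proof -
      have "p \<in> proj_simplex S" "p \<in> proj_chart S j" using that unfolding ptsQ by blast+
      obtain u where u: "u \<in> nonzero_vectors S" "\<forall>e\<in>S. 0 \<le> u e" "p = hpoint S u" "sum u S > 0"
        by (rule proj_simplexE[OF S \<open>p \<in> proj_simplex S\<close>])
      then have uj: "u j \<noteq> 0" using hpoint_in_proj_chart[OF j(1) u(1)] \<open>p \<in> proj_chart S j\<close> by simp
      have *: "hratio i j p = u i / u j" if "i \<in> S" for i using that u j
        by (simp add: hratio_hpoint nonzero_vectors_ex)
      have "(\<Sum>k\<in>S. hratio k j p) = sum u S / u j" by (simp add: * sum_divide_distrib)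
      then show "(\<Sum>k\<in>S. hratio k j p) \<noteq> 0" "normalize_rep S p = (\<lambda>i\<in>S. hratio i j p / (\<Sum>k\<in>S. hratio k j p))"
        using u(4) uj * unfolding u(3) normalize_rep_hpoint[OF nonzero_vectors_ex[OF u(1)]]
        by (auto simp: rescale_def intro!: restrict_ext)
      show "normalize_rep S p \<in> std_simplex S"
        using u(2,4) unfolding u(3) normalize_rep_hpoint[OF nonzero_vectors_ex[OF u(1)]]
        by (intro rescale_in_std_simplex) auto
    qed
    have "morphism ?Q (affine_space S) (\<lambda>p. \<lambda>i\<in>S. hratio i j p / (\<Sum>k\<in>S. hratio k j p))"
    proof (rule morphism_affine_space[OF Q, THEN iffD2])
      have "(\<lambda>p. hratio i j p / (\<Sum>k\<in>S. hratio k j p)) \<in> reg ?Q (pts ?Q)" if "i \<in> S" for i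
        by (intro fspace.reg_divide[OF Q] fspace.reg_sum[OF Q] r that openin_topspace ballI e(2))
      then show "\<forall>i\<in>S. (\<lambda>p. (\<lambda>i\<in>S. hratio i j p / (\<Sum>k\<in>S. hratio k j p)) i) \<in> reg ?Q (pts ?Q)" by simp
    qed simp
    then have "morphism ?Q (affine_space S) (normalize_rep S)" by (rule morphism_cong[OF Q]) (rule e(1))
    then have "morphism ?Q ?A (normalize_rep S)" by (rule morphism_sub_spaceI[OF Q _ e(3)])
    then show "\<exists>V \<psi>. openin (rtop ?P) V \<and> p \<in> V \<and> morphism (sub_space ?P V) ?A \<psi> \<and> (\<forall>x\<in>V. normalize_rep
        S x = \<psi> x)"
      using V u j \<open>p \<in> proj_simplex S\<close> by (intro exI[of _ ?V] exI[of _ "normalize_rep S"]) auto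
  qed
  show "normalize_rep S (hpoint S x) = x" if "x \<in> pts ?A" for x
    using that by (simp add: normalize_rep_hpoint std_simplex_nonzero rescale_std_simplex)
  show "hpoint S (normalize_rep S p) = p" if "p \<in> pts ?P" for p
  proof -
    have "p \<in> proj_simplex S" using that by simp
    then obtain u where u: "u \<in> nonzero_vectors S" "p = hpoint S u" "sum u S > 0"
      using proj_simplexE[OF S] by metis
    show ?thesis unfolding u(2) normalize_rep_hpoint[OF nonzero_vectors_ex[OF u(1)]]
      using u by (intro hpoint_scale[of "1 / sum u S"]) (auto simp: rescale_def)
  qed
qed

text \<open>A closed condition passes to the closure even if \<open>h\<close> is defined only near
  \<open>p\<close>, as is the case for conditions written in one chart of projective space.\<close>

lemma closure_of_continuous_map_closed:
  assumes "p \<in> T closure_of A" "openin T V" "p \<in> V" "continuous_map (subtopology T V) euclideanreal h"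
    and "closed C" "\<And>x. x \<in> A \<Longrightarrow> x \<in> V \<Longrightarrow> h x \<in> C"
  shows "h p \<in> C"
proof (rule ccontr)
  assume "h p \<notin> C"
  have V: "topspace (subtopology T V) = V" using openin_subset[OF assms(2)] by auto
  have "openin (subtopology T V) {x \<in> topspace (subtopology T V). h x \<in> - C}"
    using assms(4,5) unfolding continuous_map by (auto simp: open_Compl)
  then have "openin T {x \<in> V. h x \<in> - C}"
    unfolding V using assms(2) openin_trans_full by blast
  moreover have "p \<in> {x \<in> V. h x \<in> - C}" using assms(3) \<open>h p \<notin> C\<close> by simp
  ultimately obtain y where "y \<in> A" "y \<in> {x \<in> V. h x \<in> - C}" using assms(1) unfolding in_closure_of by meson
  then show False using assms(6)[of y] by simp
qed

lemma closedin_proj_simplex: "closedin (proj_topology S) (proj_simplex S)"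
proof (rule closure_of_subset_eq[THEN iffD1], intro conjI subsetI)
  show "p \<in> topspace (proj_topology S)" if "p \<in> proj_simplex S" for p
    using proj_simplex_subset that by (auto simp: topspace_proj_topology)
  fix p assume p: "p \<in> proj_topology S closure_of proj_simplex S"
  then have "p \<in> hpoint S ` nonzero_vectors S"
    using closure_of_subset_topspace topspace_proj_topology by (metis subsetD)
  then obtain u where u: "u \<in> nonzero_vectors S" "p = hpoint S u" by blast
  then obtain k where k: "k \<in> S" "u k \<noteq> 0" using nonzero_vectors_ex by blast
  have pk: "p \<in> proj_chart S k" using u k by blast
  have *: "0 \<le> u i / u k" if i: "i \<in> S" for i
  proof -
    have "hratio i k p \<in> {0..}"
    proof (rule closure_of_continuous_map_closed[OF p openin_proj_chart[OF k(1)] pk])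
      show "continuous_map (subtopology (proj_topology S) (proj_chart S k)) euclideanreal (hratio i k)"
        using fspace.reg_continuous[OF fspace_proj_space hratio_reg[OF i k(1)]] by simp
      fix q assume "q \<in> proj_simplex S"
      then obtain v where "v \<in> nonzero_vectors S" "\<forall>e\<in>S. 0 \<le> v e" "q = hpoint S v"
        by (auto simp: proj_simplex_def)
      then show "hratio i k q \<in> {0..}" using i k by (simp add: hratio_hpoint nonzero_vectors_ex)
    qed simp
    then show ?thesis using i k u by (simp add: hratio_hpoint nonzero_vectors_ex)
  qed
  \<comment> \<open>The representative \<open>u\<close> itself may be negative throughout; dividing
    by \<open>u k\<close> turns it into a nonnegative one.\<close>
  have "p = hpoint S (\<lambda>i\<in>S. u i / u k)"
    unfolding u(2) hpoint_restrict by (rule hpoint_scale[of "u k"]) (use k in auto)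
  moreover have "(\<lambda>i\<in>S. u i / u k) \<in> {x \<in> nonzero_vectors S. \<forall>e\<in>S. 0 \<le> x e}"
    using k * by auto
  ultimately show "p \<in> proj_simplex S" unfolding proj_simplex_def by blast
qed

section \<open>Blow-ups\<close>

abbreviation blowup_graph :: "'a set \<Rightarrow> nat \<Rightarrow> (nat \<Rightarrow> 'a \<Rightarrow> real) \<Rightarrow> ('a \<times> (nat \<Rightarrow> real) set) set" where
  "blowup_graph U m f \<equiv> {(x, hpoint {..<m} (\<lambda>i. f i x)) | x. x \<in> U \<and> (\<exists>i<m. f i x \<noteq> 0)}"

abbreviation blowup_ambient :: "'a rspace \<Rightarrow> 'a set \<Rightarrow> nat \<Rightarrow> ('a \<times> (nat \<Rightarrow> real) set) rspace" where
  "blowup_ambient X U m \<equiv> prod_space (sub_space X U) (proj_space {..<m})"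

lemma graph_blowup_eq:
  "graph_blowup X U m f =
     sub_space (blowup_ambient X U m) (rtop (blowup_ambient X U m) closure_of blowup_graph U m f)"
  unfolding graph_blowup_def Let_def hpoint_restrict ..

lemma fspace_graph_blowup [simp]: "fspace X \<Longrightarrow> fspace (graph_blowup X U m f)"
  by (simp add: graph_blowup_eq)

lemma pts_graph_blowup: "pts (graph_blowup X U m f) = rtop (blowup_ambient X U m) closure_of blowup_graph U m f"
  unfolding graph_blowup_eq rtop_sub_space topspace_subtopology
  by (rule Int_absorb1[OF closure_of_subset_topspace])

lemma blowup_graph_subset:
  assumes "U \<subseteq> pts X" shows "blowup_graph U m f \<subseteq> pts (blowup_ambient X U m)"
proof -
  have "hpoint {..<m} (\<lambda>i. f i x) \<in> hpoint {..<m} ` nonzero_vectors {..<m}" if "\<exists>i<m. f i x \<noteq> 0" for x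
    using that by (intro image_eqI[of _ _ "\<lambda>i\<in>{..<m}. f i x"]) auto
  then show ?thesis using assms by (auto simp: topspace_proj_topology)
qed

lemma graph_blowup_pointE:
  assumes "(x, p) \<in> pts (graph_blowup X U m f)"
  obtains u where "x \<in> U" "x \<in> pts X" "\<exists>i<m. u i \<noteq> 0" "p = hpoint {..<m} u"
proof -
  have "(x, p) \<in> pts (blowup_ambient X U m)"
    using assms closure_of_subset_topspace unfolding pts_graph_blowup by fast
  then have "x \<in> U \<and> x \<in> pts X \<and> p \<in> hpoint {..<m} ` nonzero_vectors {..<m}"
    by (auto simp: topspace_proj_topology)
  then show thesis using that nonzero_vectors_ex by blast
qed

text \<open>A linear relation with regular coefficients between the generators holds on the graph
  for the homogeneous coordinates, and it is a closed condition; so it also holds at the points over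
  the center. This is the only way in which the closure is exploited.\<close>

lemma graph_blowup_relation:
  assumes X: "fspace X" and U: "openin (rtop X) U" and V: "openin (rtop X) V" "V \<subseteq> U"
    and c: "\<And>i. i < m \<Longrightarrow> c i \<in> reg X V"
    and rel: "\<And>x. x \<in> V \<Longrightarrow> (\<Sum>i<m. c i x * f i x) = 0"
    and xp: "(x, hpoint {..<m} u) \<in> pts (graph_blowup X U m f)" "x \<in> V" "\<exists>i<m. u i \<noteq> 0"
  shows "(\<Sum>i<m. c i x * u i) = 0"
proof -
  let ?P = "blowup_ambient X U m" and ?C = "proj_chart {..<m}"
  obtain k where k: "k < m" "u k \<noteq> 0" using xp by blast
  have P: "fspace ?P" using X by simp
  let ?O = "{z \<in> pts ?P. fst z \<in> V} \<inter> {z \<in> pts ?P. snd z \<in> ?C k}"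
  have Vs: "openin (rtop (sub_space X U)) V" using U V by (simp add: openin_open_subtopology)
  have Co: "openin (rtop (proj_space {..<m})) (?C k)" using openin_proj_chart[of k "{..<m}"] k by simp
  have O1: "openin (rtop ?P) {z \<in> pts ?P. fst z \<in> V}" by (rule morphism_open[OF morphism_fst Vs])
  have O2: "openin (rtop ?P) {z \<in> pts ?P. snd z \<in> ?C k}" by (rule morphism_open[OF morphism_snd Co])
  have O: "openin (rtop ?P) ?O" using O1 O2 by (rule openin_Int)
  have c': "(\<lambda>z. c i (fst z)) \<in> reg ?P ?O" if "i < m" for i
  proof -
    have "c i \<in> reg (sub_space X U) V" using c[OF that] V reg_sub_space_open[OF X U] by simp
    from morphism_reg[OF morphism_fst this Vs, of "proj_space {..<m}"] show ?thesis
      using fspace.reg_subset[OF P _ O] by blast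
  qed
  have r: "(\<lambda>z. hratio i k (snd z)) \<in> reg ?P ?O" if "i < m" for i
  proof -
    have "hratio i k \<in> reg (proj_space {..<m}) (?C k)" using hratio_reg[of i "{..<m}" k] that k by simp
    from morphism_reg[OF morphism_snd this Co, of "sub_space X U"] show ?thesis
      using fspace.reg_subset[OF P _ O] by blast
  qed
  \<comment> \<open>The relation is homogeneous of degree one in \<open>u\<close>; divided by the
    \<open>k\<close>-th coordinate it becomes a function on a neighbourhood of the given
    point.\<close>
  let ?h = "\<lambda>z. \<Sum>i<m. c i (fst z) * hratio i k (snd z)"
  have "?h \<in> reg ?P ?O" by (intro fspace.reg_sum[OF P] O fspace.reg_mult[OF P] c' r) auto
  then have cont: "continuous_map (subtopology (rtop ?P) ?O) euclideanreal ?h"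
    by (rule fspace.reg_continuous[OF P])
  have hk: "hratio i k (hpoint {..<m} w) = w i / w k" if "i < m" "\<exists>i<m. w i \<noteq> 0" for i w
    using hratio_hpoint[of i "{..<m}" k w] that k by auto
  have "?h (x, hpoint {..<m} u) \<in> {0}"
  proof (rule closure_of_continuous_map_closed[OF xp(1)[unfolded pts_graph_blowup] O _ cont])
    have "(\<lambda>i\<in>{..<m}. u i) \<in> nonzero_vectors {..<m}" unfolding nonzero_vectors_restrict using xp(3) by blast
    then have "hpoint {..<m} (\<lambda>i\<in>{..<m}. u i) \<in> ?C k"
      using hpoint_in_proj_chart[of k "{..<m}" "\<lambda>i\<in>{..<m}. u i"] k by (simp del: hpoint_restrict)
    moreover have "(x, hpoint {..<m} u) \<in> pts ?P"
      using xp(1) closure_of_subset_topspace unfolding pts_graph_blowup by fast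
    ultimately show "(x, hpoint {..<m} u) \<in> ?O" using xp by simp
    fix z assume "z \<in> blowup_graph U m f" and zO: "z \<in> ?O"
    then obtain y where y: "z = (y, hpoint {..<m} (\<lambda>i. f i y))" "y \<in> U" "\<exists>i<m. f i y \<noteq> 0" by blast
    have "y \<in> V" using zO y by simp
    have "?h z = (\<Sum>i<m. c i y * f i y / f k y)" using y hk[OF _ y(3)] by simp
    also have "\<dots> = (\<Sum>i<m. c i y * f i y) / f k y" by (simp add: sum_divide_distrib)
    finally show "?h z \<in> {0}" using rel[OF \<open>y \<in> V\<close>] by simp
  qed simp
  then have "(\<Sum>i<m. c i x * (u i / u k)) = 0" using hk[OF _ xp(3)] by simp
  then have "(\<Sum>i<m. c i x * u i) / u k = 0" by (simp add: sum_divide_distrib)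
  then show ?thesis using k by simp
qed

text \<open>The relation used is the Koszul relation between two generators: coefficient
  \<open>f i\<close> at \<open>j\<close> and \<open>- f j\<close> at \<open>i\<close>.\<close>

lemma graph_blowup_proportional:
  assumes X: "fspace X" and U: "openin (rtop X) U" and f: "\<And>i. i < m \<Longrightarrow> f i \<in> reg X U"
    and xp: "(x, hpoint {..<m} u) \<in> pts (graph_blowup X U m f)" "\<exists>i<m. u i \<noteq> 0" and ij: "i < m" "j < m"
  shows "f i x * u j = f j x * u i"
proof -
  have "x \<in> U" using xp by (rule_tac graph_blowup_pointE) auto
  let ?c = "\<lambda>k x. (if k = j then f i x else 0) - (if k = i then f j x else 0)"
  have s: "(\<Sum>k<m. ?c k x * w k) = f i x * w j - f j x * w i" for x w
    using ij by (simp add: left_diff_distrib sum_subtractf if_distrib[of "\<lambda>a. a * _"] cong: if_cong)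
  have c: "?c k \<in> reg X U" for k
    by (rule fspace.reg_diff[OF X]; cases "k = i"; cases "k = j") (simp_all add: ij f fspace.reg_const[OF X U])
  have "(\<Sum>k<m. ?c k x * u k) = 0"
    by (rule graph_blowup_relation[OF X U U _ c _ xp(1) \<open>x \<in> U\<close> xp(2)]) (simp_all add: s)
  then show ?thesis by (simp add: s)
qed

lemma generates_ideal_matrix:
  fixes n :: nat
  assumes X: "fspace X" and gen: "generates_ideal X Z U m f"
    and V: "openin (rtop X) V" "V \<subseteq> U" "p \<in> V"
    and g: "\<And>i. i < n \<Longrightarrow> g i \<in> reg X V" "\<And>i x. i < n \<Longrightarrow> x \<in> V \<inter> Z \<Longrightarrow> g i x = 0"
  obtains W a where "openin (rtop X) W" "p \<in> W" "W \<subseteq> V"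
    "\<And>i j. i < n \<Longrightarrow> j < m \<Longrightarrow> a i j \<in> reg X W"
    "\<And>i x. i < n \<Longrightarrow> x \<in> W \<Longrightarrow> g i x = (\<Sum>j<m. a i j x * f j x)"
proof -
  define Q where "Q i W a \<longleftrightarrow> openin (rtop X) W \<and> p \<in> W \<and> W \<subseteq> V \<and> (\<forall>j<m. a j \<in> reg X W) \<and>
      (\<forall>x\<in>W. g i x = (\<Sum>j<m. a j x * f j x))" for i W and a :: "nat \<Rightarrow> 'a \<Rightarrow> real"
  have "\<exists>W a. Q i W a" if "i < n" for i
    unfolding Q_def
    by (rule gen[unfolded generates_ideal_def, THEN conjunct2, THEN conjunct2, rule_format])
      (use V g(1)[OF that] g(2)[OF that] in auto)
  then obtain W a where "\<And>i. i < n \<Longrightarrow> Q i (W i) (a i)" by metis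
  note Wa = this[unfolded Q_def]
  let ?W = "V \<inter> (\<Inter>i\<in>{..<n}. W i)"
  have W: "openin (rtop X) ?W"
  \<comment> \<open>For \<open>n = 0\<close> the empty intersection is the whole type, which need
    not be an open set of \<open>X\<close>; after meeting it with \<open>V\<close> it is
    harmless.\<close>
  proof (cases "n = 0")
    case False
    then have "openin (rtop X) (\<Inter>i\<in>{..<n}. W i)" using Wa by (intro openin_INT2) auto
    then show ?thesis using V by blast
  qed (use V in simp)
  show thesis
  proof (rule that[OF W])
    show "a i j \<in> reg X ?W" if "i < n" "j < m" for i j
      by (rule fspace.reg_subset[OF X _ W]) (use Wa that in auto)
  qed (use V Wa in auto)
qed

section \<open>Density, injectivity off the center, and uniqueness of blow-ups\<close>

lemma is_blowupE:
  assumes "is_blowup X Z Y \<pi>" "p \<in> pts X"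
  obtains U m f \<phi> \<psi> where "openin (rtop X) U" "p \<in> U" "generates_ideal X Z U m f"
    "inverse_morphisms (sub_space Y {y \<in> pts Y. \<pi> y \<in> U}) (graph_blowup X U m f) \<phi> \<psi>"
    "\<forall>y\<in>pts Y. \<pi> y \<in> U \<longrightarrow> fst (\<phi> y) = \<pi> y"
    "\<forall>w\<in>pts (graph_blowup X U m f). \<psi> w \<in> pts Y \<and> \<pi> (\<psi> w) = fst w"
proof -
  obtain U m f \<phi> \<psi> where *: "openin (rtop X) U" "p \<in> U" "generates_ideal X Z U m f"
    "inverse_morphisms (sub_space Y {y \<in> pts Y. \<pi> y \<in> U}) (graph_blowup X U m f) \<phi> \<psi>"
    "\<forall>y\<in>pts Y. \<pi> y \<in> U \<longrightarrow> fst (\<phi> y) = \<pi> y"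
    using assms unfolding is_blowup_def isomorphism_iff by meson
  have "\<psi> w \<in> pts Y \<and> \<pi> (\<psi> w) = fst w" if "w \<in> pts (graph_blowup X U m f)" for w
    using inverse_morphismsD(4,6)[OF *(4) that] *(5)[rule_format, of "\<psi> w"] by simp
  with * show thesis using that by blast
qed

text \<open>Locally a blow-up is the closure of a graph over the points where some generator is
  nonzero, and the generators vanish together exactly on \<open>Z\<close>.\<close>

lemma blowup_dense:
  assumes X: "fspace X" and bl: "is_blowup X Z Y \<pi>"
  shows "rtop Y closure_of {y \<in> pts Y. \<pi> y \<notin> Z} = pts Y"
proof (rule subset_antisym[OF closure_of_subset_topspace], rule subsetI)
  fix y assume y: "y \<in> pts Y"
  have mor: "morphism Y X \<pi>" using bl by (simp add: is_blowup_def)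
  obtain U m f \<phi> \<psi> where U: "openin (rtop X) U" "\<pi> y \<in> U" "generates_ideal X Z U m f"
    "inverse_morphisms (sub_space Y {y \<in> pts Y. \<pi> y \<in> U}) (graph_blowup X U m f) \<phi> \<psi>"
    "\<forall>y\<in>pts Y. \<pi> y \<in> U \<longrightarrow> fst (\<phi> y) = \<pi> y"
    "\<forall>w\<in>pts (graph_blowup X U m f). \<psi> w \<in> pts Y \<and> \<pi> (\<psi> w) = fst w"
    by (rule is_blowupE[OF bl morphism_in[OF mor y]])
  let ?Y = "sub_space Y {y \<in> pts Y. \<pi> y \<in> U}" and ?B = "graph_blowup X U m f" and ?P = "blowup_ambient X U m"
  have ptsY: "pts ?Y = {y \<in> pts Y. \<pi> y \<in> U}" by auto
  show "y \<in> rtop Y closure_of {y \<in> pts Y. \<pi> y \<notin> Z}"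
    unfolding in_closure_of
  proof (intro conjI allI impI y)
    fix T assume T: "y \<in> T \<and> openin (rtop Y) T"
    then have "openin (rtop ?Y) (T \<inter> {y \<in> pts Y. \<pi> y \<in> U})" by (auto simp: openin_subtopology)
    then have o: "openin (rtop ?B) {w \<in> pts ?B. \<psi> w \<in> T \<inter> {y \<in> pts Y. \<pi> y \<in> U}}"
      by (rule morphism_open[OF inverse_morphismsD(2)[OF U(4)]])
    have rB: "rtop ?B = subtopology (rtop ?P) (pts ?B)"
      unfolding pts_graph_blowup by (subst graph_blowup_eq) (rule rtop_sub_space)
    obtain N where N: "openin (rtop ?P) N"
      "{w \<in> pts ?B. \<psi> w \<in> T \<inter> {y \<in> pts Y. \<pi> y \<in> U}} = N \<inter> pts ?B"
      using o[unfolded arg_cong[OF rB, of openin, THEN fun_cong] openin_subtopology] by (elim exE conjE)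
    have yU: "y \<in> pts ?Y" using y U ptsY by simp
    have "\<phi> y \<in> pts ?B" "\<psi> (\<phi> y) = y" using inverse_morphismsD(3,5)[OF U(4)] yU by blast+
    then have "\<phi> y \<in> N \<inter> pts ?B" unfolding N(2)[symmetric] using T y U(2) by simp
    then have "\<phi> y \<in> N" "\<phi> y \<in> rtop ?P closure_of blowup_graph U m f" unfolding pts_graph_blowup
      by (rule IntD1, rule IntD2)
    then obtain w where w: "w \<in> blowup_graph U m f" "w \<in> N" using N(1) by (meson in_closure_of)
    have "blowup_graph U m f \<subseteq> pts ?B"
      unfolding pts_graph_blowup using blowup_graph_subset[OF openin_subset[OF U(1)]]
        by (rule closure_of_subset)
    then have wB: "w \<in> pts ?B" using w by blast
    then have "\<psi> w \<in> T" using N(2) w by blast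
    moreover have "fst w \<notin> Z" using w U(3) unfolding generates_ideal_def by auto
    ultimately show "\<exists>y'. y' \<in> {y \<in> pts Y. \<pi> y \<notin> Z} \<and> y' \<in> T" using U(6)[rule_format, OF wB] by auto
  qed
qed

lemma dense_in_open:
  assumes D: "T closure_of D = topspace T" and V: "openin T V" and y: "y \<in> V"
  shows "y \<in> subtopology T V closure_of (V \<inter> D)"
  unfolding in_closure_of
proof (intro conjI allI impI)
  have sub: "V \<subseteq> topspace T" using V openin_subset by blast
  then show "y \<in> topspace (subtopology T V)" using y by auto
  have y': "y \<in> T closure_of D" using D sub y by blast
  fix W assume W: "y \<in> W \<and> openin (subtopology T V) W"
  then have "openin T W" "W \<subseteq> V" using V by (simp_all add: openin_open_subtopology)
  moreover obtain z where "z \<in> D" "z \<in> W" using y' W \<open>openin T W\<close> unfolding in_closure_of by meson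
  ultimately show "\<exists>z. z \<in> V \<inter> D \<and> z \<in> W" by blast
qed

text \<open>Where some generator is nonzero, the Koszul relations force the homogeneous coordinates
  to be the values of the generators, so the fibre has at most one point.\<close>

lemma blowup_injective:
  assumes X: "fspace X" and bl: "is_blowup X Z Y \<pi>"
    and y: "y \<in> pts Y" "y' \<in> pts Y" "\<pi> y = \<pi> y'" "\<pi> y \<notin> Z"
  shows "y = y'"
proof -
  have mor: "morphism Y X \<pi>" using bl by (simp add: is_blowup_def)
  obtain U m f \<phi> \<psi> where U: "openin (rtop X) U" "\<pi> y \<in> U" "generates_ideal X Z U m f"
    "inverse_morphisms (sub_space Y {y \<in> pts Y. \<pi> y \<in> U}) (graph_blowup X U m f) \<phi> \<psi>"
    "\<forall>y\<in>pts Y. \<pi> y \<in> U \<longrightarrow> fst (\<phi> y) = \<pi> y"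
    "\<forall>w\<in>pts (graph_blowup X U m f). \<psi> w \<in> pts Y \<and> \<pi> (\<psi> w) = fst w"
    by (rule is_blowupE[OF bl morphism_in[OF mor y(1)]])
  let ?Y = "sub_space Y {y \<in> pts Y. \<pi> y \<in> U}" and ?B = "graph_blowup X U m f"
  have f: "f i \<in> reg X U" if "i < m" for i using U(3) that by (simp add: generates_ideal_def)
  have nz: "\<exists>i<m. f i (\<pi> y) \<noteq> 0"
  proof (rule ccontr)
    assume "\<not> ?thesis"
    then have "\<pi> y \<in> {x \<in> U. \<forall>i<m. f i x = 0}" using U(2) by blast
    then show False using U(3) y(4) unfolding generates_ideal_def by blast
  qed
  have *: "\<phi> z = (\<pi> y, hpoint {..<m} (\<lambda>i. f i (\<pi> y)))" if z: "z \<in> pts Y" "\<pi> z = \<pi> y" for z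
  proof -
    have "z \<in> pts ?Y" using z U(2) by auto
    then have "\<phi> z \<in> pts ?B" using inverse_morphismsD(5)[OF U(4)] by blast
    moreover have "\<phi> z = (\<pi> y, snd (\<phi> z))" using U(5)[rule_format, OF z(1)] z(2) U(2) by (simp add: prod_eq_iff)
    ultimately have B: "(\<pi> y, snd (\<phi> z)) \<in> pts ?B" by simp
    obtain u where u: "\<exists>i<m. u i \<noteq> 0" "snd (\<phi> z) = hpoint {..<m} u" by (rule graph_blowup_pointE[OF B])
    have "f i (\<pi> y) * u j = f j (\<pi> y) * u i" if "i < m" "j < m" for i j
      by (rule graph_blowup_proportional[OF X U(1) f B[unfolded u(2)] u(1) that])
    then have "hpoint {..<m} u = hpoint {..<m} (\<lambda>i. f i (\<pi> y))"
      using u nz by (intro hpoint_eqI) (auto simp: mult.commute)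
    then show ?thesis using \<open>\<phi> z = (\<pi> y, snd (\<phi> z))\<close> u by simp
  qed
  have "y \<in> pts ?Y" "y' \<in> pts ?Y" using y U(2) by auto
  then show ?thesis using *[of y] *[of y'] y inverse_morphismsD(3)[OF U(4)] by metis
qed

text \<open>Near a point of the base, two systems of generators satisfy f' = a f and f = b f' with
  matrices of regular functions. The lift sends \<open>(x, [u])\<close> to
  \<open>(x, [a u])\<close>; what has to be shown is that \<open>a u\<close> is nonzero, also over
  the center, and that the image lies in the second closed graph.\<close>

lemma blowup_local_lift:
  assumes X: "fspace X" and Y: "fspace Y" and Y': "fspace Y'"
    and bl: "is_blowup X Z Y \<pi>" and bl': "is_blowup X Z Y' \<pi>'" and y: "y \<in> pts Y"
  shows "\<exists>V \<theta>. openin (rtop Y) V \<and> y \<in> V \<and> morphism (sub_space Y V) Y' \<theta> \<and> (\<forall>z\<in>V. \<pi>' (\<theta> z) = \<pi> z)"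
proof -
  have mor: "morphism Y X \<pi>" using bl by (simp add: is_blowup_def)
  have p: "\<pi> y \<in> pts X" using morphism_in[OF mor y] .
  obtain U m f \<phi> \<psi> where U: "openin (rtop X) U" "\<pi> y \<in> U" "generates_ideal X Z U m f"
    "inverse_morphisms (sub_space Y {y \<in> pts Y. \<pi> y \<in> U}) (graph_blowup X U m f) \<phi> \<psi>"
    "\<forall>y\<in>pts Y. \<pi> y \<in> U \<longrightarrow> fst (\<phi> y) = \<pi> y"
    "\<forall>w\<in>pts (graph_blowup X U m f). \<psi> w \<in> pts Y \<and> \<pi> (\<psi> w) = fst w"
    by (rule is_blowupE[OF bl p])
  obtain U' m' f' \<phi>' \<psi>' where U': "openin (rtop X) U'" "\<pi> y \<in> U'" "generates_ideal X Z U' m' f'"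
    "inverse_morphisms (sub_space Y' {y \<in> pts Y'. \<pi>' y \<in> U'}) (graph_blowup X U' m' f') \<phi>' \<psi>'"
    "\<forall>y\<in>pts Y'. \<pi>' y \<in> U' \<longrightarrow> fst (\<phi>' y) = \<pi>' y"
    "\<forall>w\<in>pts (graph_blowup X U' m' f'). \<psi>' w \<in> pts Y' \<and> \<pi>' (\<psi>' w) = fst w"
    by (rule is_blowupE[OF bl' p])
  have f: "f i \<in> reg X U" if "i < m" for i using U(3) that by (simp add: generates_ideal_def)
  have f': "f' i \<in> reg X U'" if "i < m'" for i using U'(3) that by (simp add: generates_ideal_def)
  have Z: "{x \<in> U. \<forall>i<m. f i x = 0} = U \<inter> Z" "{x \<in> U'. \<forall>i<m'. f' i x = 0} = U' \<inter> Z"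
    using U(3) U'(3) by (simp_all add: generates_ideal_def)
  have UU: "openin (rtop X) (U \<inter> U')" using U(1) U'(1) by (rule openin_Int)
  obtain W a where W: "openin (rtop X) W" "\<pi> y \<in> W" "W \<subseteq> U \<inter> U'"
    and a: "\<And>i j. i < m' \<Longrightarrow> j < m \<Longrightarrow> a i j \<in> reg X W"
      "\<And>i x. i < m' \<Longrightarrow> x \<in> W \<Longrightarrow> f' i x = (\<Sum>j<m. a i j x * f j x)"
  proof (rule generates_ideal_matrix[OF X U(3) UU])
    show "f' i \<in> reg X (U \<inter> U')" if "i < m'" for i using fspace.reg_subset[OF X f'[OF that] UU] by simp
    show "f' i x = 0" if "i < m'" "x \<in> U \<inter> U' \<inter> Z" for i x using that Z(2) by blast
  qed (use U U' in auto)
  obtain V b where V: "openin (rtop X) V" "\<pi> y \<in> V" "V \<subseteq> W"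
    and b: "\<And>j i. j < m \<Longrightarrow> i < m' \<Longrightarrow> b j i \<in> reg X V"
      "\<And>j x. j < m \<Longrightarrow> x \<in> V \<Longrightarrow> f j x = (\<Sum>i<m'. b j i x * f' i x)"
  proof (rule generates_ideal_matrix[OF X U'(3) W(1)])
    show "f i \<in> reg X W" if "i < m" for i by (rule fspace.reg_subset[OF X f[OF that] W(1)]) (use W in blast)
    show "f i x = 0" if "i < m" "x \<in> W \<inter> Z" for i x using that Z(1) W(3) by blast
  qed (use W in auto)
  have aV: "a i j \<in> reg X V" if "i < m'" "j < m" for i j
    by (rule fspace.reg_subset[OF X a(1)[OF that] V(1) V(3)])
  have VU: "V \<subseteq> U" "V \<subseteq> U'" using V W by auto

  \<comment> \<open>The matrix 1 - b a annihilates f, hence also \<open>u\<close> by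
    \<open>graph_blowup_relation\<close>; so u = b a u, and \<open>a u\<close> cannot
    vanish.\<close>
  have invertible: "\<exists>i<m'. (\<Sum>j<m. a i j x * u j) \<noteq> 0"
    if B: "(x, hpoint {..<m} u) \<in> pts (graph_blowup X U m f)" "x \<in> V" "\<exists>i<m. u i \<noteq> 0" for x u
  proof (rule ccontr)
    assume zero: "\<not> ?thesis"
    have "u k = 0" if k: "k < m" for k
    proof -
      \<comment> \<open>Row \<open>k\<close> of the matrix 1 - b a.\<close>
      let ?c = "\<lambda>j x. (if j = k then 1 else 0) - (\<Sum>i<m'. b k i x * a i j x)"
      have s: "(\<Sum>j<m. ?c j x * w j) = w k - (\<Sum>i<m'. b k i x * (\<Sum>j<m. a i j x * w j))" for x w
      proof -
        have "(\<Sum>j<m. (\<Sum>i<m'. b k i x * a i j x) * w j) = (\<Sum>i<m'. b k i x * (\<Sum>j<m. a i j x * w j))"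
          unfolding sum_distrib_left sum_distrib_right by (subst sum.swap) (simp add: mult.assoc)
        then show ?thesis using k
          by (simp add: left_diff_distrib sum_subtractf if_distrib[of "\<lambda>a. a * _"] cong: if_cong)
      qed
      have c: "?c j \<in> reg X V" if "j < m" for j
        by (intro fspace.reg_diff[OF X] fspace.reg_sum[OF X] fspace.reg_mult[OF X] V(1) b(1) aV k that
            fspace.reg_const[OF X V(1)]) auto
      have "(\<Sum>j<m. ?c j x * f j x) = 0" if "x \<in> V" for x
      proof -
        have "(\<Sum>i<m'. b k i x * (\<Sum>j<m. a i j x * f j x)) = (\<Sum>i<m'. b k i x * f' i x)"
          by (rule sum.cong) (use a(2) that V(3) in auto)
        then show ?thesis unfolding s using b(2)[OF k that] by simp
      qed
      from graph_blowup_relation[OF X U(1) V(1) VU(1) c this B]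
      have "u k = (\<Sum>i<m'. b k i x * (\<Sum>j<m. a i j x * u j))" unfolding s by simp
      then show "u k = 0" using zero by simp
    qed
    then show False using B(3) by blast
  qed

  let ?Y = "sub_space Y {y \<in> pts Y. \<pi> y \<in> U}"
  have oU: "openin (rtop Y) {y \<in> pts Y. \<pi> y \<in> U}" by (rule morphism_open[OF mor U(1)])
  have oV: "openin (rtop Y) {y \<in> pts Y. \<pi> y \<in> V}" by (rule morphism_open[OF mor V(1)])
  have v: "morphism ?Y (proj_space {..<m}) (\<lambda>z. snd (\<phi> z))"
  proof -
    have "morphism ?Y (blowup_ambient X U m) \<phi>"
      by (rule morphism_sub_space_cod[OF _ inverse_morphismsD(1)[OF U(4), unfolded graph_blowup_eq]])
          (use X in simp)
    then show ?thesis by (rule morphism_compose) (rule morphism_snd)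
  qed
  have yY: "y \<in> pts ?Y" using y U(2) by simp
  obtain V1 g where V1: "openin (rtop ?Y) V1" "y \<in> V1" and g': "\<forall>i\<in>{..<m}. g i \<in> reg ?Y V1"
    "\<forall>z\<in>V1. \<exists>i\<in>{..<m}. g i z \<noteq> 0" "\<forall>z\<in>V1. snd (\<phi> z) = hpoint {..<m} (\<lambda>i. g i z)"
    by (rule morphism_proj_space_local[OF fspace_sub_space[OF Y] v yY])
  note g = g'[rule_format]
  have oV1: "openin (rtop Y) V1" "V1 \<subseteq> {y \<in> pts Y. \<pi> y \<in> U}" using V1(1) oU
    by (auto simp: openin_open_subtopology)
  define S where "S = V1 \<inter> {y \<in> pts Y. \<pi> y \<in> V}"
  have S: "openin (rtop Y) S" "y \<in> S" unfolding S_def using oV1 oV V1 V(2) y by auto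
  have Ssub: "z \<in> pts Y" "\<pi> z \<in> V" "z \<in> V1" if "z \<in> S" for z using that by (auto simp: S_def)
  let ?S = "sub_space Y S"
  have ptsS: "pts ?S = S" using S openin_subset by fastforce
  have FS: "fspace ?S" using Y by simp
  have zB: "(\<pi> z, hpoint {..<m} (\<lambda>i. g i z)) \<in> pts (graph_blowup X U m f)" if "z \<in> S" for z
  proof -
    have "\<pi> z \<in> U" "z \<in> pts Y" using Ssub[OF that] VU by auto
    then have "\<phi> z \<in> pts (graph_blowup X U m f)" using inverse_morphismsD(5)[OF U(4), of z] by simp
    moreover have "\<phi> z = (\<pi> z, hpoint {..<m} (\<lambda>i. g i z))"
      using U(5)[rule_format, OF \<open>z \<in> pts Y\<close> \<open>\<pi> z \<in> U\<close>] g(3)[OF Ssub(3)[OF that]] by (simp add: prod_eq_iff)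
    ultimately show ?thesis by simp
  qed
  let ?h = "\<lambda>i z. \<Sum>j<m. a i j (\<pi> z) * g j z"
  have hS: "?h i \<in> reg ?S (pts ?S)" if "i < m'" for i
  proof -
    have gS: "g j \<in> reg Y S" if "j < m" for j
    proof -
      have "g j \<in> reg Y V1" using g(1)[of j] that reg_sub_space_open[OF Y oU] by simp
      then show ?thesis by (rule fspace.reg_subset[OF Y _ S(1)]) (simp add: S_def)
    qed
    have aS: "(\<lambda>z. a i j (\<pi> z)) \<in> reg Y S" if "j < m" for j
    proof -
      have "(\<lambda>z. a i j (\<pi> z)) \<in> reg Y {y \<in> pts Y. \<pi> y \<in> V}"
        by (rule morphism_reg[OF mor aV[OF \<open>i < m'\<close> that] V(1)])
      then show ?thesis by (rule fspace.reg_subset[OF Y _ S(1)]) (simp add: S_def)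
    qed
    have "?h i \<in> reg Y S"
      by (intro fspace.reg_sum[OF Y] fspace.reg_mult[OF Y] aS gS S(1)) auto
    then show ?thesis unfolding ptsS using reg_sub_space_open[OF Y S(1)] by blast
  qed
  have hnz: "\<exists>i<m'. ?h i z \<noteq> 0" if "z \<in> S" for z
    using invertible[OF zB[OF that] Ssub(2)[OF that]] g(2)[OF Ssub(3)[OF that]] by auto
  let ?F = "\<lambda>z. (\<pi> z, hpoint {..<m'} (\<lambda>i. ?h i z))"
  have F: "morphism ?S (blowup_ambient X U' m') ?F"
  proof (rule morphism_Pair[OF FS])
    show "morphism ?S (sub_space X U') \<pi>"
      by (rule morphism_sub_spaceI[OF FS morphism_sub_space_dom[OF Y mor]]) (use Ssub VU in auto)
    show "morphism ?S (proj_space {..<m'}) (\<lambda>z. hpoint {..<m'} (\<lambda>i. ?h i z))"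
      by (rule morphism_proj_space[OF FS hS]) (use hnz ptsS in auto)
  qed
  \<comment> \<open>Off the center \<open>?F z\<close> is a point of the second graph. Such
    \<open>z\<close> are dense in \<open>S\<close>, \<open>?F\<close> is continuous and the target
    is the closure of that graph.\<close>
  have Fcl: "?F z \<in> pts (graph_blowup X U' m' f')" if z: "z \<in> S" for z
  proof -
    let ?D = "{y \<in> pts Y. \<pi> y \<notin> Z}"
    have "z \<in> rtop ?S closure_of (S \<inter> ?D)"
      unfolding rtop_sub_space by (rule dense_in_open[OF blowup_dense[OF X bl] S(1) z])
    then have "?F z \<in> rtop (blowup_ambient X U' m') closure_of (?F ` (S \<inter> ?D))"
      using continuous_map_image_closure_subset[OF morphism_continuous[OF F]] by blast
    moreover have "?F ` (S \<inter> ?D) \<subseteq> blowup_graph U' m' f'"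
    proof (rule image_subsetI)
      fix x assume "x \<in> S \<inter> ?D"
      then have x: "x \<in> S" "\<pi> x \<notin> Z" by auto
      have xU: "\<pi> x \<in> U" "\<pi> x \<in> U'" "\<pi> x \<in> W" using Ssub[OF x(1)] VU V by auto
      have nz': "\<exists>i<m'. f' i (\<pi> x) \<noteq> 0" using Z(2) xU x by blast
      obtain l where l: "l < m" "g l x \<noteq> 0" using g(2)[OF Ssub(3)[OF x(1)]] by blast
      have pr: "f j (\<pi> x) = f l (\<pi> x) / g l x * g j x" if "j < m" for j
      proof -
        have "\<exists>i<m. g i x \<noteq> 0" using l by blast
        from graph_blowup_proportional[OF X U(1) f zB[OF x(1)] this l(1) that]
        show ?thesis using l(2) by (simp add: field_simps)
      qed
      have f'h: "f' i (\<pi> x) = f l (\<pi> x) / g l x * ?h i x" if "i < m'" for i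
      proof -
        have "f' i (\<pi> x) = (\<Sum>j<m. a i j (\<pi> x) * f j (\<pi> x))" by (rule a(2)[OF that xU(3)])
        also have "\<dots> = (\<Sum>j<m. f l (\<pi> x) / g l x * (a i j (\<pi> x) * g j x))"
        proof (rule sum.cong[OF refl])
          fix j assume "j \<in> {..<m}"
          then have "f j (\<pi> x) = f l (\<pi> x) / g l x * g j x" by (intro pr) simp
          then show "a i j (\<pi> x) * f j (\<pi> x) = f l (\<pi> x) / g l x * (a i j (\<pi> x) * g j x)"
            by (simp only: mult.left_commute)
        qed
        finally show ?thesis by (simp add: sum_distrib_left)
      qed
      \<comment> \<open>Otherwise all \<open>f' i\<close> would vanish at \<open>\<pi> x\<close>,
        which lies off the center.\<close>
      then have "f l (\<pi> x) / g l x \<noteq> 0" using nz' by auto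
      then have "hpoint {..<m'} (\<lambda>i. f' i (\<pi> x)) = hpoint {..<m'} (\<lambda>i. ?h i x)"
        by (rule hpoint_scale) (rule f'h, simp)
      then show "?F x \<in> blowup_graph U' m' f'"
        using nz' xU by (intro CollectI exI[of _ "\<pi> x"]) simp
    qed
    ultimately show ?thesis unfolding pts_graph_blowup by (meson closure_of_mono subsetD)
  qed
  have "morphism ?S (graph_blowup X U' m' f') ?F"
    unfolding graph_blowup_eq
  proof (rule morphism_sub_spaceI[OF FS F])
    fix z assume "z \<in> pts ?S"
    then have "z \<in> S" unfolding ptsS .
    from Fcl[OF this] show "?F z \<in> rtop (blowup_ambient X U' m') closure_of blowup_graph U' m' f'"
      unfolding pts_graph_blowup .
  qed
  from morphism_compose[OF this inverse_morphismsD(2)[OF U'(4)]]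
  have "morphism ?S Y' (\<lambda>z. \<psi>' (?F z))" by (rule morphism_sub_space_cod[OF Y'])
  moreover have "\<pi>' (\<psi>' (?F z)) = \<pi> z" if "z \<in> S" for z using U'(6)[rule_format, OF Fcl[OF that]] by simp
  ultimately show ?thesis using S by (intro exI[of _ S] exI[of _ "\<lambda>z. \<psi>' (?F z)"]) blast
qed

text \<open>Off the center the fibres of \<pi>' have at most one point, so the two maps agree on a
  dense set; the Hausdorff property does the rest.\<close>

lemma morphisms_over_eq:
  assumes X: "fspace X" and bl: "is_blowup X Z Y \<pi>" and bl': "is_blowup X Z Y' \<pi>'"
    and H: "Hausdorff_space (rtop Y')" and V: "openin (rtop Y) V"
    and \<theta>: "continuous_map (subtopology (rtop Y) V) (rtop Y') \<theta>" "\<And>y. y \<in> V \<Longrightarrow> \<pi>' (\<theta> y) = \<pi> y"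
    and \<eta>: "continuous_map (subtopology (rtop Y) V) (rtop Y') \<eta>" "\<And>y. y \<in> V \<Longrightarrow> \<pi>' (\<eta> y) = \<pi> y"
    and y: "y \<in> V"
  shows "\<theta> y = \<eta> y"
proof -
  let ?D = "{y \<in> pts Y. \<pi> y \<notin> Z}"
  have sub: "V \<subseteq> pts Y" using V openin_subset by blast
  have top: "topspace (subtopology (rtop Y) V) = V" using sub by auto
  have "y \<in> subtopology (rtop Y) V closure_of (V \<inter> ?D)" by (rule dense_in_open[OF blowup_dense[OF X bl] V y])
  then show ?thesis
  proof (rule forall_in_closure_of_eq[OF _ H \<theta>(1) \<eta>(1)])
    fix z assume "z \<in> V \<inter> ?D"
    then have z: "z \<in> V" "\<pi> z \<notin> Z" by auto
    have "\<theta> z \<in> pts Y'" "\<eta> z \<in> pts Y'" using \<theta>(1) \<eta>(1) z top unfolding continuous_map_def by auto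
    then show "\<theta> z = \<eta> z" using blowup_injective[OF X bl', of "\<theta> z" "\<eta> z"] \<theta>(2)[OF z(1)] \<eta>(2)[OF z(1)] z by simp
  qed
qed

lemma blowup_lift:
  assumes X: "fspace X" and Y: "fspace Y" and Y': "fspace Y'" and H: "Hausdorff_space (rtop Y')"
    and bl: "is_blowup X Z Y \<pi>" and bl': "is_blowup X Z Y' \<pi>'"
  obtains \<theta> where "morphism Y Y' \<theta>" "\<And>y. y \<in> pts Y \<Longrightarrow> \<pi>' (\<theta> y) = \<pi> y"
proof -
  obtain V \<theta> where V: "\<And>y. y \<in> pts Y \<Longrightarrow> openin (rtop Y) (V y) \<and> y \<in> V y \<and> morphism (sub_space Y (V y)) Y' (\<theta> y) \<and>
      (\<forall>z\<in>V y. \<pi>' (\<theta> y z) = \<pi> z)"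
    using blowup_local_lift[OF X Y Y' bl bl'] by metis
  have agree: "\<theta> z z = \<theta> y z" if y: "y \<in> pts Y" and z: "z \<in> V y" for y z
  proof -
    have zY: "z \<in> pts Y" using V[OF y] z openin_subset by blast
    let ?V = "V y \<inter> V z"
    have c: "continuous_map (subtopology (rtop Y) ?V) (rtop Y') (\<theta> x)" if "x \<in> {y, z}" for x
      using that morphism_continuous[of "sub_space Y (V y)" Y' "\<theta> y"] morphism_continuous[of "sub_space
          Y (V z)" Y' "\<theta> z"]
        V[OF y] V[OF zY] by (auto intro: continuous_map_from_subtopology_mono)
    show ?thesis
      by (rule morphisms_over_eq[OF X bl bl' H, of ?V]) (use V[OF y] V[OF zY] z c in auto)
  qed
  show thesis
  proof (rule that)
    \<comment> \<open>The global lift is the diagonal of the chosen local ones. On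
      \<open>V y\<close> it coincides with the single morphism \<open>\<theta> y\<close> by
      uniqueness of lifts.\<close>
    show "morphism Y Y' (\<lambda>y. \<theta> y y)"
    proof (rule morphism_local[OF Y])
      fix y assume y: "y \<in> pts Y"
      show "\<exists>W \<psi>. openin (rtop Y) W \<and> y \<in> W \<and> morphism (sub_space Y W) Y' \<psi> \<and> (\<forall>x\<in>W. \<theta> x x = \<psi> x)"
        using V[OF y] agree[OF y] by (intro exI[of _ "V y"] exI[of _ "\<theta> y"] conjI ballI) blast+
    qed
    show "\<pi>' (\<theta> y y) = \<pi> y" if "y \<in> pts Y" for y using V[OF that] by blast
  qed
qed

text \<open>Both composites and the identities are maps over the base, so
  \<open>morphisms_over_eq\<close> identifies them.\<close>

theorem blowup_unique:
  assumes X: "fspace X" and Y: "fspace Y" "Hausdorff_space (rtop Y)" and Y': "fspace Y'"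
      "Hausdorff_space (rtop Y')"
    and bl: "is_blowup X Z Y \<pi>" and bl': "is_blowup X Z Y' \<pi>'"
  obtains \<theta> \<eta> where "inverse_morphisms Y Y' \<theta> \<eta>" "\<forall>y\<in>pts Y. \<pi>' (\<theta> y) = \<pi> y"
proof -
  obtain \<theta> where \<theta>: "morphism Y Y' \<theta>" "\<And>y. y \<in> pts Y \<Longrightarrow> \<pi>' (\<theta> y) = \<pi> y"
    using blowup_lift[OF X Y(1) Y' bl bl'] by metis
  obtain \<eta> where \<eta>: "morphism Y' Y \<eta>" "\<And>y. y \<in> pts Y' \<Longrightarrow> \<pi> (\<eta> y) = \<pi>' y"
    using blowup_lift[OF X Y'(1) Y bl' bl] by metis
  have "\<eta> (\<theta> y) = y" if "y \<in> pts Y" for y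
    by (rule morphisms_over_eq[OF X bl bl Y(2) openin_topspace])
      (use that \<theta> \<eta> morphism_in[OF \<theta>(1)] morphism_continuous[OF morphism_compose[OF \<theta>(1) \<eta>(1)]] in auto)
  moreover have "\<theta> (\<eta> y) = y" if "y \<in> pts Y'" for y
    by (rule morphisms_over_eq[OF X bl' bl' Y'(2) openin_topspace])
      (use that \<theta> \<eta> morphism_in[OF \<eta>(1)] morphism_continuous[OF morphism_compose[OF \<eta>(1) \<theta>(1)]] in auto)
  ultimately have "inverse_morphisms Y Y' \<theta> \<eta>" using \<theta> \<eta> by (simp add: inverse_morphisms_def)
  then show thesis using that \<theta>(2) by blast
qed

subsection \<open>Transport along isomorphisms\<close>

lemma inverse_morphisms_prod_space:
  assumes "fspace X" "fspace X'" "fspace P" "inverse_morphisms X X' \<Phi> \<Phi>'"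
  shows "inverse_morphisms (prod_space X P) (prod_space X' P) (\<lambda>z. (\<Phi> (fst z), snd z)) (\<lambda>z. (\<Phi>' (fst z),
      snd z))"
  unfolding inverse_morphisms_def
  by (intro conjI morphism_Pair morphism_snd morphism_compose[OF morphism_fst] fspace_prod_space assms)
    (use inverse_morphismsD[OF assms(4)] in auto)

lemma graph_blowup_transport:
  assumes X: "fspace X" and X': "fspace X'" and \<Phi>: "inverse_morphisms X X' \<Phi> \<Phi>'"
    and U: "U \<subseteq> pts X" and U': "U' = {x \<in> pts X'. \<Phi>' x \<in> U}"
  shows "inverse_morphisms (graph_blowup X U m f) (graph_blowup X' U' m (\<lambda>i x. f i (\<Phi>' x)))
    (\<lambda>z. (\<Phi> (fst z), snd z)) (\<lambda>z. (\<Phi>' (fst z), snd z))"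
proof -
  let ?P = "blowup_ambient X U m" and ?P' = "blowup_ambient X' U' m"
  let ?F = "\<lambda>z. (\<Phi> (fst z), snd z)" and ?G = "\<lambda>z. (\<Phi>' (fst z), snd z)"
  let ?\<Gamma> = "blowup_graph U m f" and ?\<Gamma>' = "blowup_graph U' m (\<lambda>i x. f i (\<Phi>' x))"
  have "inverse_morphisms (sub_space X U) (sub_space X' U') \<Phi> \<Phi>'"
    by (rule inverse_morphisms_sub_space[OF X X' \<Phi>]) (use inverse_morphismsD[OF \<Phi>] U' in auto)
  then have P: "inverse_morphisms ?P ?P' ?F ?G"
    by (intro inverse_morphisms_prod_space) (use X X' in auto)
  have F\<Gamma>: "?F ` ?\<Gamma> = ?\<Gamma>'"
  proof (intro subset_antisym subsetI)
    fix z assume "z \<in> ?F ` ?\<Gamma>"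
    then obtain w where w: "w \<in> ?\<Gamma>" "z = ?F w" by blast
    then obtain x where x: "w = (x, hpoint {..<m} (\<lambda>i. f i x))" "x \<in> U" "\<exists>i<m. f i x \<noteq> 0" by blast
    then have z: "z = (\<Phi> x, hpoint {..<m} (\<lambda>i. f i x))" using w by simp
    have "\<Phi>' (\<Phi> x) = x" "\<Phi> x \<in> U'" using x(2) U U' inverse_morphismsD(3,5)[OF \<Phi>, of x] by auto
    then show "z \<in> ?\<Gamma>'" using x z by (intro CollectI exI[of _ "\<Phi> x"]) simp
  next
    fix z assume "z \<in> ?\<Gamma>'"
    then obtain x where x: "z = (x, hpoint {..<m} (\<lambda>i. f i (\<Phi>' x)))" "x \<in> U'" "\<exists>i<m. f i (\<Phi>' x) \<noteq> 0" by auto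
    then have "\<Phi> (\<Phi>' x) = x" "\<Phi>' x \<in> U" using U' inverse_morphismsD(4)[OF \<Phi>, of x] by auto
    then show "z \<in> ?F ` ?\<Gamma>"
      using x by (intro image_eqI[of _ _ "(\<Phi>' x, hpoint {..<m} (\<lambda>i. f i (\<Phi>' x)))"] CollectI exI[of _ "\<Phi>'
          x"]) simp_all
  qed
  have cl: "rtop ?P' closure_of ?\<Gamma>' = ?F ` (rtop ?P closure_of ?\<Gamma>)"
    using inverse_morphisms_closure_of[OF P blowup_graph_subset[OF U], of f] unfolding F\<Gamma> .
  show ?thesis
    unfolding graph_blowup_eq
  proof (rule inverse_morphisms_sub_space[OF _ _ P])
    fix y assume "y \<in> pts ?P'" "y \<in> rtop ?P' closure_of ?\<Gamma>'"
    then obtain z where z: "y = ?F z" "z \<in> rtop ?P closure_of ?\<Gamma>" unfolding cl by blast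
    then have "z \<in> pts ?P" by (meson closure_of_subset_topspace subsetD)
    from inverse_morphismsD(3)[OF P this] show "?G y \<in> rtop ?P closure_of ?\<Gamma>" using z by simp
  qed (use X X' cl in auto)
qed

text \<open>A stage of a tower is known only up to an isomorphism with a model, so blow-up
  statements have to be moved along isomorphisms of base and total space at once.\<close>

lemma is_blowup_transport:
  assumes X: "fspace X" and X': "fspace X'" and Y: "fspace Y" and Y': "fspace Y'"
    and \<Phi>: "inverse_morphisms X X' \<Phi> \<Phi>'" and \<Psi>: "inverse_morphisms Y Y' \<Psi> \<Psi>'"
    and bl: "is_blowup X Z Y \<pi>" and \<pi>': "\<And>y. y \<in> pts Y \<Longrightarrow> \<pi>' (\<Psi> y) = \<Phi> (\<pi> y)"
  shows "is_blowup X' (\<Phi> ` Z) Y' \<pi>'"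
  unfolding is_blowup_def
proof (intro conjI ballI)
  have cl: "closedin (rtop X) Z" and mor: "morphism Y X \<pi>" using bl by (auto simp: is_blowup_def)
  have Zs: "Z \<subseteq> pts X" using cl closedin_subset by blast
  have ZI: "\<Phi> ` Z = {x \<in> pts X'. \<Phi>' x \<in> Z}"
  proof safe
    fix z assume "z \<in> Z"
    then show "\<Phi> z \<in> pts X'" "\<Phi>' (\<Phi> z) \<in> Z" using inverse_morphismsD(3,5)[OF \<Phi>, of z] Zs by auto
  next
    fix x assume "x \<in> pts X'" "\<Phi>' x \<in> Z"
    then show "x \<in> \<Phi> ` Z" using inverse_morphismsD(4)[OF \<Phi>, of x] by force
  qed
  show "closedin (rtop X') (\<Phi> ` Z)"
    unfolding ZI
      by (rule closedin_continuous_map_preimage[OF morphism_continuous[OF inverse_morphismsD(2)[OF \<Phi>]] cl])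
  have "morphism Y' X' (\<lambda>y. \<Phi> (\<pi> (\<Psi>' y)))"
    using morphism_compose[OF morphism_compose[OF inverse_morphismsD(2)[OF \<Psi>] mor]
        inverse_morphismsD(1)[OF \<Phi>]] .
  moreover have eq: "\<pi>' y = \<Phi> (\<pi> (\<Psi>' y))" if "y \<in> pts Y'" for y
    using \<pi>'[of "\<Psi>' y"] inverse_morphismsD(4,6)[OF \<Psi> that] by simp
  ultimately show "morphism Y' X' \<pi>'" by (rule morphism_cong[OF Y'])
  fix p assume p: "p \<in> pts X'"
  obtain U m f \<phi> \<psi> where U: "openin (rtop X) U" "\<Phi>' p \<in> U" "generates_ideal X Z U m f"
    "inverse_morphisms (sub_space Y {y \<in> pts Y. \<pi> y \<in> U}) (graph_blowup X U m f) \<phi> \<psi>"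
    "\<forall>y\<in>pts Y. \<pi> y \<in> U \<longrightarrow> fst (\<phi> y) = \<pi> y"
    "\<forall>w\<in>pts (graph_blowup X U m f). \<psi> w \<in> pts Y \<and> \<pi> (\<psi> w) = fst w"
    by (rule is_blowupE[OF bl inverse_morphismsD(6)[OF \<Phi> p]])
  have Us: "U \<subseteq> pts X" using U(1) openin_subset by blast
  let ?U = "{x \<in> pts X'. \<Phi>' x \<in> U}" and ?f = "\<lambda>i x. f i (\<Phi>' x)"
  have U': "openin (rtop X') ?U" by (rule morphism_open[OF inverse_morphismsD(2)[OF \<Phi>] U(1)])
  have f: "f i \<in> reg X U" if "i < m" for i using U(3) that by (simp add: generates_ideal_def)
  have fZ: "{x \<in> U. \<forall>i<m. f i x = 0} = U \<inter> Z" using U(3) by (simp add: generates_ideal_def)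
  have gen: "generates_ideal X' (\<Phi> ` Z) ?U m ?f"
    unfolding generates_ideal_def
  proof (intro conjI allI impI ballI)
    show "?f i \<in> reg X' ?U" if "i < m" for i
      by (rule morphism_reg[OF inverse_morphismsD(2)[OF \<Phi>] f[OF that] U(1)])
    show "{x \<in> ?U. \<forall>i<m. ?f i x = 0} = ?U \<inter> \<Phi> ` Z"
    proof -
      have "(\<forall>i<m. f i x = 0) \<longleftrightarrow> x \<in> Z" if "x \<in> U" for x using fZ that by blast
      then show ?thesis unfolding ZI by blast
    qed
    fix V g q assume *: "openin (rtop X') V \<and> V \<subseteq> ?U \<and> g \<in> reg X' V \<and> (\<forall>x\<in>V \<inter> \<Phi> ` Z. g x = 0)" and q: "q \<in> V"
    let ?V = "{x \<in> pts X. \<Phi> x \<in> V}"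
    have V: "openin (rtop X) ?V" using morphism_open[OF inverse_morphismsD(1)[OF \<Phi>]] * by blast
    have VU: "?V \<subseteq> U" using * inverse_morphismsD(3)[OF \<Phi>] by fastforce
    have g: "(\<lambda>x. g (\<Phi> x)) \<in> reg X ?V" using morphism_reg[OF inverse_morphismsD(1)[OF \<Phi>]] * by blast
    have qX: "q \<in> pts X'" using * q by blast
    have qV: "\<Phi>' q \<in> ?V" using inverse_morphismsD(4,6)[OF \<Phi> qX] q by simp
    have "\<forall>x\<in>?V \<inter> Z. g (\<Phi> x) = 0" using * by blast
    then have "\<exists>W a. openin (rtop X) W \<and> \<Phi>' q \<in> W \<and> W \<subseteq> ?V \<and> (\<forall>i<m. a i \<in> reg X W) \<and>
        (\<forall>x\<in>W. g (\<Phi> x) = (\<Sum>i<m. a i x * f i x))"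
      by (intro U(3)[unfolded generates_ideal_def, THEN conjunct2, THEN conjunct2, rule_format, of ?V
          "\<lambda>x. g (\<Phi> x)"])
        (use V VU g qV in blast)+
    then obtain W a where W: "openin (rtop X) W" "\<Phi>' q \<in> W" "W \<subseteq> ?V" "\<forall>i<m. a i \<in> reg X W"
      "\<forall>x\<in>W. g (\<Phi> x) = (\<Sum>i<m. a i x * f i x)"
      by (elim exE conjE)
    show "\<exists>W a. openin (rtop X') W \<and> q \<in> W \<and> W \<subseteq> V \<and> (\<forall>i<m. a i \<in> reg X' W) \<and>
        (\<forall>x\<in>W. g x = (\<Sum>i<m. a i x * ?f i x))"
    proof (intro exI[of _ "{x \<in> pts X'. \<Phi>' x \<in> W}"] exI[of _ "\<lambda>i x. a i (\<Phi>' x)"] conjI allI impI ballI)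
      show "openin (rtop X') {x \<in> pts X'. \<Phi>' x \<in> W}"
        by (rule morphism_open[OF inverse_morphismsD(2)[OF \<Phi>] W(1)])
      show "(\<lambda>x. a i (\<Phi>' x)) \<in> reg X' {x \<in> pts X'. \<Phi>' x \<in> W}" if "i < m" for i
        using morphism_reg[OF inverse_morphismsD(2)[OF \<Phi>] _ W(1)] W(4) that by blast
      show "q \<in> {x \<in> pts X'. \<Phi>' x \<in> W}" using qX W by simp
      show "{x \<in> pts X'. \<Phi>' x \<in> W} \<subseteq> V" using W(3) inverse_morphismsD(4)[OF \<Phi>] by fastforce
      fix x assume "x \<in> {x \<in> pts X'. \<Phi>' x \<in> W}"
      then show "g x = (\<Sum>i<m. a i (\<Phi>' x) * ?f i x)" using W(5) inverse_morphismsD(4)[OF \<Phi>, of x] by fastforce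
    qed
  qed
  have pre: "inverse_morphisms (sub_space Y' {y \<in> pts Y'. \<pi>' y \<in> ?U}) (sub_space Y {y \<in> pts Y. \<pi> y \<in> U}) \<Psi>' \<Psi>"
  proof (rule inverse_morphisms_sub_space[OF Y' Y inverse_morphisms_sym[OF \<Psi>]])
    fix y assume "y \<in> pts Y'" "y \<in> {y \<in> pts Y'. \<pi>' y \<in> ?U}"
    then show "\<Psi>' y \<in> {y \<in> pts Y. \<pi> y \<in> U}"
      using eq[of y] inverse_morphismsD(6)[OF \<Psi>, of y] inverse_morphismsD(3)[OF \<Phi>, of "\<pi> (\<Psi>' y)"]
          morphism_in[OF mor, of "\<Psi>' y"] by auto
  next
    fix y assume "y \<in> pts Y" "y \<in> {y \<in> pts Y. \<pi> y \<in> U}"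
    then show "\<Psi> y \<in> {y \<in> pts Y'. \<pi>' y \<in> ?U}"
      using \<pi>'[of y] inverse_morphismsD(5)[OF \<Psi>, of y] inverse_morphismsD(3,5)[OF \<Phi>, of "\<pi> y"]
          morphism_in[OF mor, of y] by auto
  qed
  let ?\<phi> = "\<lambda>y. (\<Phi> (fst (\<phi> (\<Psi>' y))), snd (\<phi> (\<Psi>' y)))"
  have "isomorphism (sub_space Y' {y \<in> pts Y'. \<pi>' y \<in> ?U}) (graph_blowup X' ?U m ?f) ?\<phi>"
    using inverse_morphisms_trans[OF inverse_morphisms_trans[OF pre U(4)] graph_blowup_transport[OF X X'
        \<Phi> Us refl]]
    unfolding isomorphism_iff by blast
  moreover have "fst (?\<phi> y) = \<pi>' y" if "y \<in> pts Y'" "\<pi>' y \<in> ?U" for y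
  proof -
    have "\<Psi>' y \<in> pts Y" "\<pi> (\<Psi>' y) \<in> U"
      using inverse_morphismsD(5)[OF pre, of y] that by auto
    then show ?thesis using U(5) eq[OF that(1)] by simp
  qed
  ultimately show "\<exists>U m f \<phi>. openin (rtop X') U \<and> p \<in> U \<and> generates_ideal X' (\<Phi> ` Z) U m f \<and>
      isomorphism (sub_space Y' {y \<in> pts Y'. \<pi>' y \<in> U}) (graph_blowup X' U m f) \<phi> \<and>
      (\<forall>y\<in>pts Y'. \<pi>' y \<in> U \<longrightarrow> fst (\<phi> y) = \<pi>' y)"
    using U' p U(2) gen by (intro exI[of _ ?U] exI[of _ m] exI[of _ ?f] exI[of _ ?\<phi>] conjI CollectI ballI impI)
qed

lemma strict_transform_transport:
  assumes \<Phi>: "inverse_morphisms X X' \<Phi> \<Phi>'" and \<Psi>: "inverse_morphisms Y Y' \<Psi> \<Psi>'" and mor: "morphism Y X \<pi>"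
    and \<pi>': "\<And>y. y \<in> pts Y \<Longrightarrow> \<pi>' (\<Psi> y) = \<Phi> (\<pi> y)" and sub: "C \<subseteq> pts X" "Z \<subseteq> pts X"
  shows "strict_transform (\<Phi> ` C) Y' \<pi>' (\<Phi> ` Z) = \<Psi> ` strict_transform C Y \<pi> Z"
proof -
  have inj: "inj_on \<Phi> (pts X)" using inverse_morphismsD(3)[OF \<Phi>] by (metis inj_onI)
  have mem: "\<Phi> x \<in> \<Phi> ` A \<longleftrightarrow> x \<in> A" if "x \<in> pts X" "A \<subseteq> pts X" for x A
    using inj that by (meson inj_on_image_mem_iff)
  have *: "\<pi>' (\<Psi> y) \<in> \<Phi> ` Z - \<Phi> ` C \<longleftrightarrow> \<pi> y \<in> Z - C" if "y \<in> pts Y" for y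
    using mem[OF morphism_in[OF mor that]] sub \<pi>'[OF that] by auto
  have "{y \<in> pts Y'. \<pi>' y \<in> \<Phi> ` Z - \<Phi> ` C} = \<Psi> ` {y \<in> pts Y. \<pi> y \<in> Z - C}"
  proof (intro subset_antisym subsetI)
    fix y assume y: "y \<in> {y \<in> pts Y'. \<pi>' y \<in> \<Phi> ` Z - \<Phi> ` C}"
    then have "y = \<Psi> (\<Psi>' y)" and x: "\<Psi>' y \<in> pts Y" using inverse_morphismsD(4,6)[OF \<Psi>, of y] by auto
    then show "y \<in> \<Psi> ` {y \<in> pts Y. \<pi> y \<in> Z - C}" using *[OF x] y by (intro image_eqI[of _ _ "\<Psi>' y"]) auto
  next
    fix y assume "y \<in> \<Psi> ` {y \<in> pts Y. \<pi> y \<in> Z - C}"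
    then obtain x where "x \<in> pts Y" "\<pi> x \<in> Z - C" "y = \<Psi> x" by blast
    then show "y \<in> {y \<in> pts Y'. \<pi>' y \<in> \<Phi> ` Z - \<Phi> ` C}" using * inverse_morphismsD(5)[OF \<Psi>, of x] by blast
  qed
  then show ?thesis
    unfolding strict_transform_def using inverse_morphisms_closure_of[OF \<Psi>, of "{y \<in> pts Y. \<pi> y \<in> Z - C}"]
      by auto
qed

section \<open>The model of a union-closed family\<close>

text \<open>As \<open>x \<gamma>\<close> has volume one, the factor of proportionality can only be
  the volume of \<gamma> under \<open>x \<eta>\<close>. Written this way the conditions are
  polynomial, hence closed; where the factor is 0, the pair does not constrain
  \<open>x \<gamma>\<close>, and this is where new directions appear.\<close>

definition model_points :: "'e set set \<Rightarrow> ('e set \<Rightarrow> 'e \<Rightarrow> real) set" where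
  "model_points I = {x \<in> (\<Pi>\<^sub>E \<gamma>\<in>I. std_simplex \<gamma>).
     \<forall>\<eta>\<in>I. \<forall>\<gamma>\<in>I. \<gamma> \<subseteq> \<eta> \<longrightarrow> (\<forall>e\<in>\<gamma>. x \<eta> e = (\<Sum>e'\<in>\<gamma>. x \<eta> e') * x \<gamma> e)}"

definition model :: "'e set set \<Rightarrow> ('e set \<Rightarrow> 'e \<Rightarrow> real) rspace" where
  "model I = sub_space (Prod_space I simplex_space) (model_points I)"

lemma fspace_model [simp]: "fspace (model I)"
  by (simp add: model_def fspace_Prod_space)

lemma pts_model [simp]: "pts (model I) = model_points I"
proof -
  have "pts (Prod_space I simplex_space) = (\<Pi>\<^sub>E \<gamma>\<in>I. std_simplex \<gamma>)"
    unfolding rtop_Prod_space topspace_product_topology o_def pts_simplex_space ..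
  then show ?thesis
    unfolding model_def rtop_sub_space[of "Prod_space I simplex_space"] topspace_subtopology
    by (auto simp: model_points_def)
qed

lemma model_pointsD:
  assumes "x \<in> model_points I" "\<gamma> \<in> I"
  shows "x \<gamma> \<in> std_simplex \<gamma>" "e \<in> \<gamma> \<Longrightarrow> 0 \<le> x \<gamma> e" "sum (x \<gamma>) \<gamma> = 1"
    "\<eta> \<in> I \<Longrightarrow> \<gamma> \<subseteq> \<eta> \<Longrightarrow> e \<in> \<gamma> \<Longrightarrow> x \<eta> e = sum (x \<eta>) \<gamma> * x \<gamma> e"
proof -
  show *: "x \<gamma> \<in> std_simplex \<gamma>" using assms by (auto simp: model_points_def)
  then show "e \<in> \<gamma> \<Longrightarrow> 0 \<le> x \<gamma> e" "sum (x \<gamma>) \<gamma> = 1" by (auto simp: std_simplex_def)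
  show "\<eta> \<in> I \<Longrightarrow> \<gamma> \<subseteq> \<eta> \<Longrightarrow> e \<in> \<gamma> \<Longrightarrow> x \<eta> e = sum (x \<eta>) \<gamma> * x \<gamma> e"
    using assms unfolding model_points_def by blast
qed

lemma model_points_eqI:
  assumes "x \<in> model_points I" "y \<in> model_points I" "\<And>\<gamma> e. \<gamma> \<in> I \<Longrightarrow> e \<in> \<gamma> \<Longrightarrow> x \<gamma> e = y \<gamma> e"
  shows "x = y"
proof (rule extensionalityI[of _ I])
  show "x \<in> extensional I" "y \<in> extensional I" using assms(1,2) by (auto simp: model_points_def PiE_def)
  fix \<gamma> assume \<gamma>: "\<gamma> \<in> I"
  show "x \<gamma> = y \<gamma>"
    by (rule extensionalityI[of _ \<gamma>])
      (use model_pointsD(1)[OF assms(1) \<gamma>] model_pointsD(1)[OF assms(2) \<gamma>] assms(3)[OF \<gamma>] in \<open>auto simp: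
          std_simplex_def PiE_def\<close>)
qed

lemma model_coordinate:
  assumes "\<gamma> \<in> I" "e \<in> \<gamma>" shows "(\<lambda>x. x \<gamma> e) \<in> reg (model I) (model_points I)"
proof -
  have "morphism (model I) (simplex_space \<gamma>) (\<lambda>x. x \<gamma>)"
    unfolding model_def
    by (rule morphism_sub_space_dom[OF fspace_Prod_space morphism_Prod_proj[OF assms(1)]]) simp
  then have m: "morphism (model I) (affine_space \<gamma>) (\<lambda>x. x \<gamma>)" by (rule morphism_sub_space_cod[rotated]) simp
  have "x \<gamma> \<in> extensional \<gamma>" if "x \<in> pts (model I)" for x
    using model_pointsD(1)[of x I \<gamma>] that assms by (auto simp: std_simplex_def PiE_def)
  then show ?thesis using morphism_affine_space[OF fspace_model, of I "\<lambda>x. x \<gamma>" \<gamma>] m assms by auto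
qed

lemma morphism_modelI:
  assumes X: "fspace X" and pts: "\<And>z. z \<in> pts X \<Longrightarrow> \<phi> z \<in> model_points I"
    and coord: "\<And>\<gamma> e. \<gamma> \<in> I \<Longrightarrow> e \<in> \<gamma> \<Longrightarrow> (\<lambda>z. \<phi> z \<gamma> e) \<in> reg X (pts X)"
  shows "morphism X (model I) \<phi>"
  unfolding model_def
proof (rule morphism_sub_spaceI[OF X morphism_ProdI[OF X] pts])
  show "\<phi> z \<in> extensional I" if "z \<in> pts X" for z using pts[OF that] by (auto simp: model_points_def PiE_def)
  fix \<gamma> assume \<gamma>: "\<gamma> \<in> I"
  have s: "\<phi> z \<gamma> \<in> std_simplex \<gamma>" if "z \<in> pts X" for z using model_pointsD(1)[OF pts[OF that] \<gamma>] .
  have "morphism X (affine_space \<gamma>) (\<lambda>z. \<phi> z \<gamma>)"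
    by (rule morphism_affine_space[OF X, THEN iffD2]) (use s coord \<gamma> in \<open>auto simp: std_simplex_def PiE_def\<close>)
  then show "morphism X (simplex_space \<gamma>) (\<lambda>z. \<phi> z \<gamma>)" by (rule morphism_sub_spaceI[OF X]) (rule s)
qed

lemma Hausdorff_model: "Hausdorff_space (rtop (model I))"
  unfolding model_def
  by (auto simp: Hausdorff_space_product_topology intro!: Hausdorff_space_subtopology)

text \<open>The parameters of the charts below are indexed by edges; they are numbered only at the
  very end, by \<open>orthant_reindex\<close>.\<close>

definition orthant_on :: "'i set \<Rightarrow> ('i \<Rightarrow> real) rspace" where
  "orthant_on S = sub_space (affine_space S) {x. \<forall>i\<in>S. 0 \<le> x i}"

lemma fspace_orthant_on [simp]: "fspace (orthant_on S)"
  by (simp add: orthant_on_def)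

lemma pts_orthant_on [simp]: "pts (orthant_on S) = {x \<in> S \<rightarrow>\<^sub>E UNIV. \<forall>i\<in>S. 0 \<le> x i}"
  by (auto simp: orthant_on_def)

lemma orthant_eq: "orthant d = orthant_on {..<d}"
  unfolding orthant_def orthant_on_def by (simp add: Ball_def)

lemma orthant_coordinate:
  assumes "i \<in> S" shows "(\<lambda>y. y i) \<in> reg (orthant_on S) (pts (orthant_on S))"
proof -
  have "morphism (orthant_on S) (affine_space S) (\<lambda>x. x)"
    unfolding orthant_on_def by (rule morphism_sub_space_incl) simp
  then show ?thesis
    using morphism_affine_space[OF fspace_orthant_on, of S "\<lambda>x. x" S] assms by (auto simp: PiE_def)
qed

lemma morphism_orthantI:
  assumes X: "fspace X" and pts: "\<And>z. z \<in> pts X \<Longrightarrow> \<phi> z \<in> pts (orthant_on S)"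
    and coord: "\<And>i. i \<in> S \<Longrightarrow> (\<lambda>z. \<phi> z i) \<in> reg X (pts X)"
  shows "morphism X (orthant_on S) \<phi>"
  unfolding orthant_on_def
proof (rule morphism_sub_spaceI[OF X])
  show "morphism X (affine_space S) \<phi>"
    by (rule morphism_affine_space[OF X, THEN iffD2]) (use pts coord in \<open>auto simp: PiE_def\<close>)
qed (use pts in auto)

lemma orthant_reindex:
  assumes h: "bij_betw h T S"
  shows "inverse_morphisms (orthant_on S) (orthant_on T) (\<lambda>y. \<lambda>i\<in>T. y (h i)) (\<lambda>x. \<lambda>e\<in>S. x (inv_into T h e))"
proof -
  have hT: "h i \<in> S" "inv_into T h (h i) = i" if "i \<in> T" for i
    using h that by (auto simp: bij_betw_def inv_into_f_f)
  have hS: "inv_into T h e \<in> T" "h (inv_into T h e) = e" if "e \<in> S" for e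
    using h that by (auto simp: bij_betw_def inv_into_into f_inv_into_f)
  show ?thesis
    unfolding inverse_morphisms_def
  proof (intro conjI ballI)
    show "morphism (orthant_on S) (orthant_on T) (\<lambda>y. \<lambda>i\<in>T. y (h i))"
    proof (rule morphism_orthantI[OF fspace_orthant_on])
      show "(\<lambda>y. (\<lambda>i\<in>T. y (h i)) i) \<in> reg (orthant_on S) (pts (orthant_on S))" if "i \<in> T" for i
        using orthant_coordinate[OF hT(1)[OF that]] that by simp
    qed (use hT in auto)
    show "morphism (orthant_on T) (orthant_on S) (\<lambda>x. \<lambda>e\<in>S. x (inv_into T h e))"
    proof (rule morphism_orthantI[OF fspace_orthant_on])
      show "(\<lambda>x. (\<lambda>e\<in>S. x (inv_into T h e)) e) \<in> reg (orthant_on T) (pts (orthant_on T))" if "e \<in> S" for e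
        using orthant_coordinate[OF hS(1)[OF that]] that by simp
    qed (use hS in auto)
    show "(\<lambda>e\<in>S. (\<lambda>i\<in>T. y (h i)) (inv_into T h e)) = y" if "y \<in> pts (orthant_on S)" for y
      by (rule extensionalityI[of _ S]) (use hS that in \<open>auto simp: PiE_def\<close>)
    show "(\<lambda>i\<in>T. (\<lambda>e\<in>S. x (inv_into T h e)) (h i)) = x" if "x \<in> pts (orthant_on T)" for x
      by (rule extensionalityI[of _ T]) (use hT that in \<open>auto simp: PiE_def\<close>)
  qed
qed

subsection \<open>Charts\<close>

text \<open>Makes \<open>lev\<close> and \<open>base\<close>, which are defined as intersections,
  actual members of the chain.\<close>

lemma chain_Inter_in:
  assumes "finite A" "A \<noteq> {}" "\<And>x y. x \<in> A \<Longrightarrow> y \<in> A \<Longrightarrow> x \<subseteq> y \<or> y \<subseteq> x"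
  shows "\<Inter>A \<in> A"
proof -
  obtain m where m: "m \<in> A" "\<And>x. x \<in> A \<Longrightarrow> x \<subseteq> m \<Longrightarrow> m = x"
    using finite_has_minimal[OF assms(1,2)] by metis
  then have "m \<subseteq> x" if "x \<in> A" for x using assms(3)[OF m(1) that] that by blast
  then have "\<Inter>A = m" using m(1) by blast
  then show ?thesis using m by simp
qed

locale union_family =
  fixes E :: "'e set" and I :: "'e set set"
  assumes finite_E: "finite E" and E_in: "E \<in> I"
    and members: "\<And>\<gamma>. \<gamma> \<in> I \<Longrightarrow> \<gamma> \<subseteq> E \<and> \<gamma> \<noteq> {}"
    and union_closed: "\<And>\<gamma> \<eta>. \<gamma> \<in> I \<Longrightarrow> \<eta> \<in> I \<Longrightarrow> \<gamma> \<union> \<eta> \<in> I"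
begin

lemma finite_I: "finite I"
  by (rule finite_subset[of _ "Pow E"]) (use members finite_E in auto)

lemma finite_member: "\<gamma> \<in> I \<Longrightarrow> finite \<gamma>"
  using members finite_E finite_subset by blast

lemma Union_in:
  assumes "A \<subseteq> I" "A \<noteq> {}" shows "\<Union>A \<in> I"
proof -
  have "finite A" using assms(1) finite_I finite_subset by blast
  then show ?thesis using assms(2,1)
    by (induction rule: finite_ne_induct) (auto intro: union_closed)
qed

end

text \<open>A chart is given by a chain \<open>C\<close> of members and a nonvanishing coordinate \<open>b \<delta>\<close> on each of its
  members.  Restricted to \<open>\<delta> \<in> C\<close> the coordinates at a bigger member of \<open>C\<close> are proportional to those
  at \<open>\<delta>\<close>, and the local parameter attached to \<open>b \<delta>\<close> is the factor of proportionality.\<close>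

locale family_chart = union_family E I for E :: "'e set" and I +
  fixes C :: "'e set set" and b :: "'e set \<Rightarrow> 'e"
  assumes C_sub: "C \<subseteq> I" and E_C: "E \<in> C"
    and chain: "\<And>\<delta> \<delta>'. \<delta> \<in> C \<Longrightarrow> \<delta>' \<in> C \<Longrightarrow> \<delta> \<subseteq> \<delta>' \<or> \<delta>' \<subseteq> \<delta>"
    and b_in: "\<And>\<delta>. \<delta> \<in> C \<Longrightarrow> b \<delta> \<in> \<delta>"
    and b_notin: "\<And>\<delta> \<delta>'. \<delta> \<in> C \<Longrightarrow> \<delta>' \<in> C \<Longrightarrow> \<delta>' \<subset> \<delta> \<Longrightarrow> b \<delta> \<notin> \<delta>'"
begin

text \<open>The smallest member of the chain that contains \<gamma>. In the chart \<gamma> has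
  nonzero volume there, so \<open>x \<gamma>\<close> is recovered from
  \<open>x (lev \<gamma>)\<close> by rescaling.\<close>

definition lev :: "'e set \<Rightarrow> 'e set" where
  "lev \<gamma> = \<Inter>{\<delta> \<in> C. \<gamma> \<subseteq> \<delta>}"

abbreviation params :: "'e set" where
  "params \<equiv> E - {b E}"

text \<open>The smallest member of the chain where \<open>e\<close> is not the normalizing
  coordinate. For \<open>e = b \<delta>'\<close> with \<delta>' other than \<open>E\<close> it is
  the next larger member after \<delta>'; the parameter of \<open>e\<close> then measures the size
  of \<delta>' inside that member.\<close>

definition base :: "'e \<Rightarrow> 'e set" where
  "base e = \<Inter>{\<delta> \<in> C. e \<in> \<delta> \<and> e \<noteq> b \<delta>}"

text \<open>The quotient \<open>x \<delta> e / x \<delta> (b \<delta>)\<close> in terms of the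
  parameters: it telescopes into the parameter of \<open>e\<close>, taken at \<open>base e\<close>,
  and one parameter \<open>y (b \<delta>')\<close> for each step of the chain from there up to
  \<delta>.\<close>

definition mon :: "('e \<Rightarrow> real) \<Rightarrow> 'e set \<Rightarrow> 'e \<Rightarrow> real" where
  "mon y \<delta> e = (if e = b \<delta> then 1 else y e) * (\<Prod>\<delta>'\<in>{\<delta>' \<in> C. e \<in> \<delta>' \<and> e \<noteq> b \<delta>' \<and> \<delta>' \<subset> \<delta>}. y (b \<delta>'))"

definition chart_dom :: "('e set \<Rightarrow> 'e \<Rightarrow> real) set" where
  "chart_dom = {x \<in> model_points I. (\<forall>\<delta>\<in>C. x \<delta> (b \<delta>) \<noteq> 0) \<and> (\<forall>\<gamma>\<in>I. sum (x (lev \<gamma>)) \<gamma> \<noteq> 0)}"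

definition coords :: "('e set \<Rightarrow> 'e \<Rightarrow> real) \<Rightarrow> 'e \<Rightarrow> real" where
  "coords x = (\<lambda>e\<in>params. x (base e) e / x (base e) (b (base e)))"

definition chart_img :: "('e \<Rightarrow> real) set" where
  "chart_img = {y \<in> pts (orthant_on params). \<forall>\<gamma>\<in>I. sum (mon y (lev \<gamma>)) \<gamma> \<noteq> 0}"

definition chart_par :: "('e \<Rightarrow> real) \<Rightarrow> 'e set \<Rightarrow> 'e \<Rightarrow> real" where
  "chart_par y = (\<lambda>\<gamma>\<in>I. rescale \<gamma> (mon y (lev \<gamma>)))"

lemma finite_C: "finite C"
  using C_sub finite_I finite_subset by blast

lemma C_in: "\<delta> \<in> C \<Longrightarrow> \<delta> \<in> I" "\<delta> \<in> C \<Longrightarrow> \<delta> \<subseteq> E"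
  using C_sub members by blast+

lemma lev:
  assumes "\<gamma> \<in> I"
  shows "lev \<gamma> \<in> C" "\<gamma> \<subseteq> lev \<gamma>" "\<delta> \<in> C \<Longrightarrow> \<gamma> \<subseteq> \<delta> \<Longrightarrow> lev \<gamma> \<subseteq> \<delta>"
proof -
  have "\<Inter>{\<delta> \<in> C. \<gamma> \<subseteq> \<delta>} \<in> {\<delta> \<in> C. \<gamma> \<subseteq> \<delta>}"
    by (rule chain_Inter_in) (use finite_C E_C members[OF assms] chain in auto)
  then show "lev \<gamma> \<in> C" "\<gamma> \<subseteq> lev \<gamma>" unfolding lev_def by auto
  show "\<delta> \<in> C \<Longrightarrow> \<gamma> \<subseteq> \<delta> \<Longrightarrow> lev \<gamma> \<subseteq> \<delta>" unfolding lev_def by blast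
qed

lemma lev_C: "\<delta> \<in> C \<Longrightarrow> lev \<delta> = \<delta>"
  using lev[OF C_in(1)] by blast

lemma lev_mono: "\<gamma> \<in> I \<Longrightarrow> \<eta> \<in> I \<Longrightarrow> \<gamma> \<subseteq> \<eta> \<Longrightarrow> lev \<gamma> \<subseteq> lev \<eta>"
  using lev by (meson order_trans)

lemma base:
  assumes "e \<in> params"
  shows "base e \<in> C" "e \<in> base e" "e \<noteq> b (base e)" "\<delta> \<in> C \<Longrightarrow> e \<in> \<delta> \<Longrightarrow> e \<noteq> b \<delta> \<Longrightarrow> base e \<subseteq> \<delta>"
proof -
  have "\<Inter>{\<delta> \<in> C. e \<in> \<delta> \<and> e \<noteq> b \<delta>} \<in> {\<delta> \<in> C. e \<in> \<delta> \<and> e \<noteq> b \<delta>}"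
    by (rule chain_Inter_in) (use finite_C E_C chain assms in auto)
  then show "base e \<in> C" "e \<in> base e" "e \<noteq> b (base e)" unfolding base_def by auto
  show "\<delta> \<in> C \<Longrightarrow> e \<in> \<delta> \<Longrightarrow> e \<noteq> b \<delta> \<Longrightarrow> base e \<subseteq> \<delta>" unfolding base_def by blast
qed

lemma b_E: "\<delta> \<in> C \<Longrightarrow> b E \<in> \<delta> \<Longrightarrow> \<delta> = E"
  using b_notin[OF E_C] C_in(2) by blast

lemma in_params:
  assumes "\<delta> \<in> C" "e \<in> \<delta>" "e \<noteq> b \<delta>" shows "e \<in> params"
proof -
  have "\<delta> = E" if "e = b E" using b_E[OF assms(1)] assms(2) that by simp
  then have "e \<noteq> b E" using assms(3) by blast
  then show ?thesis using C_in(2)[OF assms(1)] assms(2) by blast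
qed

lemma b_in_params:
  assumes "\<delta> \<in> C" "\<delta>' \<in> C" "\<delta>' \<subset> \<delta>" shows "b \<delta>' \<in> params"
proof (rule in_params[OF assms(1)])
  show "b \<delta>' \<in> \<delta>" using b_in[OF assms(2)] assms(3) by blast
  show "b \<delta>' \<noteq> b \<delta>" using b_in[OF assms(2)] b_notin[OF assms] by metis
qed

lemma mon_b: "\<delta> \<in> C \<Longrightarrow> mon y \<delta> (b \<delta>) = 1"
proof -
  assume "\<delta> \<in> C"
  then have A: "{\<delta>' \<in> C. b \<delta> \<in> \<delta>' \<and> b \<delta> \<noteq> b \<delta>' \<and> \<delta>' \<subset> \<delta>} = {}" using b_notin by blast
  show ?thesis unfolding mon_def A by simp
qed

text \<open>The telescoping product may be cut at any \<delta>' of the chain. In terms of metrics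
  this is the proportionality of \<open>x \<delta>\<close> and \<open>x \<delta>'\<close> on
  \<delta>', and it yields the equations of the model.\<close>

lemma mon_chain:
  assumes "\<delta> \<in> C" "\<delta>' \<in> C" "\<delta>' \<subseteq> \<delta>" "e \<in> \<delta>'"
  shows "mon y \<delta> e = mon y \<delta> (b \<delta>') * mon y \<delta>' e"
proof (cases "\<delta>' = \<delta> \<or> e = b \<delta>'")
  case False
  then have sub: "\<delta>' \<subset> \<delta>" "e \<noteq> b \<delta>'" using assms by auto
  let ?A = "\<lambda>\<delta> e. {\<delta>' \<in> C. e \<in> \<delta>' \<and> e \<noteq> b \<delta>' \<and> \<delta>' \<subset> \<delta>}"
  have fin: "finite (?A \<delta> e)" for \<delta> e using finite_C by simp
  have above: "x \<in> ?A \<delta> (b \<delta>') \<longleftrightarrow> x \<in> C \<and> \<delta>' \<subset> x \<and> x \<subset> \<delta>" for x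
  proof
    assume x: "x \<in> ?A \<delta> (b \<delta>')"
    then have "\<not> x \<subset> \<delta>'" using b_notin[OF assms(2), of x] by blast
    then show "x \<in> C \<and> \<delta>' \<subset> x \<and> x \<subset> \<delta>" using x chain[OF assms(2), of x] by blast
  next
    assume x: "x \<in> C \<and> \<delta>' \<subset> x \<and> x \<subset> \<delta>"
    then show "x \<in> ?A \<delta> (b \<delta>')" using b_in[OF assms(2)] b_notin[of x \<delta>'] assms(2) by auto
  qed
  \<comment> \<open>The steps of the chain between \<open>e\<close> and \<delta> are those below
    \<delta>', the step at \<delta>' itself, and those strictly between \<delta>' and
    \<delta>.\<close>
  have split: "?A \<delta> e = ?A \<delta>' e \<union> insert \<delta>' (?A \<delta> (b \<delta>'))"
  proof (rule set_eqI)
    fix x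
    show "x \<in> ?A \<delta> e \<longleftrightarrow> x \<in> ?A \<delta>' e \<union> insert \<delta>' (?A \<delta> (b \<delta>'))"
      unfolding Un_iff insert_iff above using sub assms chain[OF assms(2), of x] b_notin[of x \<delta>'] by blast
  qed
  have disj: "?A \<delta>' e \<inter> insert \<delta>' (?A \<delta> (b \<delta>')) = {}" "\<delta>' \<notin> ?A \<delta> (b \<delta>')"
    using above by blast+
  have "(\<Prod>x\<in>?A \<delta> e. y (b x)) = (\<Prod>x\<in>?A \<delta>' e. y (b x)) * (y (b \<delta>') * (\<Prod>x\<in>?A \<delta> (b \<delta>'). y (b x)))"
    unfolding split by (subst prod.union_disjoint) (use fin disj in simp_all)
  moreover have "e \<noteq> b \<delta>" "b \<delta>' \<noteq> b \<delta>" using b_notin[OF assms(1,2) sub(1)] assms(4) b_in[OF assms(2)] by auto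
  ultimately show ?thesis using sub(2) unfolding mon_def by simp
qed (use assms mon_b in auto)

lemma mon_base: "e \<in> params \<Longrightarrow> mon y (base e) e = y e"
proof -
  assume e: "e \<in> params"
  then have A: "{\<delta>' \<in> C. e \<in> \<delta>' \<and> e \<noteq> b \<delta>' \<and> \<delta>' \<subset> base e} = {}" using base(4)[OF e] by blast
  show ?thesis unfolding mon_def A using base(3)[OF e] by simp
qed

lemma mon_nonneg:
  assumes "\<And>e. e \<in> params \<Longrightarrow> 0 \<le> y e" "\<delta> \<in> C" "e \<in> \<delta>" shows "0 \<le> mon y \<delta> e"
proof -
  have "0 \<le> y (b \<delta>')" if "\<delta>' \<in> C" "\<delta>' \<subset> \<delta>" for \<delta>' using assms(1)[OF b_in_params[OF assms(2) that]] .
  moreover have "0 \<le> y e" if "e \<noteq> b \<delta>" using assms(1)[OF in_params[OF assms(2,3) that]] .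
  ultimately show ?thesis unfolding mon_def by (intro mult_nonneg_nonneg prod_nonneg) auto
qed

text \<open>\<open>T\<close> holds the parameters that may vanish. As no normalizing edge lies in
  \<open>T\<close>, vanishing is not passed on to coordinates outside \<open>T\<close>; this gives
  generic points of a center.\<close>

lemma mon_pos:
  assumes "\<And>e. e \<in> params \<Longrightarrow> e \<notin> T \<Longrightarrow> 0 < y e" "\<And>\<delta>. \<delta> \<in> C \<Longrightarrow> b \<delta> \<notin> T" "\<delta> \<in> C" "e \<in> \<delta>" "e \<notin> T"
  shows "0 < mon y \<delta> e"
proof -
  have "0 < y (b \<delta>')" if "\<delta>' \<in> C" "\<delta>' \<subset> \<delta>" for \<delta>'
    using assms(1)[OF b_in_params[OF assms(3) that]] assms(2)[OF that(1)] by blast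
  moreover have "0 < y e" if "e \<noteq> b \<delta>" using assms(1)[OF in_params[OF assms(3,4) that]] assms(5) by blast
  ultimately show ?thesis unfolding mon_def by (intro mult_pos_pos prod_pos) auto
qed

lemma chart_domD:
  assumes "x \<in> chart_dom"
  shows "x \<in> model_points I" "\<delta> \<in> C \<Longrightarrow> x \<delta> (b \<delta>) \<noteq> 0" "\<gamma> \<in> I \<Longrightarrow> sum (x (lev \<gamma>)) \<gamma> \<noteq> 0"
  using assms by (auto simp: chart_dom_def)

text \<open>One climbs the chain: \<open>e\<close> is compared with \<open>b (base e)\<close> at its
  base, and the base of \<open>b (base e)\<close> is strictly larger. Hence the induction on the
  codimension of \<open>base e\<close>; it stops when the base is \<delta>.\<close>

lemma chart_dom_mon:
  assumes x: "x \<in> chart_dom" and \<delta>: "\<delta> \<in> C" and e: "e \<in> \<delta>"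
  shows "x \<delta> e = x \<delta> (b \<delta>) * mon (coords x) \<delta> e"
  using e
proof (induction "card E - card (base e)" arbitrary: e rule: less_induct)
  case less
  show ?case
  proof (cases "e = b \<delta>")
    case True
    then show ?thesis using mon_b[OF \<delta>] by simp
  next
    case False
    have ep: "e \<in> params" by (rule in_params[OF \<delta> less.prems False])
    let ?d = "base e"
    have d: "?d \<in> C" "e \<in> ?d" "?d \<subseteq> \<delta>" "x ?d (b ?d) \<noteq> 0"
      using base[OF ep] \<delta> less.prems False chart_domD(2)[OF x] by auto
    have me: "mon (coords x) \<delta> e = mon (coords x) \<delta> (b ?d) * (x ?d e / x ?d (b ?d))"
      using mon_chain[OF \<delta> d(1,3,2)] mon_base[OF ep] ep by (simp add: coords_def)
    have bd: "b ?d \<in> \<delta>" using b_in[OF d(1)] d(3) by blast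
    have IH: "x \<delta> (b ?d) = x \<delta> (b \<delta>) * mon (coords x) \<delta> (b ?d)"
    proof (cases "?d = \<delta>")
      case True
      then show ?thesis using mon_b[OF \<delta>] by simp
    next
      case False
      then have sub: "?d \<subset> \<delta>" using d(3) by blast
      then have bp: "b ?d \<in> params" by (rule b_in_params[OF \<delta> d(1)])
      have "\<not> base (b ?d) \<subset> ?d" using b_notin[OF d(1) base(1)[OF bp]] base(2)[OF bp] by blast
      then have "?d \<subset> base (b ?d)" using chain[OF d(1) base(1)[OF bp]] base(3)[OF bp] by auto
      moreover have "finite (base (b ?d))" using base(1)[OF bp] C_in(2) finite_E finite_subset by blast
      ultimately have "card ?d < card (base (b ?d))" by (simp add: psubset_card_mono)
      moreover have "card (base (b ?d)) \<le> card E" using base(1)[OF bp] C_in(2) finite_E by (simp add: card_mono)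
      ultimately show ?thesis by (intro less.hyps bd) simp
    qed
    have xm: "x \<in> model_points I" using chart_domD(1)[OF x] .
    \<comment> \<open>The common factor may be 0, so it is not cancelled; only the nonzero
      \<open>x ?d (b ?d)\<close> is divided by.\<close>
    have "x \<delta> e = sum (x \<delta>) ?d * x ?d e" "x \<delta> (b ?d) = sum (x \<delta>) ?d * x ?d (b ?d)"
      using model_pointsD(4)[OF xm C_in(1)[OF d(1)] C_in(1)[OF \<delta>] d(3)] d(2) b_in[OF d(1)] by blast+
    then have "x \<delta> e = x \<delta> (b ?d) * (x ?d e / x ?d (b ?d))" using d(4) by simp
    then show ?thesis using me IH by simp
  qed
qed

lemma coords_in:
  assumes x: "x \<in> chart_dom" shows "coords x \<in> chart_img"
  unfolding chart_img_def
proof (intro CollectI conjI ballI)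
  have xm: "x \<in> model_points I" using chart_domD(1)[OF x] .
  have "0 \<le> coords x e" if "e \<in> params" for e
    using model_pointsD(2)[OF xm C_in(1)[OF base(1)[OF that]]] base(2)[OF that] b_in[OF base(1)[OF that]] that
    by (simp add: coords_def)
  then show "coords x \<in> pts (orthant_on params)" unfolding pts_orthant_on by (simp add: coords_def)
  fix \<gamma> assume \<gamma>: "\<gamma> \<in> I"
  have "sum (x (lev \<gamma>)) \<gamma> = x (lev \<gamma>) (b (lev \<gamma>)) * sum (mon (coords x) (lev \<gamma>)) \<gamma>"
    unfolding sum_distrib_left by (rule sum.cong[OF refl chart_dom_mon[OF x]]) (use lev[OF \<gamma>] in auto)
  then show "sum (mon (coords x) (lev \<gamma>)) \<gamma> \<noteq> 0" using chart_domD(3)[OF x \<gamma>] by auto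
qed

lemma chart_par_apply:
  assumes "\<gamma> \<in> I" "e \<in> \<gamma>" shows "chart_par y \<gamma> e = mon y (lev \<gamma>) e / sum (mon y (lev \<gamma>)) \<gamma>"
  using assms by (simp add: chart_par_def rescale_def)

lemma chart_imgD:
  assumes "y \<in> chart_img"
  shows "e \<in> params \<Longrightarrow> 0 \<le> y e" "\<gamma> \<in> I \<Longrightarrow> sum (mon y (lev \<gamma>)) \<gamma> \<noteq> 0" "y \<in> extensional params"
  using assms unfolding chart_img_def pts_orthant_on by (auto simp: PiE_def)

text \<open>By \<open>mon_chain\<close>, the monomials at \<open>lev \<eta>\<close> and at
  \<open>lev \<gamma>\<close> differ on \<gamma> by the single factor \<open>?c\<close>, which
  enters the coordinates and the volume alike.\<close>

lemma chart_par_in_model: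
  assumes y: "y \<in> chart_img" shows "chart_par y \<in> model_points I"
  unfolding model_points_def
proof (intro CollectI conjI ballI impI PiE_I)
  show "chart_par y \<gamma> \<in> std_simplex \<gamma>" if "\<gamma> \<in> I" for \<gamma>
    using that chart_imgD(2)[OF y that] mon_nonneg[OF chart_imgD(1)[OF y] lev(1)[OF that]] lev(2)[OF that]
    by (auto simp: chart_par_def intro!: rescale_in_std_simplex)
  fix \<eta> \<gamma> e assume *: "\<eta> \<in> I" "\<gamma> \<in> I" "\<gamma> \<subseteq> \<eta>" "e \<in> \<gamma>"
  let ?c = "mon y (lev \<eta>) (b (lev \<gamma>))" and ?s = "sum (mon y (lev \<eta>)) \<eta>"
  have m: "mon y (lev \<eta>) e = ?c * mon y (lev \<gamma>) e" if "e \<in> \<gamma>" for e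
    by (rule mon_chain[OF lev(1)[OF *(1)] lev(1)[OF *(2)] lev_mono[OF *(2,1,3)]]) (use that lev(2)[OF
        *(2)] in auto)
  have "sum (chart_par y \<eta>) \<gamma> = (\<Sum>e\<in>\<gamma>. ?c * mon y (lev \<gamma>) e / ?s)"
    by (rule sum.cong[OF refl]) (use * m chart_par_apply in auto)
  also have "\<dots> = ?c * sum (mon y (lev \<gamma>)) \<gamma> / ?s" by (simp add: sum_distrib_left sum_divide_distrib)
  finally have "sum (chart_par y \<eta>) \<gamma> = ?c * sum (mon y (lev \<gamma>)) \<gamma> / ?s" .
  moreover have "e \<in> \<eta>" using *(3,4) by blast
  from chart_par_apply[OF *(1) this, of y] have "chart_par y \<eta> e = ?c * mon y (lev \<gamma>) e / ?s"
    by (simp only: m[OF *(4)])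
  ultimately show "chart_par y \<eta> e = sum (chart_par y \<eta>) \<gamma> * chart_par y \<gamma> e"
    using chart_imgD(2)[OF y *(2)] chart_par_apply[OF *(2,4)] by simp
qed (simp add: chart_par_def)

lemma chart_par_in:
  assumes y: "y \<in> chart_img" shows "chart_par y \<in> chart_dom"
  unfolding chart_dom_def
proof (intro CollectI conjI ballI chart_par_in_model[OF y])
  show "chart_par y \<delta> (b \<delta>) \<noteq> 0" if "\<delta> \<in> C" for \<delta>
    using chart_par_apply[OF C_in(1)[OF that] b_in[OF that]] lev_C[OF that] mon_b[OF that]
        chart_imgD(2)[OF y C_in(1)[OF that]] by simp
  fix \<gamma> assume \<gamma>: "\<gamma> \<in> I"
  let ?l = "lev \<gamma>"
  have "sum (chart_par y ?l) \<gamma> = (\<Sum>e\<in>\<gamma>. mon y ?l e / sum (mon y ?l) ?l)"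
    by (rule sum.cong[OF refl], subst chart_par_apply) (use lev[OF \<gamma>] C_in lev_C in auto)
  also have "\<dots> = sum (mon y ?l) \<gamma> / sum (mon y ?l) ?l" by (simp add: sum_divide_distrib)
  finally show "sum (chart_par y ?l) \<gamma> \<noteq> 0"
    using chart_imgD(2)[OF y \<gamma>] chart_imgD(2)[OF y C_in(1)[OF lev(1)[OF \<gamma>]]] lev_C[OF lev(1)[OF \<gamma>]] by simp
qed

lemma coords_chart_par:
  assumes y: "y \<in> chart_img" shows "coords (chart_par y) = y"
proof (rule extensionalityI[of _ params])
  fix e assume e: "e \<in> params"
  let ?d = "base e"
  have d: "?d \<in> C" "?d \<in> I" using base(1)[OF e] C_in by auto
  show "coords (chart_par y) e = y e"
    using e chart_par_apply[OF d(2) base(2)[OF e]] chart_par_apply[OF d(2) b_in[OF d(1)]] lev_C[OF d(1)]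
        mon_b[OF d(1)]
      mon_base[OF e] chart_imgD(2)[OF y d(2)] by (simp add: coords_def)
qed (use chart_imgD(3)[OF y] in \<open>auto simp: coords_def\<close>)

text \<open>Two rescalings meet at \<open>lev \<gamma>\<close>: there the metric is a multiple of
  the monomials, and on \<gamma> a multiple of \<open>x \<gamma>\<close>, both with nonzero factor
  in the chart.\<close>

lemma chart_par_coords:
  assumes x: "x \<in> chart_dom" shows "chart_par (coords x) = x"
proof (rule extensionalityI[of _ I])
  have xm: "x \<in> model_points I" using chart_domD(1)[OF x] .
  then show "x \<in> extensional I" by (auto simp: model_points_def PiE_def)
  fix \<gamma> assume \<gamma>: "\<gamma> \<in> I"
  let ?l = "lev \<gamma>"
  have l: "?l \<in> C" "?l \<in> I" "\<gamma> \<subseteq> ?l" using lev[OF \<gamma>] C_in by auto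
  have "rescale \<gamma> (x ?l) = rescale \<gamma> (mon (coords x) ?l)"
    by (rule rescale_scale[OF chart_domD(2)[OF x l(1)] chart_dom_mon[OF x l(1)]]) (use l in auto)
  moreover have "rescale \<gamma> (x ?l) = rescale \<gamma> (x \<gamma>)"
    by (rule rescale_scale[OF chart_domD(3)[OF x \<gamma>] model_pointsD(4)[OF xm \<gamma> l(2,3)]])
  ultimately show "chart_par (coords x) \<gamma> = x \<gamma>"
    using \<gamma> rescale_std_simplex[OF model_pointsD(1)[OF xm \<gamma>]] by (simp add: chart_par_def)
qed (simp add: chart_par_def)

lemma openin_chart_dom: "openin (rtop (model I)) chart_dom"
proof -
  note M = fspace_model[of I]
  have op: "openin (rtop (model I)) (model_points I)" using openin_topspace[of "rtop (model I)"] by simp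
  \<comment> \<open>All finitely many inequations of the chart are collected in one product, so that
    the chart is the nonvanishing set of one regular function.\<close>
  let ?h = "\<lambda>x. (\<Prod>\<delta>\<in>C. x \<delta> (b \<delta>)) * (\<Prod>\<gamma>\<in>I. \<Sum>e\<in>\<gamma>. x (lev \<gamma>) e)"
  have "?h \<in> reg (model I) (model_points I)"
    by (intro fspace.reg_mult[OF M] fspace.reg_prod[OF M] fspace.reg_sum[OF M] op model_coordinate)
      (use C_in b_in lev in blast)+
  from fspace.reg_nonzero_open[OF M this] show ?thesis
    unfolding chart_dom_def using finite_C finite_I by (simp add: prod_zero_iff)
qed

lemma mon_reg:
  assumes "\<delta> \<in> C" "e \<in> \<delta>" shows "(\<lambda>y. mon y \<delta> e) \<in> reg (orthant_on params) (pts (orthant_on params))"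
proof -
  note O = fspace_orthant_on[of params]
  have "(\<lambda>y. if e = b \<delta> then 1 else y e) \<in> reg (orthant_on params) (pts (orthant_on params))"
  proof (cases "e = b \<delta>")
    case False
    then show ?thesis using orthant_coordinate[OF in_params[OF assms False]] by (simp only: if_False)
  next
    case True
    then have "(\<lambda>y. if e = b \<delta> then 1 else y e) = (\<lambda>_. 1 :: real)" by simp
    then show ?thesis by (simp only: fspace.reg_const[OF O openin_topspace])
  qed
  then show ?thesis
    unfolding mon_def
    by (intro fspace.reg_mult[OF O] fspace.reg_prod[OF O] openin_topspace orthant_coordinate)
      (use b_in_params[OF assms(1)] in blast)+
qed

lemma openin_chart_img: "openin (rtop (orthant_on params)) chart_img"
proof -
  note O = fspace_orthant_on[of params]
  let ?h = "\<lambda>y. \<Prod>\<gamma>\<in>I. \<Sum>e\<in>\<gamma>. mon y (lev \<gamma>) e"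
  have "?h \<in> reg (orthant_on params) (pts (orthant_on params))"
    by (intro fspace.reg_prod[OF O] fspace.reg_sum[OF O] openin_topspace mon_reg) (use lev in blast)+
  from fspace.reg_nonzero_open[OF O this] show ?thesis
    unfolding chart_img_def using finite_I by (simp add: prod_zero_iff)
qed

abbreviation chart_source :: "('e set \<Rightarrow> 'e \<Rightarrow> real) rspace" where
  "chart_source \<equiv> sub_space (model I) chart_dom"

abbreviation chart_target :: "('e \<Rightarrow> real) rspace" where
  "chart_target \<equiv> sub_space (orthant_on params) chart_img"

lemma pts_chart_source [simp]: "pts chart_source = chart_dom"
  using openin_subset[OF openin_chart_dom] by auto

lemma pts_chart_target [simp]: "pts chart_target = chart_img"
  using openin_subset[OF openin_chart_img] by auto

lemma coords_reg:
  assumes "e \<in> params" shows "(\<lambda>x. coords x e) \<in> reg (model I) chart_dom"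
proof -
  note M = fspace_model[of I]
  have c: "(\<lambda>x. x \<delta> e) \<in> reg (model I) chart_dom" if "\<delta> \<in> I" "e \<in> \<delta>" for \<delta> e
    by (rule fspace.reg_subset[OF M model_coordinate[OF that] openin_chart_dom]) (simp add: chart_dom_def)
  have "(\<lambda>x. x (base e) e / x (base e) (b (base e))) \<in> reg (model I) chart_dom"
    by (intro fspace.reg_divide[OF M] c C_in base[OF assms] b_in ballI chart_domD(2))
  then show ?thesis using assms by (simp add: coords_def)
qed

lemma chart_iso: "inverse_morphisms chart_source chart_target coords chart_par"
  unfolding inverse_morphisms_def
proof (intro conjI ballI)
  have S: "fspace chart_source" "fspace chart_target" by simp_all
  show "morphism chart_source chart_target coords"
  proof (rule morphism_sub_spaceI[OF S(1) morphism_orthantI[OF S(1)]])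
    show "coords z \<in> pts (orthant_on params)" if "z \<in> pts chart_source" for z
      using coords_in[of z] that unfolding pts_chart_source chart_img_def by blast
    show "(\<lambda>z. coords z i) \<in> reg chart_source (pts chart_source)" if "i \<in> params" for i
      unfolding pts_chart_source reg_sub_space_open[OF fspace_model openin_chart_dom]
        using coords_reg[OF that] by simp
    show "coords z \<in> chart_img" if "z \<in> pts chart_source" for z
      using coords_in[of z] that unfolding pts_chart_source by blast
  qed
  show "morphism chart_target chart_source chart_par"
  proof (rule morphism_sub_spaceI[OF S(2) morphism_modelI[OF S(2)]])
    show "chart_par z \<in> model_points I" if "z \<in> pts chart_target" for z
      using chart_par_in_model[of z] that unfolding pts_chart_target by blast
    show "chart_par z \<in> chart_dom" if "z \<in> pts chart_target" for z
      using chart_par_in[of z] that unfolding pts_chart_target by blast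
    fix \<gamma> e assume *: "\<gamma> \<in> I" "e \<in> \<gamma>"
    have c: "(\<lambda>y. mon y \<delta> e) \<in> reg chart_target chart_img" if "\<delta> \<in> C" "e \<in> \<delta>" for \<delta> e
      unfolding reg_sub_space_open[OF fspace_orthant_on openin_chart_img]
      using fspace.reg_subset[OF fspace_orthant_on mon_reg[OF that] openin_chart_img] openin_subset[OF
          openin_chart_img] by blast
    have op: "openin (rtop chart_target) chart_img" using openin_topspace[of "rtop chart_target"]
      unfolding pts_chart_target .
    have "(\<lambda>y. mon y (lev \<gamma>) e / (\<Sum>e\<in>\<gamma>. mon y (lev \<gamma>) e)) \<in> reg chart_target chart_img"
      by (intro fspace.reg_divide[OF S(2)] fspace.reg_sum[OF S(2)] c op ballI chart_imgD(2)[OF _ *(1)] lev(1) *)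
        (use lev[OF *(1)] * in auto)
    then show "(\<lambda>y. chart_par y \<gamma> e) \<in> reg chart_target (pts chart_target)"
      unfolding pts_chart_target chart_par_apply[OF *] .
  qed
  show "chart_par (coords x) = x" if "x \<in> pts chart_source" for x
    using chart_par_coords[of x] that unfolding pts_chart_source by blast
  show "coords (chart_par y) = y" if "y \<in> pts chart_target" for y
    using coords_chart_par[of y] that unfolding pts_chart_target by blast
qed

text \<open>All parameters outside \<open>T\<close> are raised by a small amount. With
  \<open>T\<close> empty this gives the density of positive points, with \<open>T\<close> the new
  member the generic points of its center.\<close>

lemma chart_approximation:
  assumes x: "x \<in> chart_dom" and T: "\<And>e. e \<in> params \<Longrightarrow> e \<in> T \<Longrightarrow> coords x e = 0"
    and V: "openin (rtop (model I)) V" "x \<in> V"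
  obtains z where "z \<in> V" "z \<in> chart_dom" "\<And>e. e \<in> params \<Longrightarrow> e \<in> T \<Longrightarrow> coords z e = 0"
    "\<And>e. e \<in> params \<Longrightarrow> e \<notin> T \<Longrightarrow> 0 < coords z e"
proof -
  let ?O = "{y \<in> pts chart_target. chart_par y \<in> V \<inter> chart_dom}"
  have "openin (rtop chart_source) (V \<inter> chart_dom)" using V by (auto simp: openin_subtopology)
  then have "openin (rtop chart_target) ?O" by (rule morphism_open[OF inverse_morphismsD(2)[OF chart_iso]])
  then have op: "openin (rtop (orthant_on params)) ?O"
    using openin_chart_img unfolding rtop_sub_space by (meson openin_trans_full)
  have yO: "coords x \<in> ?O"
    using coords_in[OF x] chart_par_coords[OF x] V(2) x unfolding pts_chart_target by simp
  have cx: "coords x \<in> pts (orthant_on params)" using coords_in[OF x] by (simp add: chart_img_def)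
  \<comment> \<open>The absolute value keeps the path inside the orthant for negative
    \<open>s\<close> too, so the preimage of an open set is open in the whole line.\<close>
  define c where "c s = (\<lambda>e\<in>params. coords x e + (if e \<in> T then 0 else \<bar>s\<bar>))" for s :: real
  have "continuous_map euclideanreal (product_topology (\<lambda>_. euclidean) params) c"
    unfolding continuous_map_componentwise
  proof (intro conjI ballI)
    show "c ` topspace euclideanreal \<subseteq> extensional params" by (auto simp: c_def)
    fix e assume e: "e \<in> params"
    show "continuous_map euclideanreal euclideanreal (\<lambda>s. c s e)"
      using e by (cases "e \<in> T") (auto simp: c_def intro!: continuous_intros)
  qed
  moreover have "c s \<in> pts (orthant_on params)" for s
    using cx unfolding pts_orthant_on by (auto simp: c_def)
  ultimately have cont: "continuous_map euclideanreal (rtop (orthant_on params)) c"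
    unfolding orthant_on_def by (auto simp: continuous_map_in_subtopology)
  have "openin euclideanreal {s. c s \<in> ?O}"
    using openin_continuous_map_preimage[OF cont op] unfolding topspace_euclidean by simp
  then have "open {s. c s \<in> ?O}" by simp
  moreover have "c 0 = coords x" by (rule extensionalityI[of _ params]) (auto simp: c_def coords_def)
  then have "0 \<in> {s. c s \<in> ?O}" using yO by simp
  ultimately obtain \<epsilon> where \<epsilon>: "\<epsilon> > 0" "ball 0 \<epsilon> \<subseteq> {s. c s \<in> ?O}" using open_contains_ball by blast
  have "\<epsilon> / 2 \<in> ball 0 \<epsilon>" using \<epsilon>(1) by (simp add: dist_real_def)
  then have c: "c (\<epsilon> / 2) \<in> ?O" using \<epsilon>(2) by blast
  then have c': "c (\<epsilon> / 2) \<in> chart_img" "chart_par (c (\<epsilon> / 2)) \<in> V \<inter> chart_dom" unfolding pts_chart_target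
    by auto
  have cc: "coords (chart_par (c (\<epsilon> / 2))) = c (\<epsilon> / 2)" by (rule coords_chart_par[OF c'(1)])
  show thesis
  proof (rule that[of "chart_par (c (\<epsilon> / 2))"])
    show "coords (chart_par (c (\<epsilon> / 2))) e = 0" if "e \<in> params" "e \<in> T" for e
      using T[OF that] that unfolding cc by (simp add: c_def)
    show "0 < coords (chart_par (c (\<epsilon> / 2))) e" if "e \<in> params" "e \<notin> T" for e
      using that \<epsilon>(1) cx unfolding cc pts_orthant_on by (auto simp: c_def intro: add_nonneg_pos)
  qed (use c' in auto)
qed

end

section \<open>Charts adapted to a point; smoothness and density of positive points\<close>

context union_family begin

text \<open>Two clauses are carried through the recursion for later use. That
  \<open>p \<delta>\<close> vanishes on all smaller members of the chain makes the parameters of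
  their normalizing edges vanish at \<open>p\<close>. That each \<gamma> has a nonzero coordinate at
  the smallest chain member above it puts \<open>p\<close> into \<open>chart_dom\<close>.\<close>

lemma adapted_chart_below:
  assumes p: "p \<in> model_points I" and "\<eta> \<in> I"
  shows "\<exists>C b. C \<subseteq> I \<and> \<eta> \<in> C \<and> (\<forall>\<delta>\<in>C. \<delta> \<subseteq> \<eta>) \<and> (\<forall>\<delta>\<in>C. \<forall>\<delta>'\<in>C. \<delta> \<subseteq> \<delta>' \<or> \<delta>' \<subseteq> \<delta>) \<and>
    (\<forall>\<delta>\<in>C. b \<delta> \<in> \<delta> \<and> p \<delta> (b \<delta>) \<noteq> 0 \<and> (\<forall>\<delta>'\<in>C. \<delta>' \<subset> \<delta> \<longrightarrow> (\<forall>e\<in>\<delta>'. p \<delta> e = 0))) \<and>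
    (\<forall>\<gamma>\<in>I. \<gamma> \<subseteq> \<eta> \<longrightarrow> (\<exists>\<delta>\<in>C. \<gamma> \<subseteq> \<delta> \<and> (\<forall>\<delta>'\<in>C. \<gamma> \<subseteq> \<delta>' \<longrightarrow> \<delta> \<subseteq> \<delta>') \<and> (\<exists>e\<in>\<gamma>. p \<delta> e \<noteq> 0)))"
  using assms(2)
proof (induction "card \<eta>" arbitrary: \<eta> rule: less_induct)
  case less
  let ?Z = "{\<gamma> \<in> I. \<gamma> \<subseteq> \<eta> \<and> (\<forall>e\<in>\<gamma>. p \<eta> e = 0)}"
  obtain e0 where e0: "e0 \<in> \<eta>" "p \<eta> e0 \<noteq> 0"
    using std_simplex_nonzero[OF model_pointsD(1)[OF p less.prems]] by blast
  show ?case
  proof (cases "?Z = {}")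
    case True
    then have "\<exists>e\<in>\<gamma>. p \<eta> e \<noteq> 0" if "\<gamma> \<in> I" "\<gamma> \<subseteq> \<eta>" for \<gamma> using that by blast
    then show ?thesis using less.prems e0 by (intro exI[of _ "{\<eta>}"] exI[of _ "\<lambda>_. e0"]) auto
  next
    case False
    let ?n = "\<Union>?Z"
    have n: "?n \<in> I" by (rule Union_in) (use False in auto)
    have nz: "p \<eta> e = 0" if "e \<in> ?n" for e using that by blast
    have sub: "?n \<subset> \<eta>" using e0 nz by blast
    then have "card ?n < card \<eta>" using finite_member[OF less.prems] by (rule psubset_card_mono[rotated])
    from less.hyps[OF this n] obtain C b where C: "C \<subseteq> I" "?n \<in> C" "\<forall>\<delta>\<in>C. \<delta> \<subseteq> ?n"
      "\<forall>\<delta>\<in>C. \<forall>\<delta>'\<in>C. \<delta> \<subseteq> \<delta>' \<or> \<delta>' \<subseteq> \<delta>"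
      "\<forall>\<delta>\<in>C. b \<delta> \<in> \<delta> \<and> p \<delta> (b \<delta>) \<noteq> 0 \<and> (\<forall>\<delta>'\<in>C. \<delta>' \<subset> \<delta> \<longrightarrow> (\<forall>e\<in>\<delta>'. p \<delta> e = 0))"
      "\<forall>\<gamma>\<in>I. \<gamma> \<subseteq> ?n \<longrightarrow> (\<exists>\<delta>\<in>C. \<gamma> \<subseteq> \<delta> \<and> (\<forall>\<delta>'\<in>C. \<gamma> \<subseteq> \<delta>' \<longrightarrow> \<delta> \<subseteq> \<delta>') \<and> (\<exists>e\<in>\<gamma>. p \<delta> e \<noteq> 0))"
      by (elim exE conjE) (rule that)
    have C\<eta>: "\<delta> \<subset> \<eta>" if "\<delta> \<in> C" for \<delta> using C(3) sub that by blast
    then have \<eta>C: "\<eta> \<notin> C" by blast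
    let ?C = "insert \<eta> C" and ?b = "b(\<eta> := e0)"
    have "\<forall>\<delta>\<in>?C. \<forall>\<delta>'\<in>?C. \<delta> \<subseteq> \<delta>' \<or> \<delta>' \<subseteq> \<delta>" using C(4) C\<eta> by blast
    moreover have "\<forall>\<delta>\<in>?C. ?b \<delta> \<in> \<delta> \<and> p \<delta> (?b \<delta>) \<noteq> 0 \<and> (\<forall>\<delta>'\<in>?C. \<delta>' \<subset> \<delta> \<longrightarrow> (\<forall>e\<in>\<delta>'. p \<delta> e = 0))"
    proof
      fix \<delta> assume "\<delta> \<in> ?C"
      then consider "\<delta> = \<eta>" | "\<delta> \<in> C" "\<delta> \<noteq> \<eta>" using \<eta>C by blast
      then show "?b \<delta> \<in> \<delta> \<and> p \<delta> (?b \<delta>) \<noteq> 0 \<and> (\<forall>\<delta>'\<in>?C. \<delta>' \<subset> \<delta> \<longrightarrow> (\<forall>e\<in>\<delta>'. p \<delta> e = 0))"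
      proof cases
        case 1
        have "p \<eta> e = 0" if "\<delta>' \<in> C" "e \<in> \<delta>'" for \<delta>' e using nz C(3) that by blast
        then show ?thesis using 1 e0 by auto
      next
        case 2
        then show ?thesis using C(5) C\<eta>[OF 2(1)] by auto
      qed
    qed
    moreover have "\<forall>\<gamma>\<in>I. \<gamma> \<subseteq> \<eta> \<longrightarrow> (\<exists>\<delta>\<in>?C. \<gamma> \<subseteq> \<delta> \<and> (\<forall>\<delta>'\<in>?C. \<gamma> \<subseteq> \<delta>' \<longrightarrow> \<delta> \<subseteq> \<delta>') \<and> (\<exists>e\<in>\<gamma>. p \<delta> e \<noteq> 0))"
    proof (intro ballI impI)
      fix \<gamma> assume \<gamma>: "\<gamma> \<in> I" "\<gamma> \<subseteq> \<eta>"
      show "\<exists>\<delta>\<in>?C. \<gamma> \<subseteq> \<delta> \<and> (\<forall>\<delta>'\<in>?C. \<gamma> \<subseteq> \<delta>' \<longrightarrow> \<delta> \<subseteq> \<delta>') \<and> (\<exists>e\<in>\<gamma>. p \<delta> e \<noteq> 0)"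
      proof (cases "\<forall>e\<in>\<gamma>. p \<eta> e = 0")
        case True
        then have "\<gamma> \<subseteq> ?n" using \<gamma> by blast
        then obtain \<delta> where \<delta>: "\<delta> \<in> C" "\<gamma> \<subseteq> \<delta>" "\<forall>\<delta>'\<in>C. \<gamma> \<subseteq> \<delta>' \<longrightarrow> \<delta> \<subseteq> \<delta>'" "\<exists>e\<in>\<gamma>. p \<delta> e \<noteq> 0"
          using C(6) \<gamma>(1) by meson
        then show ?thesis using C\<eta>[OF \<delta>(1)] by (intro bexI[of _ \<delta>]) auto
      next
        case False
        \<comment> \<open>\<open>p \<eta>\<close> vanishes on every member of \<open>C\<close>,
          since these lie in \<open>?n\<close>; hence \<eta> itself is the smallest chain member
          containing \<gamma>.\<close>
        have "\<not> \<gamma> \<subseteq> \<delta>" if "\<delta> \<in> C" for \<delta> using False nz C(3) that by blast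
        then show ?thesis using False \<gamma> by (intro bexI[of _ \<eta>]) auto
      qed
    qed
    ultimately show ?thesis
      using C(1) less.prems C\<eta> by (intro exI[of _ ?C] exI[of _ ?b] conjI) auto
  qed
qed

lemma adapted_chart:
  assumes p: "p \<in> model_points I"
  obtains C b where "family_chart E I C b" "p \<in> family_chart.chart_dom I C b"
    "\<forall>\<delta>\<in>C. \<forall>\<delta>'\<in>C. \<delta>' \<subset> \<delta> \<longrightarrow> (\<forall>e\<in>\<delta>'. p \<delta> e = 0)"
proof -
  obtain C b where C: "C \<subseteq> I" "E \<in> C" "\<forall>\<delta>\<in>C. \<forall>\<delta>'\<in>C. \<delta> \<subseteq> \<delta>' \<or> \<delta>' \<subseteq> \<delta>"
    "\<forall>\<delta>\<in>C. b \<delta> \<in> \<delta> \<and> p \<delta> (b \<delta>) \<noteq> 0 \<and> (\<forall>\<delta>'\<in>C. \<delta>' \<subset> \<delta> \<longrightarrow> (\<forall>e\<in>\<delta>'. p \<delta> e = 0))"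
    "\<forall>\<gamma>\<in>I. \<gamma> \<subseteq> E \<longrightarrow> (\<exists>\<delta>\<in>C. \<gamma> \<subseteq> \<delta> \<and> (\<forall>\<delta>'\<in>C. \<gamma> \<subseteq> \<delta>' \<longrightarrow> \<delta> \<subseteq> \<delta>') \<and> (\<exists>e\<in>\<gamma>. p \<delta> e \<noteq> 0))"
    using adapted_chart_below[OF p E_in] by (elim exE conjE) (rule that)
  interpret family_chart E I C b
  proof
    show "b \<delta> \<notin> \<delta>'" if "\<delta> \<in> C" "\<delta>' \<in> C" "\<delta>' \<subset> \<delta>" for \<delta> \<delta>' using C(4) that by blast
  qed (use C in blast)+
  have "sum (p (lev \<gamma>)) \<gamma> \<noteq> 0" if \<gamma>: "\<gamma> \<in> I" for \<gamma>
  proof -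
    obtain \<delta> where \<delta>: "\<delta> \<in> C" "\<gamma> \<subseteq> \<delta>" "\<forall>\<delta>'\<in>C. \<gamma> \<subseteq> \<delta>' \<longrightarrow> \<delta> \<subseteq> \<delta>'" "\<exists>e\<in>\<gamma>. p \<delta> e \<noteq> 0"
      using C(5) \<gamma> members[OF \<gamma>] by meson
    have "lev \<gamma> = \<delta>" using lev[OF \<gamma>] \<delta> by blast
    moreover obtain e where e: "e \<in> \<gamma>" "p \<delta> e \<noteq> 0" using \<delta>(4) by blast
    moreover have "0 \<le> p \<delta> e" if "e \<in> \<gamma>" for e using model_pointsD(2)[OF p C_in(1)[OF \<delta>(1)]] \<delta>(2) that by blast
    ultimately have "0 < sum (p (lev \<gamma>)) \<gamma>"
      using finite_member[OF \<gamma>] by (intro sum_pos2[of _ e]) (auto simp: less_le)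
    then show ?thesis by simp
  qed
  then have pd: "p \<in> chart_dom" unfolding chart_dom_def using p C(4) by blast
  show thesis by (rule that[OF family_chart_axioms pd]) (use C(4) in blast)
qed

text \<open>The dimension is the same in all charts, one parameter for each edge other than
  \<open>b E\<close>, although the chain \<open>C\<close> varies with the point.\<close>

lemma smooth_model: "smooth_variety (model I)"
  unfolding smooth_variety_def pts_model
proof (intro exI[of _ "card E - 1"] ballI)
  fix p assume p: "p \<in> model_points I"
  obtain C b where ch: "family_chart E I C b" and pd: "p \<in> family_chart.chart_dom I C b"
    and "\<forall>\<delta>\<in>C. \<forall>\<delta>'\<in>C. \<delta>' \<subset> \<delta> \<longrightarrow> (\<forall>e\<in>\<delta>'. p \<delta> e = 0)"
    by (rule adapted_chart[OF p])
  interpret family_chart E I C b by (rule ch)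
  let ?d = "card E - 1"
  have "card params = ?d" using b_in[OF E_C] finite_E by simp
  then obtain h where h: "bij_betw h {..<?d} params"
    using ex_bij_betw_nat_finite[of params] finite_E by (metis atLeast0LessThan finite_Diff)
  let ?F = "\<lambda>y. \<lambda>i\<in>{..<?d}. y (h i)" and ?G = "\<lambda>x. \<lambda>e\<in>params. x (inv_into {..<?d} h e)"
  note R = orthant_reindex[OF h]
  let ?W = "{x \<in> pts (orthant_on {..<?d}). ?G x \<in> chart_img}"
  have W: "openin (rtop (orthant ?d)) ?W"
    unfolding orthant_eq by (rule morphism_open[OF inverse_morphismsD(2)[OF R] openin_chart_img])
  have "inverse_morphisms chart_target (sub_space (orthant ?d) ?W) ?F ?G"
    unfolding orthant_eq
  proof (rule inverse_morphisms_sub_space[OF _ _ R])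
    fix y assume "y \<in> pts (orthant_on params)" "y \<in> chart_img"
    then show "?F y \<in> ?W" using inverse_morphismsD(3,5)[OF R, of y] by auto
  qed auto
  from inverse_morphisms_trans[OF chart_iso this]
  show "\<exists>U W \<phi>. openin (rtop (model I)) U \<and> p \<in> U \<and> openin (rtop (orthant ?d)) W \<and>
      isomorphism (sub_space (model I) U) (sub_space (orthant ?d) W) \<phi>"
    unfolding isomorphism_iff using openin_chart_dom pd W by blast
qed

definition positive_points :: "('e set \<Rightarrow> 'e \<Rightarrow> real) set" where
  "positive_points = {x \<in> model_points I. \<forall>\<gamma>\<in>I. \<forall>e\<in>\<gamma>. 0 < x \<gamma> e}"

lemma positive_points_dense: "rtop (model I) closure_of positive_points = model_points I"
proof (intro subset_antisym subsetI)
  show "x \<in> model_points I" if "x \<in> rtop (model I) closure_of positive_points" for x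
    using that closure_of_subset_topspace[of "rtop (model I)"] by auto
  fix p assume p: "p \<in> model_points I"
  obtain C b where ch: "family_chart E I C b" and pd: "p \<in> family_chart.chart_dom I C b"
    and "\<forall>\<delta>\<in>C. \<forall>\<delta>'\<in>C. \<delta>' \<subset> \<delta> \<longrightarrow> (\<forall>e\<in>\<delta>'. p \<delta> e = 0)"
    by (rule adapted_chart[OF p])
  interpret family_chart E I C b by (rule ch)
  show "p \<in> rtop (model I) closure_of positive_points"
    unfolding in_closure_of
  proof (intro conjI allI impI)
    fix V assume V: "p \<in> V \<and> openin (rtop (model I)) V"
    obtain z where z: "z \<in> V" "z \<in> chart_dom" "\<And>e. e \<in> params \<Longrightarrow> 0 < coords z e"
      using chart_approximation[OF pd, of "{}" V] V by auto
    have "0 < z \<gamma> e" if "\<gamma> \<in> I" "e \<in> \<gamma>" for \<gamma> e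
    proof -
      have "0 < mon (coords z) (lev \<gamma>) e" if "e \<in> \<gamma>" for e
        by (rule mon_pos[of "{}"]) (use z(3) lev[OF \<open>\<gamma> \<in> I\<close>] that in auto)
      moreover have "0 < sum (mon (coords z) (lev \<gamma>)) \<gamma>"
        by (rule sum_pos) (use calculation finite_member members that in auto)
      ultimately have "0 < chart_par (coords z) \<gamma> e" using chart_par_apply[OF that] that by simp
      then show ?thesis using chart_par_coords[OF z(2)] by simp
    qed
    then show "\<exists>y. y \<in> positive_points \<and> y \<in> V"
      using z chart_domD(1)[OF z(2)] unfolding positive_points_def by blast
  qed (use p in simp)
qed

end

subsection \<open>Hadamard's lemma\<close>

text \<open>These functions form a space with functions.  Hence a morphism from it to a model exists as
  soon as the coordinates belong to it, and then all regular functions do.\<close>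

definition hadamard_space :: "'a rspace \<Rightarrow> ('a \<Rightarrow> 'a) \<Rightarrow> 'i set \<Rightarrow> ('i \<Rightarrow> 'a \<Rightarrow> real) \<Rightarrow> 'a rspace" where
  "hadamard_space X z T y = \<lparr> rtop = rtop X, reg = (\<lambda>V. {f \<in> reg X V. \<forall>q\<in>V. z q = q \<longrightarrow>
     (\<exists>W a. openin (rtop X) W \<and> q \<in> W \<and> W \<subseteq> V \<and> z ` W \<subseteq> V \<and> (\<forall>e\<in>T. a e \<in> reg X W) \<and>
        (\<forall>x\<in>W. f x - f (z x) = (\<Sum>e\<in>T. a e x * y e x)))}) \<rparr>"

lemma rtop_hadamard_space [simp]: "rtop (hadamard_space X z T y) = rtop X"
  by (simp add: hadamard_space_def)

lemma reg_hadamard_space: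
  "f \<in> reg (hadamard_space X z T y) V \<longleftrightarrow> f \<in> reg X V \<and> (\<forall>q\<in>V. z q = q \<longrightarrow>
     (\<exists>W a. openin (rtop X) W \<and> q \<in> W \<and> W \<subseteq> V \<and> z ` W \<subseteq> V \<and> (\<forall>e\<in>T. a e \<in> reg X W) \<and>
        (\<forall>x\<in>W. f x - f (z x) = (\<Sum>e\<in>T. a e x * y e x))))"
  by (simp add: hadamard_space_def)

lemma reg_hadamard_spaceE:
  assumes "f \<in> reg (hadamard_space X z T y) V" "q \<in> V" "z q = q"
  obtains W a where "openin (rtop X) W" "q \<in> W" "W \<subseteq> V" "z ` W \<subseteq> V" "\<forall>e\<in>T. a e \<in> reg X W"
    "\<forall>x\<in>W. f x - f (z x) = (\<Sum>e\<in>T. a e x * y e x)"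
proof -
  from assms(1)[unfolded reg_hadamard_space, THEN conjunct2, rule_format, OF assms(2,3)]
  obtain W a where "openin (rtop X) W \<and> q \<in> W \<and> W \<subseteq> V \<and> z ` W \<subseteq> V \<and> (\<forall>e\<in>T. a e \<in> reg X W) \<and>
    (\<forall>x\<in>W. f x - f (z x) = (\<Sum>e\<in>T. a e x * y e x))"
    by (elim exE)
  then show thesis by (intro that[of W a]) simp_all
qed

text \<open>The difference of \<open>f\<close> and its pullback along \<open>z\<close> is additive
  and obeys a product and a quotient rule with regular coefficients. The division is asked for at
  fixed points of \<open>z\<close> only, since just these have neighbourhoods inside any given
  \<open>V\<close> that \<open>z\<close> maps back into \<open>V\<close>.\<close>

lemma fspace_hadamard_space:
  assumes X: "fspace X" and z: "morphism X X z"
  shows "fspace (hadamard_space X z T y)"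
proof
  let ?H = "hadamard_space X z T y"
  have pre: "openin (rtop X) {x \<in> pts X. z x \<in> V}" if "openin (rtop X) V" for V
    by (rule morphism_open[OF z that])
  have preg: "(\<lambda>x. f (z x)) \<in> reg X W"
    if "f \<in> reg X V" "openin (rtop X) W" "z ` W \<subseteq> V" for f V W
  proof -
    have "openin (rtop X) V" using fspace.reg_open[OF X that(1)] .
    from morphism_reg[OF z that(1) this] show ?thesis
      by (rule fspace.reg_subset[OF X _ that(2)]) (use that openin_subset in blast)
  qed
  fix U and f :: "'a \<Rightarrow> real"
  show "openin (rtop ?H) U" "continuous_map (subtopology (rtop ?H) U) euclideanreal f" if "f \<in> reg ?H U"
    using that fspace.reg_open[OF X] fspace.reg_continuous[OF X] by (auto simp: reg_hadamard_space)
  show "f \<in> reg ?H V" if f: "f \<in> reg ?H U" and V: "openin (rtop ?H) V" "V \<subseteq> U" for V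
    unfolding reg_hadamard_space
  proof (intro conjI ballI impI)
    have VX: "openin (rtop X) V" using V by simp
    show "f \<in> reg X V" using f fspace.reg_subset[OF X _ VX V(2)] by (auto simp: reg_hadamard_space)
    fix q assume q: "q \<in> V" "z q = q"
    obtain W a where W: "openin (rtop X) W" "q \<in> W" "W \<subseteq> U" "z ` W \<subseteq> U" "\<forall>e\<in>T. a e \<in> reg X W"
      "\<forall>x\<in>W. f x - f (z x) = (\<Sum>e\<in>T. a e x * y e x)"
      by (rule reg_hadamard_spaceE[OF f subsetD[OF V(2) q(1)] q(2)])
    \<comment> \<open>Shrunk so that \<open>z\<close> maps it into \<open>V\<close>; it still
      contains \<open>q\<close> because \<open>z\<close> fixes \<open>q\<close>.\<close>
    let ?W = "W \<inter> V \<inter> {x \<in> pts X. z x \<in> V}"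
    have oW: "openin (rtop X) ?W" by (intro openin_Int W(1) VX pre)
    have "\<forall>e\<in>T. a e \<in> reg X ?W" using W(5) fspace.reg_subset[OF X _ oW] by blast
    moreover have "q \<in> ?W" using q W openin_subset[OF VX] by auto
    ultimately show "\<exists>W a. openin (rtop X) W \<and> q \<in> W \<and> W \<subseteq> V \<and> z ` W \<subseteq> V \<and> (\<forall>e\<in>T. a e \<in> reg X W) \<and>
        (\<forall>x\<in>W. f x - f (z x) = (\<Sum>e\<in>T. a e x * y e x))"
      using oW W(6) by (intro exI[of _ ?W] exI[of _ a] conjI) auto
  qed
  show "f \<in> reg ?H U" if U: "openin (rtop ?H) U"
    and loc: "\<And>p. p \<in> U \<Longrightarrow> \<exists>V h. p \<in> V \<and> V \<subseteq> U \<and> h \<in> reg ?H V \<and> (\<forall>x\<in>V. f x = h x)"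
    unfolding reg_hadamard_space
  proof (intro conjI ballI impI)
    show "f \<in> reg X U"
      by (rule fspace.reg_local[OF X]) (use U loc in \<open>simp, meson reg_hadamard_space\<close>)
    fix q assume q: "q \<in> U" "z q = q"
    then obtain V h where V: "q \<in> V" "V \<subseteq> U" "h \<in> reg ?H V" "\<forall>x\<in>V. f x = h x" using loc by meson
    obtain W a where W: "openin (rtop X) W" "q \<in> W" "W \<subseteq> V" "z ` W \<subseteq> V" "\<forall>e\<in>T. a e \<in> reg X W"
      "\<forall>x\<in>W. h x - h (z x) = (\<Sum>e\<in>T. a e x * y e x)"
      by (rule reg_hadamard_spaceE[OF V(3,1) q(2)])
    have "f x - f (z x) = (\<Sum>e\<in>T. a e x * y e x)" if "x \<in> W" for x
      using W(3,4,6) V(4) that by (metis image_subset_iff subsetD)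
    then show "\<exists>W a. openin (rtop X) W \<and> q \<in> W \<and> W \<subseteq> U \<and> z ` W \<subseteq> U \<and> (\<forall>e\<in>T. a e \<in> reg X W) \<and>
        (\<forall>x\<in>W. f x - f (z x) = (\<Sum>e\<in>T. a e x * y e x))"
      using W V(2) by (intro exI[of _ W] exI[of _ a] conjI) auto
  qed
  show "(\<lambda>_. c) \<in> reg ?H U" if U: "openin (rtop ?H) U" for c
    unfolding reg_hadamard_space
  proof (intro conjI ballI impI)
    have UX: "openin (rtop X) U" using U by simp
    show "(\<lambda>_. c) \<in> reg X U" by (rule fspace.reg_const[OF X UX])
    fix q assume q: "q \<in> U" "z q = q"
    let ?W = "U \<inter> {x \<in> pts X. z x \<in> U}"
    have oW: "openin (rtop X) ?W" by (intro openin_Int UX pre)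
    have "q \<in> ?W" using q openin_subset[OF UX] by auto
    then show "\<exists>W a. openin (rtop X) W \<and> q \<in> W \<and> W \<subseteq> U \<and> z ` W \<subseteq> U \<and> (\<forall>e\<in>T. a e \<in> reg X W) \<and>
        (\<forall>x\<in>W. c - c = (\<Sum>e\<in>T. a e x * y e x))"
      using oW fspace.reg_const[OF X oW] by (intro exI[of _ ?W] exI[of _ "\<lambda>_ _. 0"] conjI) auto
  qed
  {
    fix g assume f: "f \<in> reg ?H U" and g: "g \<in> reg ?H U"
    have fg: "f \<in> reg X U" "g \<in> reg X U" using f g by (auto simp: reg_hadamard_space)
    have *: "(\<exists>W a. openin (rtop X) W \<and> q \<in> W \<and> W \<subseteq> U \<and> z ` W \<subseteq> U \<and> (\<forall>e\<in>T. a e \<in> reg X W) \<and>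
        (\<forall>x\<in>W. (f x + g x) - (f (z x) + g (z x)) = (\<Sum>e\<in>T. a e x * y e x))) \<and>
      (\<exists>W a. openin (rtop X) W \<and> q \<in> W \<and> W \<subseteq> U \<and> z ` W \<subseteq> U \<and> (\<forall>e\<in>T. a e \<in> reg X W) \<and>
        (\<forall>x\<in>W. f x * g x - f (z x) * g (z x) = (\<Sum>e\<in>T. a e x * y e x)))"
      if q: "q \<in> U" "z q = q" for q
    proof -
      obtain W a where W: "openin (rtop X) W" "q \<in> W" "W \<subseteq> U" "z ` W \<subseteq> U" "\<forall>e\<in>T. a e \<in> reg X W"
        "\<forall>x\<in>W. f x - f (z x) = (\<Sum>e\<in>T. a e x * y e x)"
        by (rule reg_hadamard_spaceE[OF f q])
      obtain W' a' where W': "openin (rtop X) W'" "q \<in> W'" "W' \<subseteq> U" "z ` W' \<subseteq> U" "\<forall>e\<in>T. a' e \<in> reg X W'"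
        "\<forall>x\<in>W'. g x - g (z x) = (\<Sum>e\<in>T. a' e x * y e x)"
        by (rule reg_hadamard_spaceE[OF g q])
      let ?W = "W \<inter> W'"
      have oW: "openin (rtop X) ?W" using W(1) W'(1) by (rule openin_Int)
      have zW: "z ` ?W \<subseteq> U" using W(4) by blast
      have a: "a e \<in> reg X ?W" "a' e \<in> reg X ?W" if "e \<in> T" for e
        using W(5) W'(5) that fspace.reg_subset[OF X _ oW] by blast+
      have gW: "g \<in> reg X ?W" by (rule fspace.reg_subset[OF X fg(2) oW]) (use W in blast)
      have fz: "(\<lambda>x. f (z x)) \<in> reg X ?W" by (rule preg[OF fg(1) oW zW])
      have "f x + g x - (f (z x) + g (z x)) = (\<Sum>e\<in>T. (a e x + a' e x) * y e x)" if "x \<in> ?W" for x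
        using W(6) W'(6) that by (simp add: distrib_right sum.distrib)
           (metis (no_types, lifting) add_diff_add)
      then have 1: "\<forall>x\<in>?W. f x + g x - (f (z x) + g (z x)) = (\<Sum>e\<in>T. (a e x + a' e x) * y e x)" by blast
      have "f x * g x - f (z x) * g (z x) = (\<Sum>e\<in>T. (a e x * g x + f (z x) * a' e x) * y e x)" if "x \<in> ?W" for x
      proof -
        \<comment> \<open>The Leibniz rule: first \<open>f\<close> is moved along \<open>z\<close>,
          then \<open>g\<close>.\<close>
        have "f x * g x - f (z x) * g (z x) = (f x - f (z x)) * g x + f (z x) * (g x - g (z x))"
          by (simp add: algebra_simps)
        also have "\<dots> = (\<Sum>e\<in>T. a e x * y e x) * g x + f (z x) * (\<Sum>e\<in>T. a' e x * y e x)"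
          using W(6) W'(6) that by simp
        also have "\<dots> = (\<Sum>e\<in>T. (a e x * g x + f (z x) * a' e x) * y e x)"
          unfolding sum_distrib_left sum_distrib_right sum.distrib[symmetric]
          by (rule sum.cong) (simp_all add: algebra_simps)
        finally show ?thesis .
      qed
      then have 2: "\<forall>x\<in>?W. f x * g x - f (z x) * g (z x) = (\<Sum>e\<in>T. (a e x * g x + f (z x) * a' e x) * y e x)"
        by blast
      have s1: "\<forall>e\<in>T. (\<lambda>x. a e x + a' e x) \<in> reg X ?W"
        by (intro ballI fspace.reg_add[OF X] a)
      have s2: "\<forall>e\<in>T. (\<lambda>x. a e x * g x + f (z x) * a' e x) \<in> reg X ?W"
        by (intro ballI fspace.reg_add[OF X] fspace.reg_mult[OF X a(1) gW] fspace.reg_mult[OF X fz a(2)])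
      have q': "q \<in> ?W" "?W \<subseteq> U" using W(2,3) W'(2) by auto
      show ?thesis
      proof (rule conjI)
        show "\<exists>W a. openin (rtop X) W \<and> q \<in> W \<and> W \<subseteq> U \<and> z ` W \<subseteq> U \<and> (\<forall>e\<in>T. a e \<in> reg X W) \<and>
            (\<forall>x\<in>W. (f x + g x) - (f (z x) + g (z x)) = (\<Sum>e\<in>T. a e x * y e x))"
          by (rule exI[of _ ?W], rule exI[of _ "\<lambda>e x. a e x + a' e x"]) (intro conjI oW zW q' s1 1)
        show "\<exists>W a. openin (rtop X) W \<and> q \<in> W \<and> W \<subseteq> U \<and> z ` W \<subseteq> U \<and> (\<forall>e\<in>T. a e \<in> reg X W) \<and>
            (\<forall>x\<in>W. f x * g x - f (z x) * g (z x) = (\<Sum>e\<in>T. a e x * y e x))"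
          by (rule exI[of _ ?W], rule exI[of _ "\<lambda>e x. a e x * g x + f (z x) * a' e x"]) (intro conjI oW
              zW q' s2 2)
      qed
    qed
    show "(\<lambda>x. f x + g x) \<in> reg ?H U" "(\<lambda>x. f x * g x) \<in> reg ?H U"
      unfolding reg_hadamard_space
      by (intro conjI ballI impI fspace.reg_add[OF X fg] *[THEN conjunct1]; assumption)
        (intro conjI ballI impI fspace.reg_mult[OF X fg] *[THEN conjunct2]; assumption)
  }
  show "(\<lambda>x. inverse (f x)) \<in> reg ?H U" if f: "f \<in> reg ?H U" and nz: "\<forall>x\<in>U. f x \<noteq> 0"
    unfolding reg_hadamard_space
  proof (intro conjI ballI impI)
    have fX: "f \<in> reg X U" using f by (simp add: reg_hadamard_space)
    show "(\<lambda>x. inverse (f x)) \<in> reg X U" by (rule fspace.reg_inverse[OF X fX nz])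
    fix q assume q: "q \<in> U" "z q = q"
    obtain W a where W: "openin (rtop X) W" "q \<in> W" "W \<subseteq> U" "z ` W \<subseteq> U" "\<forall>e\<in>T. a e \<in> reg X W"
      "\<forall>x\<in>W. f x - f (z x) = (\<Sum>e\<in>T. a e x * y e x)"
      by (rule reg_hadamard_spaceE[OF f q])
    have nzW: "f x \<noteq> 0 \<and> f (z x) \<noteq> 0" if "x \<in> W" for x using nz W(3,4) that by blast
    have fW: "f \<in> reg X W" by (rule fspace.reg_subset[OF X fX W(1,3)])
    have fz: "(\<lambda>x. f (z x)) \<in> reg X W" by (rule preg[OF fX W(1,4)])
    let ?a = "\<lambda>e x. (- 1) * a e x / (f x * f (z x))"
    have "?a e \<in> reg X W" if "e \<in> T" for e
      by (intro fspace.reg_divide[OF X] fspace.reg_mult[OF X] fspace.reg_const[OF X W(1)] fW fz)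
        (use W(5) that nzW in auto)
    moreover have "inverse (f x) - inverse (f (z x)) = (\<Sum>e\<in>T. ?a e x * y e x)" if "x \<in> W" for x
    proof -
      have "inverse (f x) - inverse (f (z x)) = - (f x - f (z x)) / (f x * f (z x))"
        using nzW[OF that] by (simp add: field_simps)
      also have "\<dots> = - (\<Sum>e\<in>T. a e x * y e x) / (f x * f (z x))" using W(6) that by simp
      also have "\<dots> = (\<Sum>e\<in>T. ?a e x * y e x)"
        by (simp add: sum_divide_distrib sum_negf[symmetric] del: sum_negf)
      finally show ?thesis .
    qed
    ultimately show "\<exists>W a. openin (rtop X) W \<and> q \<in> W \<and> W \<subseteq> U \<and> z ` W \<subseteq> U \<and> (\<forall>e\<in>T. a e \<in> reg X W) \<and>
        (\<forall>x\<in>W. inverse (f x) - inverse (f (z x)) = (\<Sum>e\<in>T. a e x * y e x))"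
      using W by (intro exI[of _ W] exI[of _ ?a] conjI) blast+
  qed
qed

section \<open>Adding a member is a blow-up\<close>

text \<open>Vanishing of \<open>x E\<close> alone on \<delta> would describe the full preimage of
  the face: it holds automatically once \<open>x E\<close> vanishes on some larger member. Asking it
  at every \<eta> containing \<delta> singles out the strict transform.\<close>

definition center :: "'e set set \<Rightarrow> 'e set \<Rightarrow> ('e set \<Rightarrow> 'e \<Rightarrow> real) set" where
  "center I \<delta> = {x \<in> model_points I. \<forall>\<eta>\<in>I. \<delta> \<subseteq> \<eta> \<longrightarrow> (\<forall>e\<in>\<delta>. x \<eta> e = 0)}"

lemma closedin_center: "closedin (rtop (model I)) (center I \<delta>)"
proof -
  let ?K = "{(\<eta>, e). \<eta> \<in> I \<and> \<delta> \<subseteq> \<eta> \<and> e \<in> \<delta>}"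
  have "openin (rtop (model I)) {x \<in> model_points I. x \<eta> e \<noteq> 0}" if "(\<eta>, e) \<in> ?K" for \<eta> e
    using fspace.reg_nonzero_open[OF fspace_model model_coordinate[of \<eta> I e]] that by blast
  then have "openin (rtop (model I)) (\<Union>(\<eta>, e)\<in>?K. {x \<in> model_points I. x \<eta> e \<noteq> 0})"
    by (intro openin_Union) auto
  moreover have "(\<Union>(\<eta>, e)\<in>?K. {x \<in> model_points I. x \<eta> e \<noteq> 0}) = model_points I - center I \<delta>"
    unfolding center_def by auto
  ultimately show ?thesis unfolding closedin_def pts_model by (auto simp: center_def)
qed

lemma morphism_model_restrict:
  assumes "I \<subseteq> J" shows "morphism (model J) (model I) (\<lambda>x. restrict x I)"
proof (rule morphism_modelI[OF fspace_model])
  show "restrict z I \<in> model_points I" if "z \<in> pts (model J)" for z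
    using that assms unfolding pts_model model_points_def by (auto simp: subset_iff)
  show "(\<lambda>z. restrict z I \<gamma> e) \<in> reg (model J) (pts (model J))" if "\<gamma> \<in> I" "e \<in> \<gamma>" for \<gamma> e
    using model_coordinate[of \<gamma> J e] that assms by auto
qed

text \<open>\<open>new_union\<close> keeps the enlarged family closed under unions without further
  additions. \<open>new_minimal\<close> records that only subgraphs not contained in \<gamma> have
  been treated; it also makes \<gamma> minimal in the enlarged family.\<close>

locale new_member = union_family E I for E :: "'e set" and I +
  fixes \<gamma> :: "'e set"
  assumes new_sub: "\<gamma> \<subseteq> E" and new_nonempty: "\<gamma> \<noteq> {}"
    and new_union: "\<And>\<eta>. \<eta> \<in> I \<Longrightarrow> \<eta> \<union> \<gamma> \<in> I" and new_minimal: "\<And>\<eta>. \<eta> \<in> I \<Longrightarrow> \<not> \<eta> \<subseteq> \<gamma>"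
begin

lemma new_notin: "\<gamma> \<notin> I"
  using new_minimal by blast

lemma finite_new: "finite \<gamma>"
  using new_sub finite_E finite_subset by blast

lemma union_family_insert: "union_family E (insert \<gamma> I)"
proof
  show "\<alpha> \<union> \<beta> \<in> insert \<gamma> I" if "\<alpha> \<in> insert \<gamma> I" "\<beta> \<in> insert \<gamma> I" for \<alpha> \<beta>
    using that union_closed new_union by (auto simp: Un_commute)
qed (use finite_E E_in members new_sub new_nonempty in auto)

end

section \<open>The ideal of the center in a chart\<close>

locale new_member_chart = new_member E I \<gamma> + family_chart E I C b for E :: "'e set" and I \<gamma> C b
begin

abbreviation level :: "'e set" where "level \<equiv> lev \<gamma>"

text \<open>The facts about \<open>lev\<close> were stated for members of \<open>I\<close>; the same
  argument applies to the new \<gamma>, as it lies in \<open>E\<close>.\<close>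

lemma level: "level \<in> C" "\<gamma> \<subseteq> level" "\<delta> \<in> C \<Longrightarrow> \<gamma> \<subseteq> \<delta> \<Longrightarrow> level \<subseteq> \<delta>" "level \<in> I"
proof -
  have "\<Inter>{\<delta> \<in> C. \<gamma> \<subseteq> \<delta>} \<in> {\<delta> \<in> C. \<gamma> \<subseteq> \<delta>}"
    by (rule chain_Inter_in) (use finite_C E_C new_sub chain in auto)
  then show "level \<in> C" "\<gamma> \<subseteq> level" unfolding lev_def by auto
  then show "level \<in> I" by (rule_tac C_in(1))
  show "\<delta> \<in> C \<Longrightarrow> \<gamma> \<subseteq> \<delta> \<Longrightarrow> level \<subseteq> \<delta>" unfolding lev_def by blast
qed

text \<open>Both metrics are compared at \<open>lev \<eta>\<close>, where \<eta> has nonzero volume;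
  hence the coordinates of \<gamma> at its level alone decide about the center. The factor
  \<open>c\<close> may be 0.\<close>

lemma proportional_to_level:
  assumes x: "x \<in> chart_dom" and \<eta>: "\<eta> \<in> I" "\<gamma> \<subseteq> \<eta>"
  obtains c where "\<And>e. e \<in> \<gamma> \<Longrightarrow> x \<eta> e = c * x level e"
proof -
  have xm: "x \<in> model_points I" using chart_domD(1)[OF x] .
  let ?l = "lev \<eta>"
  have l: "?l \<in> C" "\<eta> \<subseteq> ?l" "?l \<in> I" using lev[OF \<eta>(1)] C_in by auto
  have tl: "level \<subseteq> ?l" using level(3)[OF l(1)] l(2) \<eta>(2) by blast
  have "x \<eta> e = (sum (x ?l) level / sum (x ?l) \<eta>) * x level e" if "e \<in> \<gamma>" for e
  proof -
    have "x ?l e = sum (x ?l) level * x level e"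
      by (rule model_pointsD(4)[OF xm level(4) l(3) tl]) (use level(2) that in blast)
    moreover have "x ?l e = sum (x ?l) \<eta> * x \<eta> e"
      by (rule model_pointsD(4)[OF xm \<eta>(1) l(3,2)]) (use \<eta>(2) that in blast)
    ultimately show ?thesis using chart_domD(3)[OF x \<eta>(1)] by (simp add: field_simps)
  qed
  then show thesis using that by blast
qed

lemma center_chart:
  assumes x: "x \<in> chart_dom" shows "x \<in> center I \<gamma> \<longleftrightarrow> (\<forall>e\<in>\<gamma>. x level e = 0)"
proof
  show "\<forall>e\<in>\<gamma>. x level e = 0" if "x \<in> center I \<gamma>" using that level unfolding center_def by blast
  assume z: "\<forall>e\<in>\<gamma>. x level e = 0"
  have "x \<eta> e = 0" if \<eta>: "\<eta> \<in> I" "\<gamma> \<subseteq> \<eta>" and e: "e \<in> \<gamma>" for \<eta> e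
  proof -
    obtain c where "\<And>e. e \<in> \<gamma> \<Longrightarrow> x \<eta> e = c * x level e" using proportional_to_level[OF x \<eta>] by metis
    then show ?thesis using z e by simp
  qed
  then show "x \<in> center I \<gamma>" using chart_domD(1)[OF x] unfolding center_def by blast
qed

lemma chart_coordinate: "\<eta> \<in> I \<Longrightarrow> e \<in> \<eta> \<Longrightarrow> openin (rtop (model I)) V \<Longrightarrow> V \<subseteq> chart_dom \<Longrightarrow> (\<lambda>x. x \<eta> e) \<in> reg
    (model I) V"
  by (rule fspace.reg_subset[OF fspace_model model_coordinate]) (auto simp: chart_dom_def)

text \<open>The ideal condition of \<open>generates_ideal\<close>, with generators indexed by the
  edges of \<gamma> instead of numbers and confined to a chart.\<close>

definition ideal_on :: "('e set \<Rightarrow> 'e \<Rightarrow> real) set \<Rightarrow> bool" where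
  "ideal_on U \<longleftrightarrow> openin (rtop (model I)) U \<and> U \<subseteq> chart_dom \<and>
     (\<forall>V g q. openin (rtop (model I)) V \<and> V \<subseteq> U \<and> g \<in> reg (model I) V \<and> (\<forall>x\<in>V \<inter> center I \<gamma>. g x = 0) \<and> q \<in> V \<longrightarrow>
        (\<exists>W a. openin (rtop (model I)) W \<and> q \<in> W \<and> W \<subseteq> V \<and> (\<forall>e\<in>\<gamma>. a e \<in> reg (model I) W) \<and>
           (\<forall>x\<in>W. g x = (\<Sum>e\<in>\<gamma>. a e x * x level e))))"

text \<open>Off the center one of the coordinates is invertible near \<open>q\<close>, so the ideal
  contains every regular function.\<close>

lemma ideal_off_center:
  assumes V: "openin (rtop (model I)) V" "V \<subseteq> chart_dom" and g: "g \<in> reg (model I) V" and q: "q \<in> V" "q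
      \<notin> center I \<gamma>"
  shows "\<exists>W a. openin (rtop (model I)) W \<and> q \<in> W \<and> W \<subseteq> V \<and> (\<forall>e\<in>\<gamma>. a e \<in> reg (model I) W) \<and>
    (\<forall>x\<in>W. g x = (\<Sum>e\<in>\<gamma>. a e x * x level e))"
proof -
  note M = fspace_model[of I]
  obtain e0 where e0: "e0 \<in> \<gamma>" "q level e0 \<noteq> 0" using center_chart[of q] q V(2) by blast
  have c: "(\<lambda>x. x level e0) \<in> reg (model I) V"
    by (rule chart_coordinate[OF level(4) _ V]) (use e0 level in blast)
  let ?W = "{x \<in> V. x level e0 \<noteq> 0}"
  have W: "openin (rtop (model I)) ?W" by (rule fspace.reg_nonzero_open[OF M c])
  have r: "(\<lambda>x. g x / x level e0) \<in> reg (model I) ?W"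
    by (rule fspace.reg_divide[OF M fspace.reg_subset[OF M g W] fspace.reg_subset[OF M c W]]) auto
  let ?a = "\<lambda>e x. if e = e0 then g x / x level e0 else 0"
  have "?a e \<in> reg (model I) ?W" for e
    by (cases "e = e0") (simp_all add: r fspace.reg_const[OF M W])
  moreover have "g x = (\<Sum>e\<in>\<gamma>. ?a e x * x level e)" if "x \<in> ?W" for x
    using that e0(1) finite_new by (simp add: if_distrib[of "\<lambda>c. c * _"] cong: if_cong)
  ultimately show ?thesis
    using W q(1) e0(2) by (intro exI[of _ ?W] exI[of _ ?a] conjI) auto
qed

lemma ideal_regular:
  assumes p: "p \<in> chart_dom" "\<exists>e\<in>\<gamma>. p level e \<noteq> 0"
  shows "\<exists>U. p \<in> U \<and> ideal_on U"
proof -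
  let ?U = "chart_dom - center I \<gamma>"
  have U: "openin (rtop (model I)) ?U" using openin_chart_dom closedin_center by (rule openin_diff)
  have "ideal_on ?U"
    unfolding ideal_on_def
  proof (intro conjI allI impI U)
    fix V g q
    assume *: "openin (rtop (model I)) V \<and> V \<subseteq> ?U \<and> g \<in> reg (model I) V \<and> (\<forall>x\<in>V \<inter> center I \<gamma>. g x = 0) \<and> q \<in> V"
    then have "V \<subseteq> chart_dom" "q \<notin> center I \<gamma>" by blast+
    with * show "\<exists>W a. openin (rtop (model I)) W \<and> q \<in> W \<and> W \<subseteq> V \<and> (\<forall>e\<in>\<gamma>. a e \<in> reg (model I) W) \<and>
        (\<forall>x\<in>W. g x = (\<Sum>e\<in>\<gamma>. a e x * x level e))"
      by (intro ideal_off_center) simp_all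
  qed blast
  moreover have "p \<in> ?U" using p center_chart[OF p(1)] by blast
  ultimately show ?thesis by blast
qed

text \<open>At a point of the center the chain cannot continue below the level: for \<delta> in it,
  \<open>\<delta> \<union> \<gamma>\<close> would be a member with the same level on which
  \<open>p level\<close> vanishes, against the choice of chart. Hence all edges of \<gamma> have the
  level as base, and their parameters are the coordinates of \<gamma> up to a unit.\<close>

lemma minimal_level:
  assumes p: "p \<in> chart_dom" "\<forall>\<delta>\<in>C. \<forall>\<delta>'\<in>C. \<delta>' \<subset> \<delta> \<longrightarrow> (\<forall>e\<in>\<delta>'. p \<delta> e = 0)" "\<forall>e\<in>\<gamma>. p level e = 0"
  shows "\<delta> \<in> C \<Longrightarrow> level \<subseteq> \<delta>" "e \<in> \<gamma> \<Longrightarrow> e \<in> params \<and> base e = level" "\<delta> \<in> C \<Longrightarrow> b \<delta> \<notin> \<gamma>"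
proof -
  show min: "level \<subseteq> \<delta>" if \<delta>: "\<delta> \<in> C" for \<delta>
  proof (rule ccontr)
    assume "\<not> level \<subseteq> \<delta>"
    then have sub: "\<delta> \<subset> level" using chain[OF \<delta> level(1)] by blast
    have u: "\<delta> \<union> \<gamma> \<in> I" using new_union[OF C_in(1)[OF \<delta>]] .
    \<comment> \<open>It lies inside the level because both parts do, and a chain member containing
      the union contains \<gamma>.\<close>
    have "lev (\<delta> \<union> \<gamma>) = level"
    proof
      show "lev (\<delta> \<union> \<gamma>) \<subseteq> level" by (rule lev(3)[OF u level(1)]) (use sub level(2) in blast)
      show "level \<subseteq> lev (\<delta> \<union> \<gamma>)" by (rule level(3)[OF lev(1)[OF u]]) (use lev(2)[OF u] in blast)
    qed
    moreover have "p level e = 0" if "e \<in> \<delta> \<union> \<gamma>" for e using p(2,3) \<delta> level(1) sub that by blast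
    then have "sum (p level) (\<delta> \<union> \<gamma>) = 0" by (simp add: sum.neutral)
    ultimately show False using chart_domD(3)[OF p(1) u] by simp
  qed
  have nb: "b level \<notin> \<gamma>" using chart_domD(2)[OF p(1) level(1)] p(3) by blast
  show "e \<in> params \<and> base e = level" if e: "e \<in> \<gamma>"
  proof -
    have et: "e \<in> level" "e \<noteq> b level" using e level(2) nb by auto
    have ep: "e \<in> params" by (rule in_params[OF level(1) et])
    then show ?thesis using base(4)[OF ep level(1) et] min[OF base(1)[OF ep]] by blast
  qed
  show "b \<delta> \<notin> \<gamma>" if "\<delta> \<in> C"
    using min[OF that] b_notin[OF that level(1)] nb level(2) by (cases "\<delta> = level") auto
qed

text \<open>In the parameters the center is the coordinate subspace where those of \<gamma> vanish,
  and setting them to 0 is a retraction \<open>z\<close> onto it. If \<open>g\<close> vanishes on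
  the center, then \<open>g (z x)\<close> is 0, and Hadamard's lemma writes \<open>g\<close> as a
  combination of these parameters.\<close>

lemma ideal_center:
  assumes p: "p \<in> chart_dom" "\<forall>\<delta>\<in>C. \<forall>\<delta>'\<in>C. \<delta>' \<subset> \<delta> \<longrightarrow> (\<forall>e\<in>\<delta>'. p \<delta> e = 0)" "\<forall>e\<in>\<gamma>. p level e = 0"
  shows "\<exists>U. p \<in> U \<and> ideal_on U"
proof -
  note M = fspace_model[of I] and O = fspace_orthant_on[of params] and mt = minimal_level[OF p]
  have cg: "coords x e = x level e / x level (b level)" if "e \<in> \<gamma>" for x e using mt(2)[OF that]
    by (simp add: coords_def)
  have xg: "x level e = x level (b level) * coords x e" if "e \<in> \<gamma>" "x \<in> chart_dom" for x e
    using cg[OF that(1)] chart_domD(2)[OF that(2) level(1)] by simp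
  define z0 where "z0 y = (\<lambda>e\<in>params. if e \<in> \<gamma> then 0 else y e :: real)" for y
  have z0_id: "z0 y = y" if "y \<in> extensional params" "\<And>e. e \<in> \<gamma> \<Longrightarrow> y e = 0" for y
    by (rule extensionalityI[of _ params]) (use that in \<open>simp_all add: z0_def\<close>)
  have ce: "coords x \<in> extensional params" for x by (simp add: coords_def)
  have z0m: "morphism (orthant_on params) (orthant_on params) z0"
  proof (rule morphism_orthantI[OF O])
    show "z0 y \<in> pts (orthant_on params)" if "y \<in> pts (orthant_on params)" for y using that
      by (auto simp: z0_def)
    fix e assume e: "e \<in> params"
    show "(\<lambda>y. z0 y e) \<in> reg (orthant_on params) (pts (orthant_on params))"
    proof (cases "e \<in> \<gamma>")
      case True
      then have "(\<lambda>y. z0 y e) = (\<lambda>_. 0)" using e by (simp add: z0_def)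
      then show ?thesis by (simp only: fspace.reg_const[OF O openin_topspace])
    next
      case False
      then have "(\<lambda>y. z0 y e) = (\<lambda>y. y e)" using e by (simp add: z0_def)
      then show ?thesis by (simp only: orthant_coordinate[OF e])
    qed
  qed
  have cm: "morphism chart_source (orthant_on params) coords"
    by (rule morphism_sub_space_cod[OF O inverse_morphismsD(1)[OF chart_iso]])
  have zcm: "morphism chart_source (orthant_on params) (\<lambda>x. z0 (coords x))"
    by (rule morphism_compose[OF cm z0m])
  \<comment> \<open>The retraction is defined in the orthant and might leave the image of the chart,
    whence the smaller domain.\<close>
  define U where "U = {x \<in> pts chart_source. z0 (coords x) \<in> chart_img}"
  have "openin (rtop chart_source) U" unfolding U_def by (rule morphism_open[OF zcm openin_chart_img])
  then have U: "openin (rtop (model I)) U" "U \<subseteq> chart_dom"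
    using openin_chart_dom by (simp_all add: openin_open_subtopology)
  have Ui: "x \<in> U \<longleftrightarrow> x \<in> chart_dom \<and> z0 (coords x) \<in> chart_img" for x unfolding U_def pts_chart_source by blast
  define z where "z x = chart_par (z0 (coords x))" for x
  have z: "z x \<in> chart_dom" "coords (z x) = z0 (coords x)" "z x \<in> U" if "x \<in> U" for x
  proof -
    show *: "z x \<in> chart_dom" "coords (z x) = z0 (coords x)"
      unfolding z_def using chart_par_in coords_chart_par that Ui by blast+
    have "z0 (z0 (coords x)) = z0 (coords x)" by (rule extensionalityI[of _ params]) (simp_all add: z0_def)
    then show "z x \<in> U" using * that by (simp add: Ui)
  qed
  have zcenter: "z x \<in> center I \<gamma>" if "x \<in> U" for x
    using center_chart[OF z(1)[OF that]] xg[OF _ z(1)[OF that]] z(2)[OF that] mt(2) by (simp add: z0_def)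
  have fixed: "z x = x" if "x \<in> U" "x \<in> center I \<gamma>" for x
  proof -
    have xd: "x \<in> chart_dom" using that U by blast
    have "coords x e = 0" if "e \<in> \<gamma>" for e using cg[OF that] center_chart[OF xd] \<open>x \<in> center I \<gamma>\<close> that by simp
    then have "z0 (coords x) = coords x" by (rule z0_id[OF ce])
    then show ?thesis unfolding z_def using chart_par_coords[OF xd] by simp
  qed
  let ?X = "sub_space (model I) U"
  have X: "fspace ?X" by simp
  have ptsX: "pts ?X = U" using openin_subset[OF U(1)] by auto
  \<comment> \<open>Maps to the model are built from their parameters; this is applied to the
    retraction on \<open>?X\<close> and to the identity on \<open>H\<close>.\<close>
  have into: "morphism Y (model I) (\<lambda>x. chart_par (\<phi> x))"
    if "fspace Y" "morphism Y (orthant_on params) \<phi>" "\<And>x. x \<in> pts Y \<Longrightarrow> \<phi> x \<in> chart_img" for Y :: "('e set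
        \<Rightarrow> 'e \<Rightarrow> real) rspace" and \<phi>
    by (rule morphism_sub_space_cod[OF M morphism_compose[OF morphism_sub_spaceI[OF that]
        inverse_morphismsD(2)[OF chart_iso]]])
  have cmX: "morphism ?X (orthant_on params) coords"
    by (rule morphism_sub_space_dom_mono[OF M cm]) (use U in blast)
  have "morphism ?X (model I) z"
    unfolding z_def by (rule into[OF X morphism_compose[OF cmX z0m]]) (use Ui ptsX in blast)
  then have zm: "morphism ?X ?X z" by (rule morphism_sub_spaceI[OF X]) (use z(3) ptsX in blast)
  define H where "H = hadamard_space ?X z \<gamma> (\<lambda>e x. coords x e)"
  have H: "fspace H" unfolding H_def by (rule fspace_hadamard_space[OF X zm])
  have ptsH: "pts H = U" unfolding H_def rtop_hadamard_space ptsX ..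
  have oU: "openin (rtop ?X) U" using openin_topspace[of "rtop ?X"] unfolding ptsX .
  have "morphism H (orthant_on params) coords"
  proof (rule morphism_orthantI[OF H])
    show "coords x \<in> pts (orthant_on params)" if "x \<in> pts H" for x
      using coords_in[of x] that U(2) unfolding ptsH chart_img_def by blast
    fix i assume i: "i \<in> params"
    have r: "(\<lambda>x. coords x i) \<in> reg ?X U"
      using fspace.reg_subset[OF M coords_reg[OF i] U] by (simp add: reg_sub_space_open[OF M U(1)])
    show "(\<lambda>x. coords x i) \<in> reg H (pts H)"
      unfolding ptsH unfolding H_def reg_hadamard_space
    proof (intro conjI ballI impI r)
      fix q assume q: "q \<in> U" "z q = q"
      \<comment> \<open>Kronecker coefficients: the difference is the parameter of \<open>i\<close>
        itself if \<open>i\<close> lies in \<gamma>, and 0 otherwise, in which case the sum never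
        meets \<open>i\<close>.\<close>
      let ?a = "\<lambda>e x. if e = i then 1 else 0 :: real"
      have "coords x i - coords (z x) i = (\<Sum>e\<in>\<gamma>. ?a e x * coords x e)" if "x \<in> U" for x
        using z(2)[OF that] i finite_new by (simp add: z0_def if_distrib[of "\<lambda>c. c * _"] cong: if_cong)
      then show "\<exists>W a. openin (rtop ?X) W \<and> q \<in> W \<and> W \<subseteq> U \<and> z ` W \<subseteq> U \<and> (\<forall>e\<in>\<gamma>. a e \<in> reg ?X W) \<and>
          (\<forall>x\<in>W. coords x i - coords (z x) i = (\<Sum>e\<in>\<gamma>. a e x * coords x e))"
        using q oU z(3) fspace.reg_const[OF X oU] by (intro exI[of _ U] exI[of _ ?a] conjI) auto
    qed
  qed
  then have "morphism H (model I) (\<lambda>x. chart_par (coords x))"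
    by (rule into[OF H]) (use coords_in U(2) ptsH in blast)
  \<comment> \<open>That the identity is a morphism from \<open>H\<close> says that all regular
    functions of the model have the Hadamard property, though it was verified for the parameters
    only.\<close>
  then have Hm: "morphism H (model I) (\<lambda>x. x)"
    by (rule morphism_cong[OF H]) (use chart_par_coords U(2) ptsH in \<open>metis subsetD\<close>)
  have "ideal_on U"
    unfolding ideal_on_def
  proof (intro conjI allI impI U)
    fix V g q
    assume *: "openin (rtop (model I)) V \<and> V \<subseteq> U \<and> g \<in> reg (model I) V \<and> (\<forall>x\<in>V \<inter> center I \<gamma>. g x = 0) \<and> q \<in> V"
    then have V: "openin (rtop (model I)) V" "V \<subseteq> U" "g \<in> reg (model I) V" "\<forall>x\<in>V \<inter> center I \<gamma>. g x = 0"
        "q \<in> V" by auto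
    show "\<exists>W a. openin (rtop (model I)) W \<and> q \<in> W \<and> W \<subseteq> V \<and> (\<forall>e\<in>\<gamma>. a e \<in> reg (model I) W) \<and>
        (\<forall>x\<in>W. g x = (\<Sum>e\<in>\<gamma>. a e x * x level e))"
    proof (cases "q \<in> center I \<gamma>")
      case False
      show ?thesis by (rule ideal_off_center[OF V(1) _ V(3,5) False]) (use V(2) U(2) in blast)
    next
      case True
      have "{x \<in> pts H. x \<in> V} = V" unfolding ptsH using V(2) by blast
      then have gH: "g \<in> reg (hadamard_space ?X z \<gamma> (\<lambda>e x. coords x e)) V"
        using morphism_reg[OF Hm V(3,1)] unfolding H_def by simp
      have zq: "z q = q" using fixed True V by blast
      obtain W a where W: "openin (rtop ?X) W" "q \<in> W" "W \<subseteq> V" "z ` W \<subseteq> V"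
        "\<forall>e\<in>\<gamma>. a e \<in> reg ?X W" "\<forall>x\<in>W. g x - g (z x) = (\<Sum>e\<in>\<gamma>. a e x * coords x e)"
        by (rule reg_hadamard_spaceE[OF gH V(5) zq])
      have oW: "openin (rtop (model I)) W" using W(1) U(1) by (simp add: openin_open_subtopology)
      have Wd: "W \<subseteq> chart_dom" using W V U by blast
      have aW: "a e \<in> reg (model I) W" if "e \<in> \<gamma>" for e using W(5) that reg_sub_space_open[OF M U(1)] by blast
      have bW: "(\<lambda>x. x level (b level)) \<in> reg (model I) W"
        by (rule chart_coordinate[OF level(4) b_in[OF level(1)] oW Wd])
      \<comment> \<open>Passes from the parameter of \<open>e\<close> to the coordinate
        \<open>x level e\<close>; the two differ by the unit
        \<open>x level (b level)\<close>.\<close>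
      let ?a = "\<lambda>e x. a e x / x level (b level)"
      have "\<forall>e\<in>\<gamma>. ?a e \<in> reg (model I) W"
        using chart_domD(2)[OF _ level(1)] Wd by (intro ballI fspace.reg_divide[OF M] aW bW) auto
      moreover have "g x = (\<Sum>e\<in>\<gamma>. ?a e x * x level e)" if x: "x \<in> W" for x
      proof -
        have "z x \<in> V \<inter> center I \<gamma>" using W(3,4) V(2) zcenter x by blast
        then have "g (z x) = 0" using V(4) by blast
        then have "g x = (\<Sum>e\<in>\<gamma>. a e x * coords x e)" using W(6)[rule_format, OF x] by linarith
        also have "\<dots> = (\<Sum>e\<in>\<gamma>. ?a e x * x level e)" by (rule sum.cong) (simp_all add: cg)
        finally show ?thesis .
      qed
      ultimately show ?thesis using oW W(2,3) by (intro exI[of _ W] exI[of _ ?a] conjI) auto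
    qed
  qed
  moreover have "p \<in> U"
  proof -
    have "coords p e = 0" if "e \<in> \<gamma>" for e using cg[OF that] p(3) that by simp
    then have "z0 (coords p) = coords p" by (rule z0_id[OF ce])
    then show ?thesis using p(1) coords_in[OF p(1)] by (simp add: Ui)
  qed
  ultimately show ?thesis by blast
qed

end

section \<open>The enlarged model as closed graph over a chart\<close>

context new_member_chart begin

text \<open>The point of projective space in the closed graph is the new component up to scale: one
  direction forgets the scale, the other normalizes to volume one. The enumeration \<open>h\<close>
  of \<gamma> is there because blow-ups are defined with numbered generators.\<close>

lemma blowup_chart:
  assumes U: "ideal_on U"
  shows "\<exists>m f \<phi>. generates_ideal (model I) (center I \<gamma>) U m f \<and>
    isomorphism (sub_space (model (insert \<gamma> I)) {y \<in> pts (model (insert \<gamma> I)). restrict y I \<in> U})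
        (graph_blowup (model I) U m f) \<phi> \<and>
    (\<forall>y\<in>pts (model (insert \<gamma> I)). restrict y I \<in> U \<longrightarrow> fst (\<phi> y) = restrict y I)"
proof -
  let ?J = "insert \<gamma> I"
  interpret J: union_family E ?J by (rule union_family_insert)
  note M = fspace_model[of I] and MJ = fspace_model[of ?J]
  have oU: "openin (rtop (model I)) U" and Ud: "U \<subseteq> chart_dom"
    using U by (simp_all add: ideal_on_def)
  have ideal: "\<exists>W a. openin (rtop (model I)) W \<and> q \<in> W \<and> W \<subseteq> V \<and> (\<forall>e\<in>\<gamma>. a e \<in> reg (model I) W) \<and>
           (\<forall>x\<in>W. g x = (\<Sum>e\<in>\<gamma>. a e x * x level e))"
    if "openin (rtop (model I)) V \<and> V \<subseteq> U \<and> g \<in> reg (model I) V \<and> (\<forall>x\<in>V \<inter> center I \<gamma>. g x = 0) \<and> q \<in> V"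
        for V g q
    by (rule U[unfolded ideal_on_def, THEN conjunct2, THEN conjunct2, rule_format, OF that])
  have Um: "x \<in> model_points I" if "x \<in> U" for x using that Ud chart_domD(1) by blast
  define m where "m = card \<gamma>"
  obtain h where h: "bij_betw h {..<m} \<gamma>"
    using ex_bij_betw_nat_finite[OF finite_new] unfolding m_def atLeast0LessThan by blast
  define k where "k = inv_into {..<m} h"
  have k: "bij_betw k \<gamma> {..<m}" unfolding k_def by (rule bij_betw_inv_into[OF h])
  have hk: "i < m \<Longrightarrow> h i \<in> \<gamma>" "i < m \<Longrightarrow> k (h i) = i" "e \<in> \<gamma> \<Longrightarrow> k e < m" "e \<in> \<gamma> \<Longrightarrow> h (k e) = e" for i e
    using h bij_betwE[OF k] unfolding k_def by (auto simp: bij_betw_def inv_into_f_f f_inv_into_f)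
  define f where "f i x = x level (h i)" for i and x :: "'e set \<Rightarrow> 'e \<Rightarrow> real"
  have freg: "f i \<in> reg (model I) U" if "i < m" for i
    using chart_coordinate[OF level(4) _ oU Ud, of "h i"] hk(1)[OF that] level(2) unfolding f_def by blast
  have fnonneg: "0 \<le> f i x" if "i < m" "x \<in> U" for i x
    unfolding f_def
      by (rule model_pointsD(2)[OF Um[OF that(2)] level(4)]) (use hk(1)[OF that(1)] level(2) in blast)
  have all_h: "(\<forall>i<m. P (h i)) \<longleftrightarrow> (\<forall>e\<in>\<gamma>. P e)" for P
  proof
    assume *: "\<forall>i<m. P (h i)"
    show "\<forall>e\<in>\<gamma>. P e"
    proof
      fix e assume e: "e \<in> \<gamma>"
      have "P (h (k e))" using * hk(3)[OF e] by blast
      then show "P e" unfolding hk(4)[OF e] .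
    qed
  qed (use hk(1) in blast)
  have sum_h: "(\<Sum>i<m. g (h i)) = sum g \<gamma>" for g :: "'e \<Rightarrow> real" by (rule sum.reindex_bij_betw[OF h])
  have gen: "generates_ideal (model I) (center I \<gamma>) U m f"
    unfolding generates_ideal_def
  proof (intro conjI allI impI ballI freg, assumption)
    have "(\<forall>i<m. f i x = 0) \<longleftrightarrow> x \<in> center I \<gamma>" if "x \<in> U" for x
      unfolding f_def all_h[of "\<lambda>e. x level e = 0"] using center_chart[of x] Ud that by blast
    then show "{x \<in> U. \<forall>i<m. f i x = 0} = U \<inter> center I \<gamma>" by blast
    fix V g q assume "openin (rtop (model I)) V \<and> V \<subseteq> U \<and> g \<in> reg (model I) V \<and> (\<forall>x\<in>V \<inter> center I \<gamma>. g x
        = 0)" "q \<in> V"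
    then have "\<exists>W a. openin (rtop (model I)) W \<and> q \<in> W \<and> W \<subseteq> V \<and> (\<forall>e\<in>\<gamma>. a e \<in> reg (model I) W) \<and>
           (\<forall>x\<in>W. g x = (\<Sum>e\<in>\<gamma>. a e x * x level e))"
      by (intro ideal) simp
    then obtain W a where W: "openin (rtop (model I)) W" "q \<in> W" "W \<subseteq> V" "\<forall>e\<in>\<gamma>. a e \<in> reg (model I) W"
      "\<forall>x\<in>W. g x = (\<Sum>e\<in>\<gamma>. a e x * x level e)"
      by (elim exE conjE)
    have "(\<Sum>i<m. a (h i) x * f i x) = (\<Sum>e\<in>\<gamma>. a e x * x level e)" for x
      using sum_h[of "\<lambda>e. a e x * x level e"] by (simp add: f_def)
    then show "\<exists>W a. openin (rtop (model I)) W \<and> q \<in> W \<and> W \<subseteq> V \<and> (\<forall>i<m. a i \<in> reg (model I) W) \<and>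
        (\<forall>x\<in>W. g x = (\<Sum>i<m. a i x * f i x))"
      using W hk(1) by (intro exI[of _ W] exI[of _ "\<lambda>i. a (h i)"] conjI) simp_all
  qed

  define V where "V = {y \<in> pts (model ?J). restrict y I \<in> U}"
  have oV: "openin (rtop (model ?J)) V"
    unfolding V_def by (rule morphism_open[OF morphism_model_restrict oU]) blast
  have Vi: "y \<in> V \<longleftrightarrow> y \<in> model_points ?J \<and> restrict y I \<in> U" for y unfolding V_def pts_model by blast
  let ?Y = "sub_space (model ?J) V"
  have Y: "fspace ?Y" by simp
  have ptsY: "pts ?Y = V" using openin_subset[OF oV] by auto
  have Yc: "(\<lambda>y. y \<eta> e) \<in> reg ?Y (pts ?Y)" if "\<eta> \<in> ?J" "e \<in> \<eta>" for \<eta> e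
    unfolding ptsY reg_sub_space_open[OF MJ oV]
    using fspace.reg_subset[OF MJ model_coordinate[OF that] oV] Vi by blast
  let ?P = "blowup_ambient (model I) U m" and ?B = "graph_blowup (model I) U m f"
  define \<phi> where "\<phi> y = (restrict y I, hpoint {..<m} (\<lambda>i. y \<gamma> (h i)))" for y :: "'e set \<Rightarrow> 'e \<Rightarrow> real"
  have ynz: "\<exists>i\<in>{..<m}. y \<gamma> (h i) \<noteq> 0" if "y \<in> model_points ?J" for y
    using std_simplex_nonzero[OF model_pointsD(1)[OF that insertI1]] hk by (metis lessThan_iff)
  have \<phi>P: "morphism ?Y ?P \<phi>"
    unfolding \<phi>_def
  proof (rule morphism_Pair[OF Y])
    show "morphism ?Y (sub_space (model I) U) (\<lambda>y. restrict y I)"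
      by (rule morphism_sub_spaceI[OF Y morphism_sub_space_dom[OF MJ morphism_model_restrict]])
        (use ptsY Vi in auto)
    show "morphism ?Y (proj_space {..<m}) (\<lambda>y. hpoint {..<m} (\<lambda>i. y \<gamma> (h i)))"
    proof (rule morphism_proj_space[OF Y])
      show "(\<lambda>y. y \<gamma> (h i)) \<in> reg ?Y (pts ?Y)" if "i \<in> {..<m}" for i
        by (rule Yc) (use hk(1) that in auto)
      show "\<exists>i\<in>{..<m}. y \<gamma> (h i) \<noteq> 0" if "y \<in> pts ?Y" for y
        by (rule ynz) (use that Vi in \<open>unfold ptsY, blast\<close>)
    qed
  qed
  \<comment> \<open>At positive points the coordinates of \<gamma> at its level are the volume of
    \<gamma> times \<open>y \<gamma>\<close>, with nonzero volume, so \<phi> lands in the graph;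
    such points are dense in the enlarged model.\<close>
  have \<phi>B: "\<phi> y \<in> pts ?B" if y: "y \<in> V" for y
  proof -
    have "y \<in> rtop ?Y closure_of (V \<inter> J.positive_points)"
      unfolding rtop_sub_space
      by (rule dense_in_open[OF _ oV y]) (simp only: J.positive_points_dense pts_model)
    then have "\<phi> y \<in> rtop ?P closure_of (\<phi> ` (V \<inter> J.positive_points))"
      using continuous_map_image_closure_subset[OF morphism_continuous[OF \<phi>P]] by blast
    moreover have "\<phi> ` (V \<inter> J.positive_points) \<subseteq> blowup_graph U m f"
    proof (rule image_subsetI)
      fix y assume "y \<in> V \<inter> J.positive_points"
      then have y: "y \<in> V" "y \<in> J.positive_points" by auto
      have yJ: "y \<in> model_points ?J" using y(1) Vi by blast
      have tJ: "level \<in> ?J" using level(4) by blast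
      have pos: "0 < y level e" if "e \<in> \<gamma>" for e
        using y(2) tJ level(2) that unfolding J.positive_points_def by blast
      have s: "0 < sum (y level) \<gamma>" by (rule sum_pos[OF finite_new new_nonempty pos])
      have r: "f i (restrict y I) = sum (y level) \<gamma> * y \<gamma> (h i)" if "i < m" for i
        using model_pointsD(4)[OF yJ insertI1 tJ level(2) hk(1)[OF that]] level(4) by (simp add: f_def)
      have "hpoint {..<m} (\<lambda>i. f i (restrict y I)) = hpoint {..<m} (\<lambda>i. y \<gamma> (h i))"
        by (rule hpoint_scale[of "sum (y level) \<gamma>"]) (use s r in auto)
      moreover have "\<exists>i<m. f i (restrict y I) \<noteq> 0" using ynz[OF yJ] r s by auto
      ultimately show "\<phi> y \<in> blowup_graph U m f"
        using y(1) Vi unfolding \<phi>_def by (intro CollectI exI[of _ "restrict y I"]) auto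
    qed
    ultimately show ?thesis unfolding pts_graph_blowup by (meson closure_of_mono subsetD)
  qed

  have incl: "morphism ?B ?P (\<lambda>z. z)" unfolding graph_blowup_eq by (rule morphism_sub_space_incl) simp
  have FB: "fspace ?B" by simp
  have Bfst: "morphism ?B (sub_space (model I) U) fst" by (rule morphism_compose[OF incl morphism_fst])
  have Bsnd: "morphism ?B (proj_space {..<m}) snd" by (rule morphism_compose[OF incl morphism_snd])
  have BU: "fst z \<in> U" if "z \<in> pts ?B" for z using morphism_in[OF Bfst that] by simp
  \<comment> \<open>The generators are nonnegative on \<open>U\<close> and the projective simplex is
    closed, so points of the closure over the center can be normalized as well.\<close>
  have Bsimplex: "snd z \<in> proj_simplex {..<m}" if z: "z \<in> pts ?B" for z
  proof -
    have "snd ` blowup_graph U m f \<subseteq> proj_simplex {..<m}"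
    proof (rule image_subsetI)
      fix w assume "w \<in> blowup_graph U m f"
      then obtain x where x: "w = (x, hpoint {..<m} (\<lambda>i\<in>{..<m}. f i x))" "x \<in> U" "\<exists>i<m. f i x \<noteq> 0" by auto
      then have "(\<lambda>i\<in>{..<m}. f i x) \<in> {x \<in> nonzero_vectors {..<m}. \<forall>e\<in>{..<m}. 0 \<le> x e}"
        using fnonneg by auto
      then show "snd w \<in> proj_simplex {..<m}" unfolding x(1) proj_simplex_def snd_conv by (rule imageI)
    qed
    then have "proj_topology {..<m} closure_of (snd ` blowup_graph U m f) \<subseteq> proj_simplex {..<m}"
      by (rule closure_of_minimal[OF _ closedin_proj_simplex])
    moreover have "snd z \<in> rtop (proj_space {..<m}) closure_of (snd ` blowup_graph U m f)"
      by (rule subsetD[OF continuous_map_image_closure_subset[OF morphism_continuous[OF morphism_snd]] imageI])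
        (rule z[unfolded pts_graph_blowup])
    ultimately show ?thesis unfolding rtop_proj_space by blast
  qed
  note simplex = inverse_morphisms_simplex[OF finite_lessThan[of m]]
  define w where "w z = normalize_rep {..<m} (snd z)" for z :: "('e set \<Rightarrow> 'e \<Rightarrow> real) \<times> (nat \<Rightarrow> real) set"
  have wB: "w z \<in> std_simplex {..<m}" "hpoint {..<m} (w z) = snd z" if z: "z \<in> pts ?B" for z
  proof -
    have "snd z \<in> pts (sub_space (proj_space {..<m}) (proj_simplex {..<m}))"
      unfolding pts_proj_simplex_space by (rule Bsimplex[OF z])
    from inverse_morphismsD(6)[OF simplex this] inverse_morphismsD(4)[OF simplex this]
    show "w z \<in> std_simplex {..<m}" "hpoint {..<m} (w z) = snd z" unfolding w_def pts_simplex_space .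
  qed
  have wreg: "(\<lambda>z. w z i) \<in> reg ?B (pts ?B)" if "i < m" for i
  proof -
    have "morphism ?B (sub_space (proj_space {..<m}) (proj_simplex {..<m})) snd"
      by (rule morphism_sub_spaceI[OF FB Bsnd Bsimplex])
    from morphism_compose[OF this inverse_morphismsD(2)[OF simplex]]
    have "morphism ?B (affine_space {..<m}) w" unfolding w_def by (rule morphism_sub_space_cod[rotated]) simp
    moreover have "w z \<in> extensional {..<m}" if "z \<in> pts ?B" for z
      using wB(1)[OF that] by (simp add: std_simplex_def PiE_def)
    ultimately show ?thesis using morphism_affine_space[OF FB, of w "{..<m}"] that by blast
  qed
  \<comment> \<open>The relations \<open>f i * w j = f j * w i\<close> are summed over one index; as
    \<open>w z\<close> has volume one, the factor of proportionality is the volume of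
    \<gamma>.\<close>
  have wprop: "fst z level e = sum (fst z level) \<gamma> * w z (k e)" if z: "z \<in> pts ?B" and e: "e \<in> \<gamma>" for z e
  proof -
    have zB: "(fst z, hpoint {..<m} (w z)) \<in> pts ?B" using z wB(2)[OF z] by simp
    have nz: "\<exists>i<m. w z i \<noteq> 0" using std_simplex_nonzero[OF wB(1)[OF z]] by blast
    have "f (k e) (fst z) = (\<Sum>j<m. f (k e) (fst z) * w z j)"
      using wB(1)[OF z] by (simp add: sum_distrib_left[symmetric] std_simplex_def)
    also have "\<dots> = (\<Sum>j<m. f j (fst z) * w z (k e))"
      by (rule sum.cong[OF refl], rule graph_blowup_proportional[OF M oU freg zB nz hk(3)[OF e]]) auto
    also have "\<dots> = (\<Sum>j<m. f j (fst z)) * w z (k e)" by (simp add: sum_distrib_right)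
    also have "(\<Sum>j<m. f j (fst z)) = sum (fst z level) \<gamma>" unfolding f_def by (rule sum_h)
    finally show ?thesis using hk(4)[OF e] by (simp add: f_def)
  qed
  define \<psi> where "\<psi> z = (\<lambda>\<eta>\<in>?J. if \<eta> = \<gamma> then (\<lambda>e\<in>\<gamma>. w z (k e)) else fst z \<eta>)"
    for z :: "('e set \<Rightarrow> 'e \<Rightarrow> real) \<times> (nat \<Rightarrow> real) set"
  have \<psi>I: "\<psi> z \<eta> = fst z \<eta>" if "\<eta> \<in> I" for z \<eta> using that new_notin by (auto simp: \<psi>_def)
  have \<psi>\<gamma>: "\<psi> z \<gamma> = (\<lambda>e\<in>\<gamma>. w z (k e))" for z by (simp add: \<psi>_def)
  have \<psi>m: "\<psi> z \<in> model_points ?J" if z: "z \<in> pts ?B" for z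
    unfolding model_points_def
  proof (intro CollectI conjI ballI impI PiE_I)
    have x: "fst z \<in> U" "fst z \<in> model_points I" "fst z \<in> chart_dom" using BU[OF z] Um Ud by blast+
    have sumw: "(\<Sum>e\<in>\<gamma>. w z (k e)) = 1"
      using sum.reindex_bij_betw[OF k, of "w z"] wB(1)[OF z] by (simp add: std_simplex_def)
    show "\<psi> z \<eta> \<in> std_simplex \<eta>" if "\<eta> \<in> ?J" for \<eta>
    proof (cases "\<eta> = \<gamma>")
      case True
      then show ?thesis using wB(1)[OF z] hk(3) sumw unfolding True \<psi>\<gamma> by (auto simp: std_simplex_def)
    next
      case False
      then show ?thesis using that \<psi>I model_pointsD(1)[OF x(2)] by auto
    qed
    fix \<eta> \<theta> e assume *: "\<eta> \<in> ?J" "\<theta> \<in> ?J" "\<theta> \<subseteq> \<eta>" "e \<in> \<theta>"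
    \<comment> \<open>The case of an old \<theta> inside the new \<gamma> is excluded by
      \<open>new_minimal\<close>.\<close>
    consider "\<eta> \<in> I" "\<theta> \<in> I" | "\<eta> \<in> I" "\<theta> = \<gamma>" | "\<eta> = \<gamma>" "\<theta> = \<gamma>"
      using * new_minimal[of \<theta>] by blast
    then show "\<psi> z \<eta> e = sum (\<psi> z \<eta>) \<theta> * \<psi> z \<theta> e"
    proof cases
      case 1
      then show ?thesis using model_pointsD(4)[OF x(2) _ _ *(3,4)] \<psi>I by simp
    next
      case 2
      \<comment> \<open>The relation is known at the level of \<gamma>; it passes to any larger
        \<eta> since on \<gamma> both metrics are proportional.\<close>
      obtain c where c: "\<And>e. e \<in> \<gamma> \<Longrightarrow> fst z \<eta> e = c * fst z level e"
        using proportional_to_level[OF x(3) 2(1)] *(3) 2(2) by metis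
      then have "sum (fst z \<eta>) \<gamma> = c * sum (fst z level) \<gamma>" by (simp add: sum_distrib_left)
      then show ?thesis
        using c[of e] wprop[OF z, of e] *(4) unfolding 2(2) \<psi>I[OF 2(1)] \<psi>\<gamma> by simp
    next
      case 3
      have "sum (\<psi> z \<gamma>) \<gamma> = 1" using sumw unfolding \<psi>\<gamma> by simp
      then show ?thesis using 3 by simp
    qed
  qed (simp add: \<psi>_def)
  have \<psi>r: "restrict (\<psi> z) I = fst z" if z: "z \<in> pts ?B" for z
  proof (rule extensionalityI[of _ I])
    show "fst z \<in> extensional I" using Um[OF BU[OF z]] by (simp add: model_points_def PiE_def)
  qed (simp_all add: \<psi>I)
  have \<psi>V: "\<psi> z \<in> V" if "z \<in> pts ?B" for z using \<psi>m[OF that] \<psi>r[OF that] BU[OF that] Vi by simp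
  have "inverse_morphisms ?Y ?B \<phi> \<psi>"
    unfolding inverse_morphisms_def
  proof (intro conjI ballI)
    show "morphism ?Y ?B \<phi>"
      unfolding graph_blowup_eq
      by (rule morphism_sub_spaceI[OF Y \<phi>P]) (use \<phi>B in \<open>unfold ptsY pts_graph_blowup, blast\<close>)
    show "morphism ?B ?Y \<psi>"
    proof (rule morphism_sub_spaceI[OF FB morphism_modelI[OF FB \<psi>m] \<psi>V])
      fix \<eta> e assume *: "\<eta> \<in> ?J" "e \<in> \<eta>"
      show "(\<lambda>z. \<psi> z \<eta> e) \<in> reg ?B (pts ?B)"
      proof (cases "\<eta> = \<gamma>")
        case True
        then have "(\<lambda>z. \<psi> z \<eta> e) = (\<lambda>z. w z (k e))" using *(2) by (simp add: \<psi>\<gamma>)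
        then show ?thesis using wreg hk(3) * True by simp
      next
        case False
        then have \<eta>: "\<eta> \<in> I" using * by blast
        have op: "openin (rtop (sub_space (model I) U)) U" using oU by (simp add: openin_open_subtopology)
        have "(\<lambda>x. x \<eta> e) \<in> reg (sub_space (model I) U) U"
          using chart_coordinate[OF \<eta> *(2) oU Ud] by (simp add: reg_sub_space_open[OF M oU])
        from morphism_reg[OF Bfst this op]
        have "(\<lambda>z. fst z \<eta> e) \<in> reg ?B {z \<in> pts ?B. fst z \<in> U}" .
        moreover have "{z \<in> pts ?B. fst z \<in> U} = pts ?B" using BU by blast
        ultimately show ?thesis by (simp add: \<psi>I[OF \<eta>])
      qed
    qed
    show "\<psi> (\<phi> y) = y" if "y \<in> pts ?Y" for y
    proof -
      have y: "y \<in> V" using that unfolding ptsY .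
      have yJ: "y \<in> model_points ?J" using y Vi by blast
      show ?thesis
      proof (rule model_points_eqI[OF \<psi>m[OF \<phi>B[OF y]] yJ])
        fix \<eta> e assume *: "\<eta> \<in> ?J" "e \<in> \<eta>"
        show "\<psi> (\<phi> y) \<eta> e = y \<eta> e"
        proof (cases "\<eta> = \<gamma>")
          case True
          have "(\<Sum>i<m. y \<gamma> (h i)) = 1" using sum_h[of "y \<gamma>"] model_pointsD(3)[OF yJ insertI1] by simp
          then have "w (\<phi> y) (k e) = y \<gamma> e"
            using hk(3,4) * True ynz[OF yJ] by (simp add: w_def \<phi>_def normalize_rep_hpoint rescale_def)
          then show ?thesis using True * by (simp add: \<psi>\<gamma>)
        next
          case False
          then show ?thesis using * \<psi>I by (auto simp: \<phi>_def)
        qed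
      qed
    qed
    show "\<phi> (\<psi> z) = z" if z: "z \<in> pts ?B" for z
    proof -
      have "hpoint {..<m} (\<lambda>i. \<psi> z \<gamma> (h i)) = hpoint {..<m} (w z)"
        by (rule hpoint_scale[of 1]) (use hk in \<open>auto simp: \<psi>\<gamma>\<close>)
      then show ?thesis using \<psi>r[OF z] wB(2)[OF z] by (simp add: \<phi>_def)
    qed
  qed
  then have "isomorphism (sub_space (model ?J) {y \<in> pts (model ?J). restrict y I \<in> U}) ?B \<phi>"
    unfolding isomorphism_iff V_def by blast
  then show ?thesis using gen by (intro exI[of _ m] exI[of _ f] exI[of _ \<phi>]) (simp add: \<phi>_def)
qed

end

context new_member begin

theorem model_blowup: "is_blowup (model I) (center I \<gamma>) (model (insert \<gamma> I)) (\<lambda>x. restrict x I)"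
  unfolding is_blowup_def
proof (intro conjI ballI closedin_center)
  show "morphism (model (insert \<gamma> I)) (model I) (\<lambda>x. restrict x I)" by (rule morphism_model_restrict) blast
  fix p assume "p \<in> pts (model I)"
  then have p: "p \<in> model_points I" by simp
  obtain C b where ch: "family_chart E I C b" and pd: "p \<in> family_chart.chart_dom I C b"
    and ad: "\<forall>\<delta>\<in>C. \<forall>\<delta>'\<in>C. \<delta>' \<subset> \<delta> \<longrightarrow> (\<forall>e\<in>\<delta>'. p \<delta> e = 0)"
    by (rule adapted_chart[OF p])
  interpret family_chart E I C b by (rule ch)
  interpret new_member_chart E I \<gamma> C b ..
  obtain U where U: "p \<in> U" "ideal_on U"
    using ideal_regular[OF pd] ideal_center[OF pd ad] by blast
  obtain m f \<phi> where "generates_ideal (model I) (center I \<gamma>) U m f"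
    "isomorphism (sub_space (model (insert \<gamma> I)) {y \<in> pts (model (insert \<gamma> I)). restrict y I \<in> U})
        (graph_blowup (model I) U m f) \<phi>"
    "\<forall>y\<in>pts (model (insert \<gamma> I)). restrict y I \<in> U \<longrightarrow> fst (\<phi> y) = restrict y I"
    using blowup_chart[OF U(2)] by (elim exE conjE)
  moreover have "openin (rtop (model I)) U" using U(2) by (simp add: ideal_on_def)
  ultimately show "\<exists>U m f \<phi>. openin (rtop (model I)) U \<and> p \<in> U \<and> generates_ideal (model I) (center I \<gamma>) U m f \<and>
      isomorphism (sub_space (model (insert \<gamma> I)) {y \<in> pts (model (insert \<gamma> I)). restrict y I \<in> U})
          (graph_blowup (model I) U m f) \<phi> \<and>
      (\<forall>y\<in>pts (model (insert \<gamma> I)). restrict y I \<in> U \<longrightarrow> fst (\<phi> y) = restrict y I)"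
    using U(1) by (intro exI[of _ U] exI[of _ m] exI[of _ f] exI[of _ \<phi>] conjI)
qed

text \<open>Off the center of \<gamma> the new component is determined by the old ones, so the
  equations for \<delta> carry over to it. Conversely, \<gamma> is not contained in \<delta>, so a
  generic point of the new center keeps a nonzero coordinate on \<gamma> and avoids the center of
  \<gamma>.\<close>

lemma strict_transform_center:
  assumes "new_member E (insert \<gamma> I) \<delta>"
  shows "strict_transform (center I \<gamma>) (model (insert \<gamma> I)) (\<lambda>x. restrict x I) (center I \<delta>) = center
      (insert \<gamma> I) \<delta>"
proof -
  let ?J = "insert \<gamma> I"
  interpret J: new_member E ?J \<delta> by (rule assms)
  let ?S = "{y \<in> pts (model ?J). restrict y I \<in> center I \<delta> - center I \<gamma>}"
  have "?S \<subseteq> center ?J \<delta>"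
  proof
    fix y assume "y \<in> ?S"
    then have y: "y \<in> model_points ?J" "restrict y I \<in> center I \<delta>" "restrict y I \<in> model_points I"
        "restrict y I \<notin> center I \<gamma>"
      by (auto simp: center_def)
    \<comment> \<open>A member at which \<gamma> has nonzero volume; through it the vanishing on
      \<delta> is transferred to the component at \<gamma>.\<close>
    then obtain \<theta> e where \<theta>: "\<theta> \<in> I" "\<gamma> \<subseteq> \<theta>" "e \<in> \<gamma>" "y \<theta> e \<noteq> 0" unfolding center_def by auto
    then have s: "sum (y \<theta>) \<gamma> \<noteq> 0" using model_pointsD(4)[OF y(1) insertI1, of \<theta> e] by auto
    have I0: "y \<eta> e = 0" if "\<eta> \<in> I" "\<delta> \<subseteq> \<eta>" "e \<in> \<delta>" for \<eta> e
      using y(2) that unfolding center_def by auto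
    have "y \<gamma> e = 0" if "\<delta> \<subseteq> \<gamma>" "e \<in> \<delta>" for e
    proof -
      have "y \<theta> e = 0" by (rule I0[OF \<theta>(1) _ that(2)]) (use that \<theta> in blast)
      moreover have "y \<theta> e = sum (y \<theta>) \<gamma> * y \<gamma> e"
        by (rule model_pointsD(4)[OF y(1) insertI1 _ \<theta>(2)]) (use \<theta>(1) that in auto)
      ultimately show ?thesis using s by simp
    qed
    then show "y \<in> center ?J \<delta>" using I0 y(1) unfolding center_def by blast
  qed
  then have "rtop (model ?J) closure_of ?S \<subseteq> center ?J \<delta>" by (rule closure_of_minimal[OF _ closedin_center])
  moreover have "center ?J \<delta> \<subseteq> rtop (model ?J) closure_of ?S"
  proof
    fix p assume pc: "p \<in> center ?J \<delta>"
    then have p: "p \<in> model_points ?J" by (simp add: center_def)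
    obtain C b where ch: "family_chart E ?J C b" and pd: "p \<in> family_chart.chart_dom ?J C b"
      and ad: "\<forall>\<delta>\<in>C. \<forall>\<delta>'\<in>C. \<delta>' \<subset> \<delta> \<longrightarrow> (\<forall>e\<in>\<delta>'. p \<delta> e = 0)"
      by (rule J.adapted_chart[OF p])
    interpret family_chart E ?J C b by (rule ch)
    interpret new_member_chart E ?J \<delta> C b ..
    have p0: "\<forall>e\<in>\<delta>. p level e = 0" using center_chart[OF pd] pc by blast
    note mt = minimal_level[OF pd ad p0]
    have xg: "x level e = x level (b level) * coords x e" if "e \<in> \<delta>" "x \<in> chart_dom" for x e
      using mt(2)[OF that(1)] chart_domD(2)[OF that(2) level(1)] by (simp add: coords_def)
    show "p \<in> rtop (model ?J) closure_of ?S"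
      unfolding in_closure_of
    proof (intro conjI allI impI)
      fix V assume V: "p \<in> V \<and> openin (rtop (model ?J)) V"
      have c0: "coords p e = 0" if "e \<in> params" "e \<in> \<delta>" for e
        using xg[OF that(2) pd] p0 that(2) chart_domD(2)[OF pd level(1)] by simp
      \<comment> \<open>Nearby points with exactly the parameters of \<delta> equal to 0.\<close>
      obtain z where z': "z \<in> V" "z \<in> chart_dom" "\<forall>e\<in>params. e \<in> \<delta> \<longrightarrow> coords z e = 0"
        "\<forall>e\<in>params. e \<notin> \<delta> \<longrightarrow> 0 < coords z e"
        by (rule chart_approximation[OF pd c0 conjunct2[OF V] conjunct1[OF V]], assumption, assumption,
            rule that) blast+
      note z = z'(1,2) z'(3,4)[rule_format]
      have zm: "z \<in> model_points ?J" using chart_domD(1)[OF z(2)] .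
      have "z \<in> center ?J \<delta>"
        using center_chart[OF z(2)] xg[OF _ z(2)] z(3) mt(2) by simp
      moreover have zr: "restrict z I \<in> model_points I"
        using morphism_in[OF morphism_model_restrict[of I ?J]] zm by auto
      ultimately have "restrict z I \<in> center I \<delta>" unfolding center_def by auto
      moreover have "restrict z I \<notin> center I \<gamma>"
      proof -
        obtain e where e: "e \<in> \<gamma>" "e \<notin> \<delta>" using J.new_minimal[of \<gamma>] by blast
        have "0 < mon (coords z) E e" by (rule mon_pos[OF z(4) mt(3) E_C]) (use e new_sub in auto)
        then have "z E e \<noteq> 0"
          using chart_dom_mon[OF z(2) E_C] chart_domD(2)[OF z(2) E_C] e new_sub by auto
        then show ?thesis using e(1) new_sub E_in unfolding center_def by auto
      qed
      ultimately show "\<exists>y. y \<in> ?S \<and> y \<in> V" using z(1) zm by auto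
    qed (use p in simp)
  qed
  ultimately show ?thesis unfolding strict_transform_def by blast
qed

end

section \<open>Towers of blow-ups\<close>

abbreviation to_proj :: "'e set set \<Rightarrow> ('e set \<Rightarrow> 'e \<Rightarrow> real) \<Rightarrow> 'e set \<Rightarrow> ('e \<Rightarrow> real) set" where
  "to_proj I x \<equiv> (\<lambda>\<gamma>\<in>I. hpoint \<gamma> (x \<gamma>))"

abbreviation of_proj :: "'e set set \<Rightarrow> ('e set \<Rightarrow> ('e \<Rightarrow> real) set) \<Rightarrow> 'e set \<Rightarrow> 'e \<Rightarrow> real" where
  "of_proj I p \<equiv> (\<lambda>\<gamma>\<in>I. normalize_rep \<gamma> (p \<gamma>))"

lemma to_proj_in: "x \<in> model_points I \<Longrightarrow> to_proj I x \<in> (\<Pi>\<^sub>E \<gamma>\<in>I. proj_simplex \<gamma>)"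
  by (auto intro: hpoint_in_proj_simplex model_pointsD(1))

lemma of_proj_to_proj:
  assumes "x \<in> model_points I" shows "of_proj I (to_proj I x) = x"
proof (rule extensionalityI[of _ I])
  show "x \<in> extensional I" using assms by (auto simp: model_points_def PiE_def)
  show "of_proj I (to_proj I x) \<gamma> = x \<gamma>" if "\<gamma> \<in> I" for \<gamma>
    using model_pointsD(1)[OF assms that] that
    by (simp add: normalize_rep_hpoint std_simplex_nonzero rescale_std_simplex)
qed simp

lemma pts_Prod_proj: "pts (Prod_space I proj_space) = (\<Pi>\<^sub>E \<gamma>\<in>I. hpoint \<gamma> ` nonzero_vectors \<gamma>)"
  unfolding rtop_Prod_space topspace_product_topology o_def pts_proj_space ..

lemma to_proj_image_subset: "to_proj I ` model_points I \<subseteq> pts (Prod_space I proj_space)"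
  unfolding pts_Prod_proj
proof (rule image_subsetI)
  fix x assume "x \<in> model_points I"
  from to_proj_in[OF this] show "to_proj I x \<in> (\<Pi>\<^sub>E \<gamma>\<in>I. hpoint \<gamma> ` nonzero_vectors \<gamma>)"
    using proj_simplex_subset by (simp add: PiE_iff) blast
qed

lemma model_to_proj:
  assumes fin: "\<And>\<gamma>. \<gamma> \<in> I \<Longrightarrow> finite \<gamma>"
  shows "inverse_morphisms (model I) (sub_space (Prod_space I proj_space) (to_proj I ` model_points I))
      (to_proj I) (of_proj I)"
  unfolding inverse_morphisms_def
proof (intro conjI ballI)
  let ?P = "Prod_space I proj_space" and ?A = "to_proj I ` model_points I"
  let ?S = "sub_space ?P ?A"
  have P: "fspace ?P" by (rule fspace_Prod_space) simp
  have S: "fspace ?S" using P by simp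
  have ptsS: "pts ?S = ?A"
    unfolding rtop_sub_space[of ?P] topspace_subtopology by (rule Int_absorb1[OF to_proj_image_subset])
  show "morphism (model I) ?S (to_proj I)"
  proof (rule morphism_sub_spaceI[OF fspace_model morphism_ProdI[OF fspace_model]])
    fix \<gamma> assume \<gamma>: "\<gamma> \<in> I"
    have "morphism (model I) (proj_space \<gamma>) (\<lambda>x. hpoint \<gamma> (\<lambda>e. x \<gamma> e))"
    proof (rule morphism_proj_space[OF fspace_model])
      show "(\<lambda>x. x \<gamma> e) \<in> reg (model I) (pts (model I))" if "e \<in> \<gamma>" for e
        unfolding pts_model by (rule model_coordinate[OF \<gamma> that])
      show "\<exists>e\<in>\<gamma>. x \<gamma> e \<noteq> 0" if "x \<in> pts (model I)" for x
        using std_simplex_nonzero[OF model_pointsD(1)[of x I \<gamma>]] that \<gamma> by simp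
    qed
    then show "morphism (model I) (proj_space \<gamma>) (\<lambda>x. to_proj I x \<gamma>)" using \<gamma> by simp
  qed auto
  have Aof: "of_proj I p \<in> model_points I" if p: "p \<in> ?A" for p
  proof -
    obtain x where x: "x \<in> model_points I" "p = to_proj I x" using p by blast
    show ?thesis unfolding x(2) of_proj_to_proj[OF x(1)] by (rule x(1))
  qed
  show "morphism ?S (model I) (of_proj I)"
  proof (rule morphism_modelI[OF S])
    show "of_proj I p \<in> model_points I" if "p \<in> pts ?S" for p using Aof that unfolding ptsS .
    fix \<gamma> e assume \<gamma>: "\<gamma> \<in> I" and e: "e \<in> \<gamma>"
    have "morphism ?S (sub_space (proj_space \<gamma>) (proj_simplex \<gamma>)) (\<lambda>p. p \<gamma>)"
    proof (rule morphism_sub_spaceI[OF S morphism_sub_space_dom[OF P morphism_Prod_proj[OF \<gamma>]]])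
      fix p assume "p \<in> pts ?S"
      then obtain x where "x \<in> model_points I" "p = to_proj I x" unfolding ptsS by blast
      then show "p \<gamma> \<in> proj_simplex \<gamma>" using hpoint_in_proj_simplex[OF model_pointsD(1)] \<gamma> by simp
    qed
    from morphism_compose[OF this inverse_morphismsD(2)[OF inverse_morphisms_simplex[OF fin[OF \<gamma>]]]]
    have m: "morphism ?S (simplex_space \<gamma>) (\<lambda>p. normalize_rep \<gamma> (p \<gamma>))" .
    have ext: "normalize_rep \<gamma> (p \<gamma>) \<in> extensional \<gamma>" if "p \<in> pts ?S" for p
      using morphism_in[OF m that] unfolding pts_simplex_space by (simp add: std_simplex_def PiE_def)
    have "morphism ?S (affine_space \<gamma>) (\<lambda>p. normalize_rep \<gamma> (p \<gamma>))"
      by (rule morphism_sub_space_cod[OF _ m]) simp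
    then have "(\<lambda>p. normalize_rep \<gamma> (p \<gamma>) e) \<in> reg ?S (pts ?S)"
      using morphism_affine_space[OF S ext, of "\<lambda>p. p"] e by blast
    then show "(\<lambda>p. of_proj I p \<gamma> e) \<in> reg ?S (pts ?S)" using \<gamma> by simp
  qed
  show "of_proj I (to_proj I x) = x" if "x \<in> pts (model I)" for x
    using of_proj_to_proj that by simp
  show "to_proj I (of_proj I p) = p" if p: "p \<in> pts ?S" for p
  proof -
    obtain x where x: "x \<in> model_points I" "p = to_proj I x" using p unfolding ptsS by blast
    show ?thesis unfolding x(2) of_proj_to_proj[OF x(1)] ..
  qed
qed

lemma model_points_singleton: "model_points {S} = (\<Pi>\<^sub>E _\<in>{S}. std_simplex S)"
proof (intro subset_antisym subsetI)
  show "x \<in> (\<Pi>\<^sub>E _\<in>{S}. std_simplex S)" if "x \<in> model_points {S}" for x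
    using that by (simp add: model_points_def PiE_iff)
  fix x assume x: "x \<in> (\<Pi>\<^sub>E _\<in>{S}. std_simplex S)"
  then have "sum (x S) S = 1" by (simp add: PiE_iff std_simplex_def)
  then show "x \<in> model_points {S}" using x by (simp add: model_points_def PiE_iff)
qed

lemma hpoint_rescale:
  assumes "sum u S \<noteq> 0" shows "hpoint S (rescale S u) = hpoint S u"
  by (rule hpoint_scale[of "1 / sum u S"]) (use assms in \<open>auto simp: rescale_def\<close>)

text \<open>The starting point of the towers: for empty \<delta> it identifies stage 0 with the
  model of the one-member family, in general the face of \<delta> with its center.\<close>

lemma to_proj_singleton:
  assumes S: "finite S" and \<delta>: "\<delta> \<subseteq> S"
  shows "to_proj {S} ` {x \<in> model_points {S}. \<forall>e\<in>\<delta>. x S e = 0} =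
    (\<Pi>\<^sub>E _\<in>{S}. hpoint S ` {x \<in> nonzero_vectors S. (\<forall>e\<in>S. 0 \<le> x e) \<and> (\<forall>e\<in>\<delta>. x e = 0)})"
    (is "?L = ?R")
proof (intro subset_antisym subsetI)
  fix p assume "p \<in> ?L"
  then obtain x where x: "x \<in> model_points {S}" "\<forall>e\<in>\<delta>. x S e = 0" "p = to_proj {S} x" by blast
  have s: "x S \<in> std_simplex S" using model_pointsD(1)[OF x(1)] by blast
  have "x S \<in> {x \<in> nonzero_vectors S. (\<forall>e\<in>S. 0 \<le> x e) \<and> (\<forall>e\<in>\<delta>. x e = 0)}"
    using s std_simplex_nonzero[OF s] x(2) by (simp add: std_simplex_def nonzero_vectors_def)
  then show "p \<in> ?R" unfolding x(3) by (intro restrict_PiE_iff[THEN iffD2]) auto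
next
  fix p assume p: "p \<in> ?R"
  then have "p S \<in> hpoint S ` {x \<in> nonzero_vectors S. (\<forall>e\<in>S. 0 \<le> x e) \<and> (\<forall>e\<in>\<delta>. x e = 0)}" by (simp add: PiE_iff)
  then obtain u where u: "u \<in> nonzero_vectors S" "\<forall>e\<in>S. 0 \<le> u e" "\<forall>e\<in>\<delta>. u e = 0" "p S = hpoint S u" by blast
  obtain i where "i \<in> S" "u i \<noteq> 0" using nonzero_vectors_ex[OF u(1)] by blast
  then have s: "sum u S > 0" using S u(2) by (intro sum_pos2[of S i]) (auto simp: less_le)
  define x where "x = (\<lambda>_\<in>{S}. rescale S u)"
  have "rescale S u \<in> std_simplex S" using u(2) s by (intro rescale_in_std_simplex) auto
  then have "x \<in> model_points {S}" unfolding model_points_singleton x_def by simp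
  moreover have "x S e = 0" if "e \<in> \<delta>" for e using u(3) that \<delta> by (auto simp: x_def rescale_def)
  moreover have "to_proj {S} x = p"
  proof (rule extensionalityI[of _ "{S}"])
    show "p \<in> extensional {S}" using p by (simp add: PiE_def)
    show "to_proj {S} x T = p T" if "T \<in> {S}" for T
      using that u(4) hpoint_rescale[of u S] s by (simp add: x_def)
  qed simp
  ultimately show "p \<in> ?L" by blast
qed

lemma stage_index_Suc: "i < length \<gamma>s \<Longrightarrow> stage_index G \<gamma>s (Suc i) = insert (\<gamma>s ! i) (stage_index G \<gamma>s i)"
  by (auto simp: stage_index_def take_Suc_conv_app_nth)

text \<open>\<open>new\<close> covers all later subgraphs and not just the next one, because their
  strict transforms have to be followed through every stage.\<close>

locale blowup_sequence =
  fixes G :: "('v, 'e, 'l) graph" and \<gamma>s :: "'e set list"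
  assumes family: "union_family (edges G) (stage_index G \<gamma>s i)"
    and new: "i \<le> j \<Longrightarrow> j < length \<gamma>s \<Longrightarrow> new_member (edges G) (stage_index G \<gamma>s i) (\<gamma>s ! j)"
begin

abbreviation idx :: "nat \<Rightarrow> 'e set set" where "idx i \<equiv> stage_index G \<gamma>s i"

text \<open>The induction invariant: besides the isomorphism with the model it keeps track of the
  strict transforms of all remaining faces, which are the centers of later steps.\<close>

definition matches :: "(nat \<Rightarrow> ('e set \<Rightarrow> ('e \<Rightarrow> real) set) set) \<Rightarrow> nat \<Rightarrow>
    (('e set \<Rightarrow> 'e \<Rightarrow> real) \<Rightarrow> 'e set \<Rightarrow> ('e \<Rightarrow> real) set) \<Rightarrow> bool" where
  "matches A i \<theta> \<longleftrightarrow> (\<exists>\<eta>. inverse_morphisms (model (idx i)) (stage G \<gamma>s A i) \<theta> \<eta>) \<and>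
     (\<forall>j. i \<le> j \<and> j < length \<gamma>s \<longrightarrow> transform G \<gamma>s A i (\<gamma>s ! j) = \<theta> ` center (idx i) (\<gamma>s ! j))"

lemma finite_idx: "\<gamma> \<in> idx i \<Longrightarrow> finite \<gamma>"
  by (rule union_family.finite_member[OF family])

lemma fspace_stage: "fspace (stage G \<gamma>s A i)"
  unfolding stage_def by (intro fspace_sub_space fspace_Prod_space fspace_proj_space)

lemma Hausdorff_stage: "Hausdorff_space (rtop (stage G \<gamma>s A i))"
  unfolding stage_def rtop_sub_space rtop_Prod_space
  by (intro Hausdorff_space_subtopology) (simp add: Hausdorff_space_product_topology
      Hausdorff_proj_topology finite_idx)

lemma idx_0: "idx 0 = {edges G}"
  by (simp add: stage_index_def)

lemma matches_0:
  assumes "A 0 = (\<Pi>\<^sub>E _\<in>{edges G}. proj_simplex (edges G))"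
  shows "matches A 0 (to_proj {edges G})"
proof -
  have E: "finite (edges G)" using family[of 0] by (simp add: union_family_def)
  have "to_proj {edges G} ` model_points {edges G} = A 0"
    using to_proj_singleton[OF E, of "{}"] unfolding assms proj_simplex_def by simp
  then have "inverse_morphisms (model (idx 0)) (stage G \<gamma>s A 0) (to_proj {edges G}) (of_proj {edges G})"
    using model_to_proj[of "{edges G}"] E unfolding stage_def idx_0 by simp
  moreover have "transform G \<gamma>s A 0 (\<gamma>s ! j) = to_proj {edges G} ` center {edges G} (\<gamma>s ! j)"
    if j: "j < length \<gamma>s" for j
  proof -
    have sub: "\<gamma>s ! j \<subseteq> edges G" using new_member.new_sub[OF new[of 0 j]] j by simp
    have "center {edges G} (\<gamma>s ! j) = {x \<in> model_points {edges G}. \<forall>e\<in>\<gamma>s ! j. x (edges G) e = 0}"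
      using sub by (auto simp: center_def)
    then show ?thesis using to_proj_singleton[OF E sub] by (simp add: L_face_def)
  qed
  ultimately show ?thesis unfolding matches_def idx_0 by blast
qed

lemma matches_Suc:
  assumes i: "i < length \<gamma>s" and m: "matches A i \<theta>"
    and iso: "inverse_morphisms (model (idx (Suc i))) (stage G \<gamma>s A (Suc i)) \<theta>' \<eta>'"
    and comm: "\<And>x. x \<in> model_points (idx (Suc i)) \<Longrightarrow> blow_down G \<gamma>s i (\<theta>' x) = \<theta> (restrict x (idx i))"
  shows "matches A (Suc i) \<theta>'"
proof -
  obtain \<eta> where \<eta>: "inverse_morphisms (model (idx i)) (stage G \<gamma>s A i) \<theta> \<eta>"
    and tr: "\<And>j. i \<le> j \<Longrightarrow> j < length \<gamma>s \<Longrightarrow> transform G \<gamma>s A i (\<gamma>s ! j) = \<theta> ` center (idx i) (\<gamma>s ! j)"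
    using m unfolding matches_def by blast
  note Suc = stage_index_Suc[OF i, of G]
  have "transform G \<gamma>s A (Suc i) (\<gamma>s ! j) = \<theta>' ` center (idx (Suc i)) (\<gamma>s ! j)"
    if j: "Suc i \<le> j" "j < length \<gamma>s" for j
  proof -
    have "transform G \<gamma>s A (Suc i) (\<gamma>s ! j) = strict_transform (\<theta> ` center (idx i) (\<gamma>s ! i))
        (stage G \<gamma>s A (Suc i)) (blow_down G \<gamma>s i) (\<theta> ` center (idx i) (\<gamma>s ! j))"
      using tr[of i] tr[of j] i j by simp
    also have "\<dots> = \<theta>' ` strict_transform (center (idx i) (\<gamma>s ! i)) (model (idx (Suc i))) (\<lambda>x. restrict x
        (idx i)) (center (idx i) (\<gamma>s ! j))"
    proof (rule strict_transform_transport[OF \<eta> iso])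
      show "morphism (model (idx (Suc i))) (model (idx i)) (\<lambda>x. restrict x (idx i))"
        by (rule morphism_model_restrict) (use Suc in blast)
    qed (use comm in \<open>auto simp: center_def\<close>)
    also have "\<dots> = \<theta>' ` center (idx (Suc i)) (\<gamma>s ! j)"
      using new_member.strict_transform_center[OF new[OF order_refl i], of "\<gamma>s ! j"] new[OF j] unfolding Suc
        by simp
    finally show ?thesis .
  qed
  then show ?thesis using iso unfolding matches_def by blast
qed

text \<open>\<open>Y\<close> is left open since two choices are used: the model itself, to be
  compared with the next stage of a given tower, and the stage of the tower built from the
  models.\<close>

lemma model_blowup_stage:
  assumes i: "i < length \<gamma>s" and m: "matches A i \<theta>"
    and iso: "inverse_morphisms (model (idx (Suc i))) Y \<theta>' \<eta>'" and Y: "fspace Y"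
    and comm: "\<And>x. x \<in> model_points (idx (Suc i)) \<Longrightarrow> \<pi> (\<theta>' x) = \<theta> (restrict x (idx i))"
  shows "is_blowup (stage G \<gamma>s A i) (transform G \<gamma>s A i (\<gamma>s ! i)) Y \<pi>"
proof -
  obtain \<eta> where \<eta>: "inverse_morphisms (model (idx i)) (stage G \<gamma>s A i) \<theta> \<eta>"
    and tr: "transform G \<gamma>s A i (\<gamma>s ! i) = \<theta> ` center (idx i) (\<gamma>s ! i)"
    using m i unfolding matches_def by blast
  have "is_blowup (model (idx i)) (center (idx i) (\<gamma>s ! i)) (model (idx (Suc i))) (\<lambda>x. restrict x (idx i))"
    unfolding stage_index_Suc[OF i] by (rule new_member.model_blowup[OF new[OF order_refl i]])
  from is_blowup_transport[OF fspace_model fspace_stage fspace_model Y \<eta> iso this] comm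
  show ?thesis unfolding tr by simp
qed

text \<open>The next model and the next stage are blow-ups of the same space along the same center.
  The isomorphism provided by uniqueness commutes with the blow-downs, and this propagates the
  strict transforms.\<close>

lemma tower_matches:
  assumes A: "blowup_tower G \<gamma>s A" and "i \<le> length \<gamma>s"
  shows "\<exists>\<theta>. matches A i \<theta>"
  using assms(2)
proof (induction i)
  case 0
  have "A 0 = (\<Pi>\<^sub>E _\<in>{edges G}. proj_simplex (edges G))" using A by (simp add: blowup_tower_def)
  then show ?case by (intro exI) (rule matches_0[of A])
next
  case (Suc i)
  then have i: "i < length \<gamma>s" by simp
  then obtain \<theta> where \<theta>: "matches A i \<theta>" using Suc.IH less_imp_le by blast
  let ?M = "model (idx (Suc i))"
  obtain \<eta> where \<eta>: "inverse_morphisms (model (idx i)) (stage G \<gamma>s A i) \<theta> \<eta>" using \<theta> unfolding matches_def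
    by blast
  have id: "inverse_morphisms ?M ?M (\<lambda>x. x) (\<lambda>x. x)" by (simp add: inverse_morphisms_def morphism_id)
  have "is_blowup (stage G \<gamma>s A i) (transform G \<gamma>s A i (\<gamma>s ! i)) ?M (\<lambda>x. \<theta> (restrict x (idx i)))"
    by (rule model_blowup_stage[OF i \<theta> id]) simp_all
  moreover have "is_blowup (stage G \<gamma>s A i) (transform G \<gamma>s A i (\<gamma>s ! i)) (stage G \<gamma>s A (Suc i))
      (blow_down G \<gamma>s i)"
    using A i unfolding blowup_tower_def by blast
  ultimately obtain \<theta>' \<eta>' where "inverse_morphisms ?M (stage G \<gamma>s A (Suc i)) \<theta>' \<eta>'"
    "\<forall>x\<in>pts ?M. blow_down G \<gamma>s i (\<theta>' x) = \<theta> (restrict x (idx i))"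
    by (rule blowup_unique[OF fspace_stage fspace_model Hausdorff_model fspace_stage Hausdorff_stage])
  then have "matches A (Suc i) \<theta>'" by (intro matches_Suc[OF i \<theta>]) simp_all
  then show ?case by blast
qed

lemma tower_exists: "\<exists>A. blowup_tower G \<gamma>s A"
proof -
  \<comment> \<open>The models embedded in products of projective spaces. Here the comparison maps
    are explicit, so the blow-up property is transported from the models.\<close>
  define A where "A i = to_proj (idx i) ` model_points (idx i)" for i
  have iso: "inverse_morphisms (model (idx i)) (stage G \<gamma>s A i) (to_proj (idx i)) (of_proj (idx i))" for i
    unfolding stage_def A_def by (rule model_to_proj) (rule finite_idx)
  have E: "finite (edges G)" using family[of 0] by (simp add: union_family_def)
  have A0: "A 0 = (\<Pi>\<^sub>E _\<in>{edges G}. proj_simplex (edges G))"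
    using to_proj_singleton[OF E, of "{}"] unfolding A_def idx_0 proj_simplex_def by simp
  have comm: "blow_down G \<gamma>s i (to_proj (idx (Suc i)) x) = to_proj (idx i) (restrict x (idx i))"
    if "i < length \<gamma>s" for i x
    unfolding blow_down_def stage_index_Suc[OF that]
      by (rule extensionalityI[OF restrict_extensional restrict_extensional]) simp
  have m: "matches A i (to_proj (idx i))" if "i \<le> length \<gamma>s" for i
    using that
  proof (induction i)
    case 0
    show ?case unfolding idx_0 by (rule matches_0[of A, OF A0])
  next
    case (Suc i)
    then have i: "i < length \<gamma>s" by simp
    have "matches A i (to_proj (idx i))" by (rule Suc.IH[OF less_imp_le[OF i]])
    then show ?case by (rule matches_Suc[OF i _ iso]) (rule comm[OF i])
  qed
  have bl: "is_blowup (stage G \<gamma>s A i) (transform G \<gamma>s A i (\<gamma>s ! i)) (stage G \<gamma>s A (Suc i)) (blow_down G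
      \<gamma>s i)" if "i < length \<gamma>s" for i
  proof (rule model_blowup_stage[OF that m[OF less_imp_le[OF that]] iso fspace_stage])
    show "blow_down G \<gamma>s i (to_proj (idx (Suc i)) x) = to_proj (idx i) (restrict x (idx i))" for x
      by (rule comm[OF that])
  qed
  have "A (Suc i) \<subseteq> pts (Prod_space (idx (Suc i)) proj_space)" for i
    unfolding A_def by (rule to_proj_image_subset)
  then show ?thesis
    unfolding blowup_tower_def by (intro exI[of _ A] conjI allI impI A0 bl)
qed

end

section \<open>Core subgraphs\<close>

abbreviation adjacency :: "('v, 'e, 'l) graph \<Rightarrow> 'e set \<Rightarrow> ('v \<times> 'v) set" where
  "adjacency G S \<equiv> {(a, b). \<exists>e\<in>S. ends G e = {a, b}}"

lemma equiv_joined: "equiv W (joined G W S)"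
proof (rule equivI)
  show "refl_on W (joined G W S)" by (auto simp: refl_on_def joined_def)
  show "joined G W S \<subseteq> W \<times> W" by (auto simp: joined_def)
  have "sym (adjacency G S)" by (auto simp: sym_def insert_commute)
  then have "sym ((adjacency G S)\<^sup>*)" by (rule sym_rtrancl)
  then show "sym (joined G W S)" unfolding joined_def sym_def by blast
  show "trans (joined G W S)" unfolding joined_def trans_def by (auto intro: rtrancl_trans)
qed

text \<open>An edge whose ends stay joined without it, in particular a self-loop, closes a cycle;
  any other edge merges two components and leaves the rank unchanged.\<close>

lemma betti_remove_edge:
  assumes W: "finite W" "a \<in> W" "b \<in> W" and S: "finite S" "e \<in> S" "ends G e = {a, b}"
  shows "betti G W S = betti G W (S - {e}) + (if (a, b) \<in> (adjacency G (S - {e}))\<^sup>* then 1 else 0)"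
proof -
  define Q R where "Q = adjacency G (S - {e})" and "R = adjacency G S"
  let ?q = "joined G W (S - {e})" and ?r = "joined G W S"
  have q: "?q = {(u, v). u \<in> W \<and> v \<in> W \<and> (u, v) \<in> Q\<^sup>*}" and r: "?r = {(u, v). u \<in> W \<and> v \<in> W \<and> (u, v) \<in> R\<^sup>*}"
    by (simp_all add: joined_def Q_def R_def)
  have "sym Q" unfolding Q_def by (auto simp: sym_def insert_commute)
  then have symQ: "(y, x) \<in> Q\<^sup>*" if "(x, y) \<in> Q\<^sup>*" for x y
    using sym_rtrancl[of Q] that by (meson symD)
  have R: "R = insert (a, b) (insert (b, a) Q)"
    unfolding R_def Q_def using S by (auto simp: doubleton_eq_iff)
  have card_S: "int (card S) = int (card (S - {e})) + 1" using S card_Suc_Diff1[of S e] by linarith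
  have "betti G W S = betti G W (S - {e}) + (if (a, b) \<in> Q\<^sup>* then 1 else 0)"
  proof (cases "(a, b) \<in> Q\<^sup>*")
    case True
    have "R\<^sup>* = Q\<^sup>*"
      by (rule rtrancl_subset) (use R True symQ[OF True] in auto)
    then have "?r = ?q" unfolding q r by simp
    then show ?thesis using True card_S by (simp add: betti_def components_def)
  next
    case False
    have Rs: "(u, v) \<in> R\<^sup>* \<longleftrightarrow> (u, v) \<in> Q\<^sup>* \<or> (u, a) \<in> Q\<^sup>* \<and> (b, v) \<in> Q\<^sup>* \<or> (u, b) \<in> Q\<^sup>* \<and> (a, v) \<in> Q\<^sup>*" for u v
      unfolding R rtrancl_insert using symQ rtrancl_trans[of _ _ Q] by blast
    have eq: "equiv W ?q" "equiv W ?r" by (rule equiv_joined)+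
    have sub: "?q \<subseteq> ?r" unfolding q r using Rs by blast
    let ?A = "?q `` {a}" and ?B = "?q `` {b}"
    have AB: "?A \<in> W // ?q" "?B \<in> W // ?q" using W by (auto intro: quotientI)
    have nAB: "?A \<noteq> ?B" using False eq_equiv_class[OF _ eq(1) W(3)] unfolding q by blast
    have fin: "finite (W // ?q)" using W(1) equiv_type[OF eq(1)] by (rule finite_quotient)
    have img: "?r `` (?q `` {u}) = ?r `` {u}" if u: "u \<in> W" for u
    proof (intro subset_antisym subsetI)
      have tr: "trans ?r" and rf: "refl_on W ?q" using eq by (simp_all add: equiv_def)
      show "v \<in> ?r `` {u}" if "v \<in> ?r `` (?q `` {u})" for v
        using that sub transD[OF tr, of u _ v] by blast
      show "v \<in> ?r `` (?q `` {u})" if "v \<in> ?r `` {u}" for v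
        using that refl_onD[OF rf u] by blast
    qed
    have Wq: "W // s = (\<lambda>u. s `` {u}) ` W" for s by (auto simp: quotient_def)
    \<comment> \<open>Old components map onto new ones, and only those of \<open>a\<close> and
      \<open>b\<close> are identified; leaving out one of the two gives a bijection.\<close>
    have surj: "(\<lambda>X. ?r `` X) ` (W // ?q) = W // ?r"
      unfolding Wq image_image by (rule image_cong[OF refl img])
    have same: "?r `` ?A = ?r `` ?B"
    proof -
      have "(a, b) \<in> ?r" using W Rs unfolding r by blast
      then show ?thesis using img W equiv_class_eq[OF eq(2)] by simp
    qed
    have surj': "(\<lambda>X. ?r `` X) ` (W // ?q - {?B}) = W // ?r"
    proof -
      have A1: "(\<lambda>X. ?r `` X) ` (W // ?q) \<subseteq> (\<lambda>X. ?r `` X) ` (W // ?q - {?B})"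
      proof (rule image_subsetI)
        fix X assume X: "X \<in> W // ?q"
        show "?r `` X \<in> (\<lambda>X. ?r `` X) ` (W // ?q - {?B})"
        proof (cases "X = ?B")
          case True
          have "?A \<in> W // ?q - {?B}" using AB nAB by blast
          then show ?thesis unfolding True same[symmetric] by (rule imageI)
        next
          case False
          then show ?thesis using X by (intro imageI) simp
        qed
      qed
      have A2: "(\<lambda>X. ?r `` X) ` (W // ?q - {?B}) \<subseteq> (\<lambda>X. ?r `` X) ` (W // ?q)" by (rule image_mono) blast
      show ?thesis using subset_antisym[OF A2 A1] surj by (rule trans)
    qed
    have inj: "inj_on (\<lambda>X. ?r `` X) (W // ?q - {?B})"
    proof (rule inj_onI)
      fix X Y assume X: "X \<in> W // ?q - {?B}" and Y: "Y \<in> W // ?q - {?B}" and XY: "?r `` X = ?r `` Y"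
      obtain u v where u: "u \<in> W" "X = ?q `` {u}" and v: "v \<in> W" "Y = ?q `` {v}"
        using X Y by (auto elim!: quotientE)
      have "?r `` {u} = ?r `` {v}" using XY img[OF u(1)] img[OF v(1)] unfolding u(2) v(2) by simp
      then have "(u, v) \<in> ?r" by (rule eq_equiv_class[OF _ eq(2) v(1)])
      moreover have "(u, b) \<notin> ?q" using X u(2) equiv_class_eq[OF eq(1), of u b] by blast
      moreover have "(v, b) \<notin> ?q" using Y v(2) equiv_class_eq[OF eq(1), of v b] by blast
      ultimately have "(u, v) \<in> ?q" using Rs symQ W(3) u v unfolding q r by blast
      then show "X = Y" unfolding u v by (rule equiv_class_eq[OF eq(1)])
    qed
    have "card (W // ?r) = card (W // ?q - {?B})" using card_image[OF inj] surj' by simp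
    moreover have "Suc (card (W // ?q - {?B})) = card (W // ?q)" by (rule card_Suc_Diff1[OF fin AB(2)])
    ultimately show ?thesis using False card_S by (simp add: betti_def components_def)
  qed
  then show ?thesis unfolding Q_def .
qed

lemma edge_ends:
  assumes "wf_graph G" "e \<in> edges G" obtains a b where "ends G e = {a, b}"
proof -
  have "card (ends G e) = 1 \<or> card (ends G e) = 2" using assms by (auto simp: wf_graph_def)
  then show thesis using that by (metis card_1_singletonE card_2_iff insert_absorb2)
qed

lemma everts_mem: "e \<in> S \<Longrightarrow> ends G e = {a, b} \<Longrightarrow> a \<in> everts G S \<and> b \<in> everts G S"
  by (auto simp: everts_def)

lemma finite_everts:
  assumes "wf_graph G" "S \<subseteq> edges G" shows "finite (everts G S)" "everts G S \<subseteq> verts G"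
proof -
  show "everts G S \<subseteq> verts G" using assms by (auto simp: wf_graph_def everts_def)
  then show "finite (everts G S)" using assms finite_subset by (auto simp: wf_graph_def)
qed

text \<open>A core is a graph without bridges. The criterion does not mention \<open>W\<close>, so
  the vertex set of the whole graph and that of the endpoints give the same notion.\<close>

lemma core_on_iff:
  assumes G: "wf_graph G" and S: "S \<subseteq> edges G" and W: "finite W" "everts G S \<subseteq> W"
  shows "core_on G W S \<longleftrightarrow> (\<forall>e\<in>S. \<forall>a b. ends G e = {a, b} \<longrightarrow> (a, b) \<in> (adjacency G (S - {e}))\<^sup>*)"
proof -
  have fin: "finite S" using G S finite_subset by (auto simp: wf_graph_def)
  have *: "betti G W (S - {e}) < betti G W S \<longleftrightarrow> (a, b) \<in> (adjacency G (S - {e}))\<^sup>*"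
    if "e \<in> S" "ends G e = {a, b}" for e a b
  proof -
    have "a \<in> W" "b \<in> W" using everts_mem[OF that] W(2) by blast+
    from betti_remove_edge[OF W(1) this fin that] show ?thesis by simp
  qed
  show ?thesis
    unfolding core_on_def
  proof (intro iffI ballI allI impI)
    fix e assume "\<forall>e\<in>S. \<forall>a b. ends G e = {a, b} \<longrightarrow> (a, b) \<in> (adjacency G (S - {e}))\<^sup>*" "e \<in> S"
    moreover obtain a b where "ends G e = {a, b}" using edge_ends[OF G] S \<open>e \<in> S\<close> by blast
    ultimately show "betti G W (S - {e}) < betti G W S" using * by blast
  qed (use * in blast)
qed

lemma adjacency_mono: "S \<subseteq> T \<Longrightarrow> (adjacency G S)\<^sup>* \<subseteq> (adjacency G T)\<^sup>*"
  by (rule rtrancl_mono) blast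

lemma cores_iff:
  assumes "wf_graph G"
  shows "\<gamma> \<in> cores G \<longleftrightarrow> \<gamma> \<subseteq> edges G \<and> \<gamma> \<noteq> {} \<and>
    (\<forall>e\<in>\<gamma>. \<forall>a b. ends G e = {a, b} \<longrightarrow> (a, b) \<in> (adjacency G (\<gamma> - {e}))\<^sup>*)"
  using core_on_iff[OF assms _ finite_everts(1)[OF assms] order_refl] unfolding cores_def by blast

text \<open>The path that bypasses an edge inside one part is still available in the union.\<close>

lemma cores_union:
  assumes G: "wf_graph G" and "\<gamma> \<in> cores G" "\<delta> \<in> cores G" shows "\<gamma> \<union> \<delta> \<in> cores G"
proof -
  have conn: "(a, b) \<in> (adjacency G (\<gamma> \<union> \<delta> - {e}))\<^sup>*" if "e \<in> \<gamma> \<union> \<delta>" "ends G e = {a, b}" for e a b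
    using assms(2,3) that adjacency_mono[of "\<gamma> - {e}" "\<gamma> \<union> \<delta> - {e}" G] adjacency_mono[of "\<delta> - {e}" "\<gamma> \<union>
        \<delta> - {e}" G]
    unfolding cores_iff[OF G] by blast
  have "\<gamma> \<subseteq> edges G" "\<gamma> \<noteq> {}" "\<delta> \<subseteq> edges G" using assms(2,3) by (simp_all add: cores_def)
  then show ?thesis unfolding cores_iff[OF G] by (intro conjI ballI allI impI conn) auto
qed

text \<open>With the vertex set fixed, the graph without edges has rank 0 and adding an edge never
  lowers the rank.\<close>

lemma betti_nonneg:
  assumes G: "wf_graph G" and W: "finite W" "everts G S \<subseteq> W" and S: "S \<subseteq> edges G"
  shows "0 \<le> betti G W S"
proof -
  have "finite S" using G S finite_subset by (auto simp: wf_graph_def)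
  then show ?thesis using W(2) S
  proof (induction S)
    case empty
    have "card (W // joined G W {}) \<ge> card W"
    proof -
      have j: "joined G W {} = Id_on W" by (auto simp: joined_def)
      have "inj_on (\<lambda>x. {x}) W" by simp
      moreover have "W // joined G W {} = (\<lambda>x. {x}) ` W" unfolding j by (auto simp: quotient_def)
      ultimately show ?thesis by (simp add: card_image)
    qed
    then show ?case by (simp add: betti_def components_def)
  next
    case (insert e S)
    obtain a b where ab: "ends G e = {a, b}" using edge_ends[OF G] insert.prems by blast
    have "a \<in> W" "b \<in> W" using everts_mem[OF insertI1 ab, of S] insert.prems by auto
    then have "betti G W (insert e S - {e}) \<le> betti G W (insert e S)"
      using betti_remove_edge[OF W(1) _ _ _ insertI1 ab, of S] insert.hyps by simp
    moreover have "0 \<le> betti G W S" using insert by (auto simp: everts_def)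
    ultimately show ?case using insert.hyps by simp
  qed
qed

text \<open>An edge of a core is bypassed inside the core, hence inside \<open>F\<close>; removing
  it would leave a graph of rank -1.\<close>

lemma forest_no_core:
  assumes G: "wf_graph G" and F: "forest G F" and \<gamma>: "\<gamma> \<in> cores G" shows "\<not> \<gamma> \<subseteq> F"
proof
  assume sub: "\<gamma> \<subseteq> F"
  obtain e where e: "e \<in> \<gamma>" using \<gamma> by (auto simp: cores_def)
  have FE: "F \<subseteq> edges G" "betti G (everts G F) F = 0" using F by (auto simp: forest_def)
  obtain a b where ab: "ends G e = {a, b}" using edge_ends[OF G] e sub FE by blast
  have "(a, b) \<in> (adjacency G (\<gamma> - {e}))\<^sup>*" using \<gamma> e ab unfolding cores_iff[OF G] by blast
  then have "(a, b) \<in> (adjacency G (F - {e}))\<^sup>*" using adjacency_mono[of "\<gamma> - {e}" "F - {e}" G] sub by blast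
  moreover have "finite F" using G FE(1) finite_subset by (auto simp: wf_graph_def)
  moreover note fin = finite_everts(1)[OF G FE(1)]
  moreover have eF: "e \<in> F" using e sub by blast
  ultimately have "betti G (everts G F) F = betti G (everts G F) (F - {e}) + 1"
    using betti_remove_edge[OF fin _ _ _ eF ab] everts_mem[OF eF ab] by simp
  moreover have "0 \<le> betti G (everts G F) (F - {e})"
    by (rule betti_nonneg[OF G fin]) (use FE in \<open>auto simp: everts_def\<close>)
  ultimately show False using FE(2) by simp
qed

section \<open>The two constructions\<close>

lemma closedin_model_points: "closedin (rtop (Prod_space I simplex_space)) (model_points I)"
proof -
  let ?P = "Prod_space I simplex_space"
  have P: "fspace ?P" by (rule fspace_Prod_space) simp
  have ptsP: "pts ?P = (\<Pi>\<^sub>E \<gamma>\<in>I. std_simplex \<gamma>)"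
    unfolding rtop_Prod_space topspace_product_topology o_def pts_simplex_space ..
  have c: "(\<lambda>x. x \<gamma> e) \<in> reg ?P (pts ?P)" if "\<gamma> \<in> I" "e \<in> \<gamma>" for \<gamma> e
  proof -
    have "morphism ?P (affine_space \<gamma>) (\<lambda>x. x \<gamma>)"
      by (rule morphism_sub_space_cod[OF fspace_affine_space morphism_Prod_proj[OF that(1)]])
    moreover have "x \<gamma> \<in> extensional \<gamma>" if "x \<in> pts ?P" for x
      using that \<open>\<gamma> \<in> I\<close> unfolding ptsP by (auto simp: std_simplex_def PiE_iff)
    ultimately show ?thesis using morphism_affine_space[OF P, of "\<lambda>x. x \<gamma>" \<gamma>] that(2) by blast
  qed
  let ?K = "{(\<eta>, \<gamma>, e). \<eta> \<in> I \<and> \<gamma> \<in> I \<and> \<gamma> \<subseteq> \<eta> \<and> e \<in> \<gamma>}"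
  let ?N = "\<lambda>(\<eta>, \<gamma>, e). {x \<in> pts ?P. x \<eta> e - (\<Sum>e'\<in>\<gamma>. x \<eta> e') * x \<gamma> e \<noteq> 0}"
  have "openin (rtop ?P) (?N t)" if t: "t \<in> ?K" for t
  proof -
    obtain \<eta> \<gamma> e where t': "t = (\<eta>, \<gamma>, e)" "\<eta> \<in> I" "\<gamma> \<in> I" "\<gamma> \<subseteq> \<eta>" "e \<in> \<gamma>" using t by blast
    have "(\<lambda>x. x \<eta> e - (\<Sum>e'\<in>\<gamma>. x \<eta> e') * x \<gamma> e) \<in> reg ?P (pts ?P)"
      by (intro fspace.reg_diff[OF P] fspace.reg_mult[OF P] fspace.reg_sum[OF P] openin_topspace c) (use
          t' in auto)
    from fspace.reg_nonzero_open[OF P this] show ?thesis unfolding t'(1) prod.case .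
  qed
  then have "openin (rtop ?P) (\<Union>t\<in>?K. ?N t)" by (intro openin_Union) blast
  moreover have "(\<Union>t\<in>?K. ?N t) = pts ?P - model_points I"
  proof (intro subset_antisym subsetI)
    fix x assume "x \<in> (\<Union>t\<in>?K. ?N t)"
    then obtain \<eta> \<gamma> e where "\<eta> \<in> I" "\<gamma> \<in> I" "\<gamma> \<subseteq> \<eta>" "e \<in> \<gamma>" "x \<in> ?N (\<eta>, \<gamma>, e)" by blast
    then show "x \<in> pts ?P - model_points I" using model_pointsD(4)[of x I \<gamma> \<eta> e] by auto
  next
    fix x assume x: "x \<in> pts ?P - model_points I"
    then have "\<not> (\<forall>\<eta>\<in>I. \<forall>\<gamma>\<in>I. \<gamma> \<subseteq> \<eta> \<longrightarrow> (\<forall>e\<in>\<gamma>. x \<eta> e = (\<Sum>e'\<in>\<gamma>. x \<eta> e') * x \<gamma> e))"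
      unfolding ptsP model_points_def by blast
    then obtain \<eta> \<gamma> e where t: "\<eta> \<in> I" "\<gamma> \<in> I" "\<gamma> \<subseteq> \<eta>" "e \<in> \<gamma>" "x \<eta> e \<noteq> (\<Sum>e'\<in>\<gamma>. x \<eta> e') * x \<gamma> e"
      by blast
    then have "x \<in> ?N (\<eta>, \<gamma>, e)" using x by simp
    then show "x \<in> (\<Union>t\<in>?K. ?N t)" using t by (intro UN_I[of "(\<eta>, \<gamma>, e)"]) simp_all
  qed
  moreover have "model_points I \<subseteq> pts ?P" unfolding ptsP model_points_def by blast
  ultimately show ?thesis unfolding closedin_def by simp
qed

text \<open>An equality and not merely an isomorphism: both are the subspace structure of the same
  product of simplices on the same set of points.\<close>

lemma closure_cell_eq_model:
  assumes G: "wf_graph G" and E: "edges G \<in> cores G" and fam: "union_family (edges G) (cores G)"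
  shows "closure_cell G = model (cores G)"
proof -
  interpret union_family "edges G" "cores G" by (rule fam)
  let ?P = "Prod_space (cores G) simplex_space"
  have P: "simplex_product G = ?P" by (simp add: simplex_product_def)
  have rm: "rmap G x \<in> model_points (cores G)" if x: "x \<in> open_cell G" for x
  proof -
    have xs: "x \<in> std_simplex (edges G)" and f: "forest G {e \<in> edges G. x e = 0}" using x
      by (auto simp: open_cell_def)
    have nn: "0 \<le> x e" if "e \<in> edges G" for e using xs that by (simp add: std_simplex_def)
    \<comment> \<open>On the faces belonging to the cell only a forest is collapsed, so every core
      subgraph keeps positive volume and the rescaling is meaningful.\<close>
    have s: "sum x \<gamma> \<noteq> 0" if \<gamma>: "\<gamma> \<in> cores G" for \<gamma>
    proof -
      have "\<not> \<gamma> \<subseteq> {e \<in> edges G. x e = 0}" by (rule forest_no_core[OF G f \<gamma>])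
      then obtain e where "e \<in> \<gamma>" "x e \<noteq> 0" using members[OF \<gamma>] by blast
      then have "0 < sum x \<gamma>" using finite_member[OF \<gamma>] nn members[OF \<gamma>]
        by (intro sum_pos2[of _ e]) (auto simp: less_le)
      then show ?thesis by simp
    qed
    show ?thesis
      unfolding model_points_def
    proof (intro CollectI conjI ballI impI PiE_I)
      show "rmap G x \<gamma> \<in> std_simplex \<gamma>" if "\<gamma> \<in> cores G" for \<gamma>
        using that s[OF that] nn members[OF that] by (auto simp: rmap_def intro!: rescale_in_std_simplex)
      fix \<eta> \<gamma> e assume *: "\<eta> \<in> cores G" "\<gamma> \<in> cores G" "\<gamma> \<subseteq> \<eta>" "e \<in> \<gamma>"
      have "sum (rmap G x \<eta>) \<gamma> = (\<Sum>e\<in>\<gamma>. x e / sum x \<eta>)"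
        by (rule sum.cong) (use * in \<open>auto simp: rmap_def rescale_def\<close>)
      also have "\<dots> = sum x \<gamma> / sum x \<eta>" by (simp add: sum_divide_distrib)
      finally show "rmap G x \<eta> e = sum (rmap G x \<eta>) \<gamma> * rmap G x \<gamma> e"
        using * s[OF *(2)] by (auto simp: rmap_def rescale_def)
    qed (simp add: rmap_def)
  qed
  have pos: "positive_points \<subseteq> rmap G ` open_cell G"
  proof
    fix x assume "x \<in> positive_points"
    then have x: "x \<in> model_points (cores G)" "\<And>\<gamma> e. \<gamma> \<in> cores G \<Longrightarrow> e \<in> \<gamma> \<Longrightarrow> 0 < x \<gamma> e"
      by (auto simp: positive_points_def)
    let ?x = "x (edges G)"
    have "rmap G ?x = x"
    proof (rule extensionalityI[of _ "cores G"])
      show "x \<in> extensional (cores G)" using x(1) by (simp add: model_points_def PiE_def)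
      fix \<gamma> assume \<gamma>: "\<gamma> \<in> cores G"
      have "0 < sum ?x \<gamma>" using x(2)[OF E] members[OF \<gamma>] finite_member[OF \<gamma>] by (intro sum_pos) auto
      then have "sum ?x \<gamma> \<noteq> 0" by simp
      then have "rescale \<gamma> ?x = rescale \<gamma> (x \<gamma>)"
        by (rule rescale_scale[OF _ model_pointsD(4)[OF x(1) \<gamma> E]]) (use members[OF \<gamma>] in blast)+
      then show "rmap G ?x \<gamma> = x \<gamma>" using \<gamma> rescale_std_simplex[OF model_pointsD(1)[OF x(1) \<gamma>]]
        by (simp add: rmap_def)
    qed (simp add: rmap_def)
    \<comment> \<open>The component at \<open>edges G\<close> is positive, so the point of the cell
      lies in the open simplex, where the collapsed forest is empty.\<close>
    moreover have z: "{e \<in> edges G. ?x e = 0} = {}" using x(2)[OF E] by force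
    have "forest G {}" by (simp add: forest_def betti_def components_def everts_def quotient_def)
    then have "?x \<in> open_cell G"
      using model_pointsD(1)[OF x(1) E] unfolding open_cell_def by (simp only: mem_Collect_eq z)
    ultimately show "x \<in> rmap G ` open_cell G" by (metis imageI)
  qed
  have "rtop ?P closure_of (rmap G ` open_cell G) = model_points (cores G)"
  proof
    show "rtop ?P closure_of (rmap G ` open_cell G) \<subseteq> model_points (cores G)"
      by (rule closure_of_minimal[OF _ closedin_model_points]) (use rm in blast)
    have "model_points (cores G) \<subseteq> rtop ?P closure_of positive_points"
      using positive_points_dense closure_of_subtopology_subset[of "rtop ?P" "model_points (cores G)"
          positive_points]
      unfolding model_def rtop_sub_space by simp
    then show "model_points (cores G) \<subseteq> rtop ?P closure_of (rmap G ` open_cell G)"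
      using closure_of_mono[OF pos] by blast
  qed
  then show ?thesis unfolding closure_cell_def P model_def by simp
qed

text \<open>Increasing dimension of the faces means decreasing number of edges. A union that differs
  from the indexed part \<alpha> has more edges than \<alpha>, so it is the whole graph or precedes
  \<alpha> in the list.\<close>

lemma blowup_order_sequence:
  assumes G: "wf_graph G" and E: "edges G \<in> cores G" and ord: "blowup_order G \<gamma>s"
  shows "blowup_sequence G \<gamma>s"
proof (rule blowup_sequence.intro)
  have finE: "finite (edges G)" using G by (simp add: wf_graph_def)
  have nth_core: "\<gamma>s ! j \<in> cores G" "\<gamma>s ! j \<noteq> edges G" if "j < length \<gamma>s" for j
    using ord nth_mem[OF that] by (auto simp: blowup_order_def proper_cores_def)
  have fin: "finite \<gamma>" if "\<gamma> \<in> cores G" for \<gamma> using that finE finite_subset by (auto simp: cores_def)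
  have idx_cases: "\<alpha> = edges G \<or> (\<exists>a<i. a < length \<gamma>s \<and> \<alpha> = \<gamma>s ! a)" if "\<alpha> \<in> stage_index G \<gamma>s i" for \<alpha> i
    using that by (auto simp: stage_index_def in_set_conv_nth)
  have idx_nth: "\<gamma>s ! a \<in> stage_index G \<gamma>s i" if "a < i" "a < length \<gamma>s" for a i
    using that by (auto simp: stage_index_def in_set_conv_nth intro!: exI[of _ a])
  have idx_core: "\<alpha> \<in> cores G" if "\<alpha> \<in> stage_index G \<gamma>s i" for \<alpha> i
    using idx_cases[OF that] nth_core E by blast
  have sorted: "card (\<gamma>s ! b) \<le> card (\<gamma>s ! a)" if "a < b" "b < length \<gamma>s" for a b
  proof -
    have "sorted_wrt (\<lambda>\<gamma> \<delta>. L_dim G \<gamma> \<le> L_dim G \<delta>) \<gamma>s" using ord by (simp add: blowup_order_def)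
    then have "L_dim G (\<gamma>s ! a) \<le> L_dim G (\<gamma>s ! b)" using that by (simp add: sorted_wrt_iff_nth_less)
    then show ?thesis by (simp add: L_dim_def)
  qed
  have union: "\<alpha> \<union> \<beta> \<in> stage_index G \<gamma>s i" if \<alpha>: "\<alpha> \<in> stage_index G \<gamma>s i" and \<beta>: "\<beta> \<in> cores G" for \<alpha> \<beta> i
  proof -
    have u: "\<alpha> \<union> \<beta> \<in> cores G" by (rule cores_union[OF G idx_core[OF \<alpha>] \<beta>])
    consider "\<alpha> = edges G" | "\<alpha> \<union> \<beta> = edges G" | a where "a < i" "a < length \<gamma>s" "\<alpha> = \<gamma>s ! a" "\<alpha> \<union> \<beta> \<noteq> edges G"
      using idx_cases[OF \<alpha>] by blast
    then show ?thesis
    proof cases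
      case 1
      then have "\<alpha> \<union> \<beta> = \<alpha>" using \<beta> by (auto simp: cores_def)
      then show ?thesis using \<alpha> by simp
    next
      case 2
      then show ?thesis by (simp add: stage_index_def)
    next
      case 3
      then have "\<alpha> \<union> \<beta> \<in> set \<gamma>s" using u ord by (auto simp: blowup_order_def proper_cores_def)
      then obtain c where c: "c < length \<gamma>s" "\<alpha> \<union> \<beta> = \<gamma>s ! c" by (metis in_set_conv_nth)
      show ?thesis
      proof (cases "c < i")
        case True
        then show ?thesis using idx_nth[OF True c(1)] c(2) by simp
      next
        case False
        \<comment> \<open>The union stands at position \<open>c\<close>, beyond \<alpha> at position
          \<open>a\<close>; so it has no more edges than \<alpha> and equals it.\<close>
        then have "card (\<alpha> \<union> \<beta>) \<le> card \<alpha>" using sorted[of a c] 3 c by simp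
        then have "\<alpha> = \<alpha> \<union> \<beta>" using fin[OF u] by (intro card_seteq) auto
        then show ?thesis using \<alpha> by simp
      qed
    qed
  qed
  show fam: "union_family (edges G) (stage_index G \<gamma>s i)" for i
  proof
    show "edges G \<in> stage_index G \<gamma>s i" by (simp add: stage_index_def)
    show "\<gamma> \<subseteq> edges G \<and> \<gamma> \<noteq> {}" if "\<gamma> \<in> stage_index G \<gamma>s i" for \<gamma> using idx_core[OF that]
      by (auto simp: cores_def)
  qed (use finE union idx_core in auto)
  fix i j assume ij: "i \<le> j" "j < length \<gamma>s"
  interpret union_family "edges G" "stage_index G \<gamma>s i" by (rule fam)
  show "new_member (edges G) (stage_index G \<gamma>s i) (\<gamma>s ! j)"
  proof
    show "\<gamma>s ! j \<subseteq> edges G" "\<gamma>s ! j \<noteq> {}" using nth_core[OF ij(2)] by (auto simp: cores_def)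
    show "\<eta> \<union> \<gamma>s ! j \<in> stage_index G \<gamma>s i" if "\<eta> \<in> stage_index G \<gamma>s i" for \<eta>
      by (rule union[OF that nth_core(1)[OF ij(2)]])
    show "\<not> \<eta> \<subseteq> \<gamma>s ! j" if \<eta>: "\<eta> \<in> stage_index G \<gamma>s i" for \<eta>
    proof
      assume sub: "\<eta> \<subseteq> \<gamma>s ! j"
      have "\<eta> \<noteq> edges G" using sub nth_core[OF ij(2)] by (auto simp: cores_def)
      then obtain a where a: "a < i" "a < length \<gamma>s" "\<eta> = \<gamma>s ! a" using idx_cases[OF \<eta>] by blast
      \<comment> \<open>An earlier subgraph has at least as many edges, so inclusion forces
        equality, against distinctness of the list.\<close>
      have "card (\<gamma>s ! j) \<le> card \<eta>" unfolding a(3) by (rule sorted) (use a ij in auto)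
      then have "\<eta> = \<gamma>s ! j" using sub fin[OF nth_core(1)[OF ij(2)]] by (intro card_seteq)
      then show False using a ij ord by (auto simp: blowup_order_def nth_eq_iff_index_eq)
    qed
  qed
qed

text \<open>Every map out of an empty space is a morphism, and smoothness is vacuous; covers graphs
  without internal edges.\<close>

lemma isomorphic_smooth_empty:
  assumes "fspace X" "fspace Y" "pts X = {}" "pts Y = {}"
  shows "isomorphic_smooth_varieties X Y"
proof -
  have m: "morphism A B \<phi>" if A: "fspace A" "pts A = {}" and B: "pts B = {}" for A B and \<phi> :: "'c \<Rightarrow> 'd"
  proof -
    have "f \<in> reg A {}" for f by (rule fspace.reg_local[OF A(1)]) auto
    then show ?thesis using A B by (auto simp: morphism_def continuous_map_def)
  qed
  show ?thesis
    unfolding isomorphic_smooth_varieties_def smooth_variety_def isomorphism_def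
    using assms m[of X Y] m[of Y X] by auto
qed

theorem proposition4p5:
  fixes G :: "('v, 'e, 'l) graph" and n k N :: nat
  assumes "admissible G n k" and "card (edges G) = N"
  shows "\<forall>\<gamma>s. blowup_order G \<gamma>s \<longrightarrow>
    (\<exists>Y. is_blowup_cell G \<gamma>s Y) \<and>
    (\<forall>Y. is_blowup_cell G \<gamma>s Y \<longrightarrow> isomorphic_smooth_varieties (closure_cell G) Y)"
proof (intro allI impI)
  fix \<gamma>s assume ord: "blowup_order G \<gamma>s"
  have G: "wf_graph G" and core: "core_on G (verts G) (edges G)" using assms(1) by (auto simp: admissible_def)
  have cell_iff: "(\<exists>Y. is_blowup_cell G \<gamma>s Y) \<longleftrightarrow> (\<exists>A. blowup_tower G \<gamma>s A)"
    unfolding is_blowup_cell_def by simp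
  show "(\<exists>Y. is_blowup_cell G \<gamma>s Y) \<and> (\<forall>Y. is_blowup_cell G \<gamma>s Y \<longrightarrow> isomorphic_smooth_varieties
      (closure_cell G) Y)"
  proof (cases "edges G = {}")
    \<comment> \<open>A single vertex with legs. The empty edge set is not a core, so the general
      argument has no top member; both cells are empty because the coordinates of a metric would
      have to sum to 1.\<close>
    case True
    have "proper_cores G = {}" unfolding proper_cores_def cores_def True by blast
    then have \<gamma>s: "\<gamma>s = []" using ord by (simp add: blowup_order_def)
    have empty: "proj_simplex (edges G) = {}" "open_cell G = {}"
      by (simp_all add: True proj_simplex_def nonzero_vectors_def open_cell_def std_simplex_def)
    have "\<exists>A. blowup_tower G \<gamma>s A"
      by (rule exI[of _ "\<lambda>_. \<Pi>\<^sub>E _\<in>{edges G}. proj_simplex (edges G)"]) (simp add: blowup_tower_def \<gamma>s)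
    moreover have "isomorphic_smooth_varieties (closure_cell G) Y" if Y: "is_blowup_cell G \<gamma>s Y" for Y
    proof -
      obtain A where A: "blowup_tower G \<gamma>s A" "Y = stage G \<gamma>s A (length \<gamma>s)"
        using Y unfolding is_blowup_cell_def by (elim exE conjE)
      have "A 0 = {}" using A(1) empty(1) by (simp add: blowup_tower_def PiE_eq_empty_iff)
      then have "A (length \<gamma>s) = {}" by (simp add: \<gamma>s)
      then have pY: "pts Y = {}" unfolding A(2) stage_def rtop_sub_space topspace_subtopology by simp
      have pC: "pts (closure_cell G) = {}"
        unfolding closure_cell_def rtop_sub_space topspace_subtopology empty(2) by simp
      have "fspace Y" unfolding A(2) stage_def by (intro fspace_sub_space fspace_Prod_space fspace_proj_space)
      moreover have "fspace (closure_cell G)"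
        unfolding closure_cell_def simplex_product_def
          by (intro fspace_sub_space fspace_Prod_space fspace_affine_space)
      ultimately show ?thesis using pY pC by (intro isomorphic_smooth_empty)
    qed
    ultimately show ?thesis by (simp add: cell_iff)
  next
    case False
    have "everts G (edges G) \<subseteq> verts G" "finite (verts G)" using finite_everts(2)[OF G] G
      by (auto simp: wf_graph_def)
    \<comment> \<open>Admissibility gives the core property on all vertices, \<open>cores\<close>
      asks for it on endpoints of edges; the bridge criterion is the same for both.\<close>
    then have E: "edges G \<in> cores G"
      using core core_on_iff[OF G order_refl, of "verts G"] False unfolding cores_iff[OF G] by blast
    interpret blowup_sequence G \<gamma>s by (rule blowup_order_sequence[OF G E ord])
    have idx: "idx (length \<gamma>s) = cores G" using ord E
      by (auto simp: stage_index_def blowup_order_def proper_cores_def)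
    have fam: "union_family (edges G) (cores G)" using family[of "length \<gamma>s"] unfolding idx .
    have "isomorphic_smooth_varieties (closure_cell G) Y" if Y: "is_blowup_cell G \<gamma>s Y" for Y
    proof -
      obtain A where A: "blowup_tower G \<gamma>s A" "Y = stage G \<gamma>s A (length \<gamma>s)"
        using Y unfolding is_blowup_cell_def by (elim exE conjE)
      obtain \<theta> \<eta> where iso: "inverse_morphisms (model (cores G)) Y \<theta> \<eta>"
        using tower_matches[OF A(1) order_refl] unfolding matches_def idx A(2) by (elim exE conjE)
      have "smooth_variety (model (cores G))" by (rule union_family.smooth_model[OF fam])
      moreover have "smooth_variety Y"
        by (rule smooth_variety_transfer[OF fspace_model _ iso calculation]) (simp add: A(2) fspace_stage)
      ultimately show ?thesis
        using iso unfolding isomorphic_smooth_varieties_def closure_cell_eq_model[OF G E fam] isomorphism_iff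
        by (intro conjI exI)
    qed
    then show ?thesis using tower_exists by (simp add: cell_iff)
  qed
qed

end
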